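(* Fix an integer $k\ge 2$. There is an algorithm which, given $n$, after a preprocessing phase using $O(n^{k+1})$ time and $O(n^{k})$ space, generates a random $k$-noncrossing partial matching on $[n]=\{1,\dots,n\}$ such that every $k$-noncrossing partial matching on $[n]$ is output with the same probability $1/f_k^*(n)$; each such random $k$-noncrossing partial matching is generated with $O(n)$ time and space complexity.
   Context: A partial matching on $[n]$ is a graph on vertex set $[n]$ in which every vertex has degree at most one; an edge (arc) is written $(i,j)$ with $i<j$. A $k$-crossing is a set of $k$ arcs $(i_1,j_1),\dots,(i_k,j_k)$ with $i_1<i_2<\dots<i_k<j_1<j_2<\dots<j_k$. A partial matching is $k$-noncrossing if it contains no $k$-crossing. $f_k^*(n)$ denotes the number of $k$-noncrossing partial matchings on $[n]$. *)

theory Defs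
  imports "HOL-Probability.Probability" "HOL-Library.Landau_Symbols"
begin

section \<open>Noncrossing partial matchings\<close>

text \<open>A graph on \<open>[n]\<close> is given by its set of arcs \<open>(i, j)\<close> with \<open>i < j\<close>.\<close>

definition partial_matching :: "nat \<Rightarrow> (nat \<times> nat) set \<Rightarrow> bool" where
  "partial_matching n \<mu> \<longleftrightarrow>
     \<mu> \<subseteq> {(i, j). 1 \<le> i \<and> i < j \<and> j \<le> n} \<and>
     (\<forall>v\<in>{1..n}. card {e \<in> \<mu>. v = fst e \<or> v = snd e} \<le> 1)"

definition is_crossing :: "nat \<Rightarrow> (nat \<times> nat) set \<Rightarrow> bool" where
  "is_crossing k S \<longleftrightarrow>
     (\<exists>i j :: nat \<Rightarrow> nat. S = (\<lambda>r. (i r, j r)) ` {1..k} \<and>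
        strict_mono_on {1..k} i \<and> i k < j 1 \<and> strict_mono_on {1..k} j)"

definition noncrossing :: "nat \<Rightarrow> (nat \<times> nat) set \<Rightarrow> bool" where
  "noncrossing k \<mu> \<longleftrightarrow> \<not> (\<exists>S \<subseteq> \<mu>. is_crossing k S)"

definition nc_matchings :: "nat \<Rightarrow> nat \<Rightarrow> (nat \<times> nat) set set" where
  "nc_matchings k n = {\<mu>. partial_matching n \<mu> \<and> noncrossing k \<mu>}"

definition fstar :: "nat \<Rightarrow> nat \<Rightarrow> nat" where
  "fstar k n = card (nc_matchings k n)"

text \<open>Machine output: the list of the partners of \<open>1, \<dots>, n\<close>, with \<open>0\<close> for an isolated vertex.\<close>

definition partner :: "(nat \<times> nat) set \<Rightarrow> nat \<Rightarrow> nat" where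
  "partner \<mu> v =
     (if \<exists>u. (u, v) \<in> \<mu> \<or> (v, u) \<in> \<mu> then THE u. (u, v) \<in> \<mu> \<or> (v, u) \<in> \<mu> else 0)"

definition encode :: "nat \<Rightarrow> (nat \<times> nat) set \<Rightarrow> nat list" where
  "encode n \<mu> = map (partner \<mu>) [1..<Suc n]"


section \<open>Randomized word RAM\<close>

text \<open>
  Programs of a random access machine with structured control flow. The registers are addressed by
  natural numbers and hold words of \<open>w\<close> bits, and arithmetic is truncated to a word. The word
  length has to be linear in \<open>n\<close> for a word to hold a count such as \<open>fstar k n\<close>, and the bound keeps
  the number of registers a meaningful measure of space. Every step has unit cost, including the
  drawing of a uniformly distributed number below the content of a register: exact uniform
  sampling in bounded time is impossible with fair coin flips alone.
\<close>

type_synonym mem = "nat \<Rightarrow> nat"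

datatype binop = Add | Sub | Mul | Div | And

fun eval_op :: "binop \<Rightarrow> nat \<Rightarrow> nat \<Rightarrow> nat" where
  "eval_op Add x y = x + y"
| "eval_op Sub x y = x - y"
| "eval_op Mul x y = x * y"
| "eval_op Div x y = x div y"
| "eval_op And x y = semiring_bit_operations_class.and x y"

datatype com =
    Const nat nat           \<comment> \<open>\<open>M[d] := v\<close>\<close>
  | Op binop nat nat nat    \<comment> \<open>\<open>M[d] := M[a] op M[b]\<close>\<close>
  | Load nat nat            \<comment> \<open>\<open>M[d] := M[M[a]]\<close>\<close>
  | Store nat nat           \<comment> \<open>\<open>M[M[a]] := M[b]\<close>\<close>
  | Rand nat nat            \<comment> \<open>\<open>M[d] :=\<close> uniform in \<open>{..<M[a]}\<close>\<close>
  | Write nat               \<comment> \<open>append \<open>M[a]\<close> to the output\<close>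
  | Seq com com
  | Cond nat com com        \<comment> \<open>condition \<open>M[a] \<noteq> 0\<close>\<close>
  | While nat com           \<comment> \<open>condition \<open>M[a] \<noteq> 0\<close>\<close>

text \<open>\<open>used\<close> collects the registers read or written so far; its size is the space consumption.\<close>

record conf =
  code :: "com list"
  mem :: mem
  used :: "nat set"
  out :: "nat list"

fun accesses :: "mem \<Rightarrow> com \<Rightarrow> nat set" where
  "accesses M (Const d v) = {d}"
| "accesses M (Op f d a b) = {d, a, b}"
| "accesses M (Load d a) = {d, a, M a}"
| "accesses M (Store a b) = {a, M a, b}"
| "accesses M (Rand d a) = {d, a}"
| "accesses M (Write a) = {a}"
| "accesses M (Seq c1 c2) = {}"
| "accesses M (Cond a c1 c2) = {a}"
| "accesses M (While a c) = {a}"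

definition uniform_below :: "nat \<Rightarrow> nat pmf" where
  "uniform_below m = (if m = 0 then return_pmf 0 else pmf_of_set {..<m})"

fun exec :: "nat \<Rightarrow> com \<Rightarrow> com list \<Rightarrow> mem \<Rightarrow> nat set \<Rightarrow> nat list \<Rightarrow> conf pmf" where
  "exec w (Const d v) cs M U xs =
     return_pmf \<lparr>code = cs, mem = M(d := v mod 2 ^ w), used = U, out = xs\<rparr>"
| "exec w (Op f d a b) cs M U xs =
     return_pmf \<lparr>code = cs, mem = M(d := eval_op f (M a) (M b) mod 2 ^ w), used = U, out = xs\<rparr>"
| "exec w (Load d a) cs M U xs =
     return_pmf \<lparr>code = cs, mem = M(d := M (M a)), used = U, out = xs\<rparr>"
| "exec w (Store a b) cs M U xs =
     return_pmf \<lparr>code = cs, mem = M(M a := M b), used = U, out = xs\<rparr>"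
| "exec w (Rand d a) cs M U xs =
     map_pmf (\<lambda>r. \<lparr>code = cs, mem = M(d := r), used = U, out = xs\<rparr>) (uniform_below (M a))"
| "exec w (Write a) cs M U xs =
     return_pmf \<lparr>code = cs, mem = M, used = U, out = xs @ [M a]\<rparr>"
| "exec w (Seq c1 c2) cs M U xs =
     return_pmf \<lparr>code = c1 # c2 # cs, mem = M, used = U, out = xs\<rparr>"
| "exec w (Cond a c1 c2) cs M U xs =
     return_pmf \<lparr>code = (if M a \<noteq> 0 then c1 else c2) # cs, mem = M, used = U, out = xs\<rparr>"
| "exec w (While a c) cs M U xs =
     return_pmf \<lparr>code = (if M a \<noteq> 0 then c # While a c # cs else cs), mem = M, used = U, out = xs\<rparr>"

text \<open>A configuration with empty code has halted and is never left.\<close>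

definition step :: "nat \<Rightarrow> conf \<Rightarrow> conf pmf" where
  "step w s = (case code s of
       [] \<Rightarrow> return_pmf s
     | c # cs \<Rightarrow> exec w c cs (mem s) (used s \<union> accesses (mem s) c) (out s))"

primrec steps :: "nat \<Rightarrow> nat \<Rightarrow> conf \<Rightarrow> conf pmf" where
  "steps w 0 s = return_pmf s"
| "steps w (Suc t) s = bind_pmf (step w s) (steps w t)"

definition run :: "nat \<Rightarrow> com \<Rightarrow> mem \<Rightarrow> nat \<Rightarrow> conf pmf" where
  "run w c M t = steps w t \<lparr>code = [c], mem = M, used = {}, out = []\<rparr>"

text \<open>Worst case over all random choices.\<close>

definition runs_within :: "nat \<Rightarrow> com \<Rightarrow> mem \<Rightarrow> nat \<Rightarrow> nat \<Rightarrow> bool" where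
  "runs_within w c M t s \<longleftrightarrow>
     (\<forall>s' \<in> set_pmf (run w c M t). code s' = [] \<and> card (used s') \<le> s)"

definition final_mems :: "nat \<Rightarrow> com \<Rightarrow> mem \<Rightarrow> mem set" where
  "final_mems w c M = {mem s' | s' t. s' \<in> set_pmf (run w c M t) \<and> code s' = []}"

definition input :: "nat \<Rightarrow> mem" where
  "input n = (\<lambda>_. 0)(0 := n)"

text \<open>
  The memories in which the generator \<open>G\<close> can be started: those left by the preprocessing \<open>P\<close>
  on input \<open>n\<close>, possibly followed by any number of earlier runs of \<open>G\<close>.
\<close>

inductive_set ready :: "nat \<Rightarrow> com \<Rightarrow> com \<Rightarrow> nat \<Rightarrow> mem set"
  for w :: nat and P G :: com and n :: nat where
  preprocessed: "M \<in> final_mems w P (input n) \<Longrightarrow> M \<in> ready w P G n"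
| generated: "M \<in> ready w P G n \<Longrightarrow> M' \<in> final_mems w G M \<Longrightarrow> M' \<in> ready w P G n"

end

theory Submission imports Defs begin

text \<open>
  Reading a matching from right to left, insert the opener of every closer by row insertion and delete
  every opener when it is reached. The resulting tableaux have at most \<open>k - 1\<close> rows iff there is no
  \<open>k\<close>-crossing, since the number of rows is the length of a longest decreasing subsequence of the
  openers of the arcs that are open simultaneously. Read from left to right, the shapes form a closed
  lattice walk in a Weyl chamber with \<open>n\<close> steps, and reverse row insertion recovers the matching from
  the walk.

  The numbers of ways to complete a walk depend only on the shape and the remaining time, and are
  tabulated by dynamic programming with \<open>O(n ^ k)\<close> entries. A single random number below the total is
  then unranked step by step. As a word has more than \<open>n\<close> bits, each row of the tableau is kept as a
  bit set in one register, and a reverse insertion costs \<open>O(k)\<close> word operations.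
\<close>

section \<open>Row insertion and decreasing subsequences\<close>

definition below :: "nat set \<Rightarrow> nat \<Rightarrow> nat" where
  "below R m = card (R \<inter> {..<m})"

fun hd_row :: "nat set list \<Rightarrow> nat set" where
  "hd_row [] = {}"
| "hd_row (R # Rs) = R"

text \<open>
  Rows are sets of entries. Comparing the numbers of entries below every threshold says that the
  columns increase; trailing rows may be empty.
\<close>

fun tableau :: "nat set list \<Rightarrow> bool" where
  "tableau [] \<longleftrightarrow> True"
| "tableau (R # Rs) \<longleftrightarrow> finite R \<and> R \<inter> \<Union>(set Rs) = {} \<and>
     (\<forall>m. below (hd_row Rs) m \<le> below R m) \<and> tableau Rs"

fun row_insert :: "nat \<Rightarrow> nat set list \<Rightarrow> nat set list" where
  "row_insert x [] = [{x}]"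
| "row_insert x (R # Rs) =
     (if \<exists>y\<in>R. x < y
      then insert x (R - {Min {y\<in>R. x < y}}) # row_insert (Min {y\<in>R. x < y}) Rs
      else insert x R # Rs)"

fun landing :: "nat \<Rightarrow> nat set list \<Rightarrow> nat" where
  "landing x [] = 0"
| "landing x (R # Rs) = (if \<exists>y\<in>R. x < y then Suc (landing (Min {y\<in>R. x < y}) Rs) else 0)"

fun row_extract :: "nat \<Rightarrow> nat set list \<Rightarrow> nat \<times> nat set list" where
  "row_extract r [] = (0, [])"
| "row_extract 0 (R # Rs) = (Max R, (R - {Max R}) # Rs)"
| "row_extract (Suc r) (R # Rs) =
     (let (y, Rs') = row_extract r Rs; z = Max {z\<in>R. z < y} in (z, insert y (R - {z}) # Rs'))"

definition row :: "nat set list \<Rightarrow> nat \<Rightarrow> nat set" where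
  "row T r = (if r < length T then T ! r else {})"

lemma row_simps [simp]:
  "row [] r = {}" "row (R # Rs) 0 = R" "row (R # Rs) (Suc r) = row Rs r"
  by (auto simp: row_def)

lemma row_0: "row T 0 = hd_row T"
  by (cases T) auto

lemma hd_row_subset: "hd_row T \<subseteq> \<Union>(set T)"
  by (cases T) auto

lemma row_subset: "row T r \<subseteq> \<Union>(set T)"
  by (auto simp: row_def intro!: bexI[OF _ nth_mem])

lemma below_mono: "m \<le> m' \<Longrightarrow> below R m \<le> below R m'"
  unfolding below_def by (intro card_mono) auto

lemma below_insert:
  "x \<notin> R \<Longrightarrow> below (insert x R) m = below R m + of_bool (x < m)"
  by (auto simp: below_def)

lemma below_remove:
  "x \<in> R \<Longrightarrow> below (R - {x}) m = below R m - of_bool (x < m)"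
proof -
  assume "x \<in> R"
  then have "below (insert x (R - {x})) m = below (R - {x}) m + of_bool (x < m)"
    by (intro below_insert) auto
  moreover have "insert x (R - {x}) = R" using \<open>x \<in> R\<close> by auto
  ultimately show ?thesis by simp
qed

lemma below_Suc: "below R (Suc m) = below R m + of_bool (m \<in> R)"
proof -
  have "R \<inter> {..<Suc m} = (if m \<in> R then insert m (R \<inter> {..<m}) else R \<inter> {..<m})"
    by (auto simp: less_Suc_eq)
  then show ?thesis by (auto simp: below_def)
qed

lemma below_eq:
  assumes "a \<le> b" "\<And>z. z \<in> R \<Longrightarrow> a \<le> z \<Longrightarrow> \<not> z < b"
  shows "below R a = below R b"
proof -
  have "R \<inter> {..<a} = R \<inter> {..<b}"
    using assms by (auto, meson linorder_not_less)
  then show ?thesis by (simp add: below_def)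
qed

lemma tableau_finite: "tableau T \<Longrightarrow> R \<in> set T \<Longrightarrow> finite R"
  by (induction T) auto

lemma tableau_smaller_above:
  assumes "tableau (R # Rs)" "y \<in> hd_row Rs"
  shows "\<exists>z\<in>R. z < y"
proof -
  have "y \<notin> R" using assms hd_row_subset[of Rs] by auto
  have "below (hd_row Rs) (Suc y) \<ge> 1" using assms by (simp add: below_Suc)
  then have "below R (Suc y) \<ge> 1" using assms(1) by (metis le_trans tableau.simps(2))
  then have "R \<inter> {..<Suc y} \<noteq> {}" by (auto simp: below_def)
  with \<open>y \<notin> R\<close> show ?thesis by (metis IntE all_not_in_conv lessThan_iff less_Suc_eq)
qed

lemma least_above:
  assumes "finite R" "\<exists>y\<in>R. x < y"
  shows "Min {y\<in>R. x < y} \<in> R" "x < Min {y\<in>R. x < y}"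
    "\<And>z. z \<in> R \<Longrightarrow> x < z \<Longrightarrow> Min {y\<in>R. x < y} \<le> (z::nat)"
proof -
  have "finite {y\<in>R. x < y}" "{y\<in>R. x < y} \<noteq> {}" using assms by auto
  then show "Min {y\<in>R. x < y} \<in> R" "x < Min {y\<in>R. x < y}"
    "\<And>z. z \<in> R \<Longrightarrow> x < z \<Longrightarrow> Min {y\<in>R. x < y} \<le> z"
    using Min_in[of "{y\<in>R. x < y}"] by auto
qed

lemma greatest_below:
  assumes "finite R" "\<exists>y\<in>R. y < x"
  shows "Max {y\<in>R. y < x} \<in> R" "Max {y\<in>R. y < x} < x"
    "\<And>z. z \<in> R \<Longrightarrow> z < x \<Longrightarrow> z \<le> Max {y\<in>R. y < (x::nat)}"
proof -
  have "finite {y\<in>R. y < x}" "{y\<in>R. y < x} \<noteq> {}" using assms by auto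
  then show "Max {y\<in>R. y < x} \<in> R" "Max {y\<in>R. y < x} < x"
    "\<And>z. z \<in> R \<Longrightarrow> z < x \<Longrightarrow> z \<le> Max {y\<in>R. y < x}"
    using Max_in[of "{y\<in>R. y < x}"] by auto
qed

lemma hd_row_insert_below:
  assumes "tableau T" "x \<notin> \<Union>(set T)"
  shows "below (hd_row (row_insert x T)) m \<le>
    (if m \<le> x then below (hd_row T) m else max (below (hd_row T) m) (Suc (below (hd_row T) x)))"
proof (cases T)
  case Nil
  then show ?thesis by (auto simp: below_def)
next
  case (Cons R Rs)
  with assms have fin: "finite R" and x: "x \<notin> R" by auto
  show ?thesis
  proof (cases "\<exists>y\<in>R. x < y")
    case True
    define y where "y = Min {y\<in>R. x < y}"
    note y = least_above[OF fin True, folded y_def]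
    have hd: "hd_row (row_insert x T) = insert x (R - {y})" "hd_row T = R"
      using Cons True by (auto simp: y_def)
    have "below (insert x (R - {y})) m = below R m - of_bool (y < m) + of_bool (x < m)"
      using x y by (simp add: below_insert below_remove)
    moreover have "below R x = below R m" if "x < m" "\<not> y < m"
    proof (rule below_eq)
      show "x \<le> m" using that by simp
      fix z assume "z \<in> R" "x \<le> z"
      then have "y \<le> z" using y(3)[of z] x by (metis le_neq_implies_less)
      then show "\<not> z < m" using that by simp
    qed
    moreover have "below R m \<ge> 1" if "y < m"
    proof -
      have "below R (Suc y) \<ge> 1" using y(1) by (simp add: below_Suc)
      then show ?thesis using that below_mono[of "Suc y" m R] by simp
    qed
    ultimately show ?thesis unfolding hd using y(2) by (cases "y < m"; cases "x < m") auto
  next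
    case False
    have hd: "hd_row (row_insert x T) = insert x R" "hd_row T = R"
      using Cons False by auto
    have "below R x = below R m" if "x < m"
    proof (rule below_eq)
      show "x \<le> m" using that by simp
      fix z assume "z \<in> R" "x \<le> z"
      then show "\<not> z < m" using False x by (metis le_neq_implies_less)
    qed
    then show ?thesis unfolding hd using x by (cases "x < m") (auto simp: below_insert)
  qed
qed

lemma Union_row_insert:
  assumes "tableau T"
  shows "\<Union>(set (row_insert x T)) = insert x (\<Union>(set T))"
  using assms
proof (induction T arbitrary: x)
  case (Cons R Rs)
  then have fin: "finite R" by auto
  show ?case
  proof (cases "\<exists>y\<in>R. x < y")
    case True
    then show ?thesis using Cons.IH[of "Min {y\<in>R. x < y}"] Cons.prems least_above(1)[OF fin True]
      by auto
  qed auto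
qed auto

lemma tableau_row_insert:
  assumes "tableau T" "x \<notin> \<Union>(set T)"
  shows "tableau (row_insert x T)"
  using assms
proof (induction T arbitrary: x)
  case Nil
  then show ?case by (auto simp: below_def)
next
  case (Cons R Rs)
  then have fin: "finite R" and x: "x \<notin> R" and tab: "tableau Rs" and dj: "R \<inter> \<Union>(set Rs) = {}"
    and le: "\<And>m. below (hd_row Rs) m \<le> below R m" by auto
  show ?case
  proof (cases "\<exists>y\<in>R. x < y")
    case True
    define y where "y = Min {y\<in>R. x < y}"
    note y = least_above[OF fin True, folded y_def]
    have yn: "y \<notin> \<Union>(set Rs)" using dj y by auto
    have R': "below (insert x (R - {y})) m = below R m - of_bool (y < m) + of_bool (x < m)" for m
      using x y by (simp add: below_insert below_remove)
    have pos: "below R m \<ge> Suc (below R y)" if "y < m" for m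
    proof -
      have "below R (Suc y) = Suc (below R y)" using y(1) by (simp add: below_Suc)
      then show ?thesis using that below_mono[of "Suc y" m R] by simp
    qed
    have "below (hd_row (row_insert y Rs)) m \<le> below (insert x (R - {y})) m" for m
      using hd_row_insert_below[OF tab yn, of m] le[of m] le[of y] pos[of m] y(2)
      unfolding R' by (cases "y < m"; cases "x < m") auto
    moreover have "tableau (row_insert y Rs)" using Cons.IH[OF tab yn] .
    ultimately have "tableau (insert x (R - {y}) # row_insert y Rs)"
      using fin Cons.prems dj y(1,2) by (auto simp: Union_row_insert[OF tab])
    moreover have "row_insert x (R # Rs) = insert x (R - {y}) # row_insert y Rs"
      using True by (simp add: y_def)
    ultimately show ?thesis by (simp only:)
  next
    case False
    have "row_insert x (R # Rs) = insert x R # Rs" using False by simp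
    moreover have "tableau (insert x R # Rs)"
      using Cons.prems le x by (auto simp: below_insert intro: le_SucI)
    ultimately show ?thesis by (simp only:)
  qed
qed

lemma row_extract_row_insert:
  assumes "tableau T" "x \<notin> \<Union>(set T)" "landing x T < length T"
  shows "row_extract (landing x T) (row_insert x T) = (x, T)"
  using assms
proof (induction T arbitrary: x)
  case (Cons R Rs)
  then have fin: "finite R" and x: "x \<notin> R" and tab: "tableau Rs" and dj: "R \<inter> \<Union>(set Rs) = {}"
    by auto
  show ?case
  proof (cases "\<exists>y\<in>R. x < y")
    case True
    define y where "y = Min {y\<in>R. x < y}"
    note y = least_above[OF fin True, folded y_def]
    have yn: "y \<notin> \<Union>(set Rs)" using dj y by auto
    have eq: "row_insert x (R # Rs) = insert x (R - {y}) # row_insert y Rs"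
      "landing x (R # Rs) = Suc (landing y Rs)"
      using True by (simp_all add: y_def)
    have IH: "row_extract (landing y Rs) (row_insert y Rs) = (y, Rs)"
      using Cons.IH[OF tab yn] Cons.prems(3) eq by simp
    have "Max {z \<in> insert x (R - {y}). z < y} = x"
      using fin y by (intro Max_eqI) (auto simp: not_less[symmetric] dest: leD)
    then show ?thesis unfolding eq using IH x y by (auto simp: Let_def)
  next
    case False
    have "Max (insert x R) = x" using fin False by (intro Max_eqI) (auto simp: leI)
    then show ?thesis using False x by auto
  qed
qed simp

lemma row_extract_props:
  assumes "tableau T" "card (row T (Suc r)) < card (row T r)" "row_extract r T = (x, T')"
  shows "tableau T' \<and> length T' = length T \<and> x \<in> hd_row T \<and> row_insert x T' = T \<and>
    landing x T' = r \<and> \<Union>(set T') = \<Union>(set T) - {x} \<and>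
    (\<forall>m. below (hd_row T') m \<le> below (hd_row T) m) \<and>
    (\<forall>m\<le>x. below (hd_row T') m = below (hd_row T) m)"
  using assms
proof (induction r arbitrary: T x T')
  case 0
  then obtain R Rs where T: "T = R # Rs" by (cases T) auto
  from 0 T have fin: "finite R" and lt: "card (hd_row Rs) < card R" by (auto simp: row_0)
  then have "R \<noteq> {}" by auto
  define M where "M = Max R"
  have M: "M \<in> R" "\<And>z. z \<in> R \<Longrightarrow> z \<le> M" using fin \<open>R \<noteq> {}\<close> by (auto simp: M_def)
  have xT': "x = M" "T' = (R - {M}) # Rs" using 0 T by (auto simp: M_def)
  have "M \<notin> \<Union>(set Rs)" using M 0(1) T by auto
  have le: "below (hd_row Rs) m \<le> below R m" for m using 0(1) T by auto
  have "below (hd_row Rs) m \<le> below (R - {M}) m" for m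
  proof (cases "M < m")
    case True
    then have "R \<inter> {..<m} = R" using M(2) by (meson inf.absorb_iff1 le_less_trans lessThan_iff subsetI)
    then have "below R m = card R" by (simp add: below_def)
    moreover have "below (hd_row Rs) m \<le> card (hd_row Rs)" unfolding below_def
      using 0(1) T by (intro card_mono) (cases Rs, auto)
    ultimately show ?thesis using lt True M by (simp add: below_remove)
  next
    case False
    then show ?thesis using le[of m] M by (simp add: below_remove)
  qed
  then have "tableau T'" using 0(1) T xT' by auto
  moreover have "\<not> (\<exists>y\<in>R - {M}. M < y)" using M(2) by (auto simp: not_less)
  moreover have "insert M (R - {M}) = R" using M by auto
  ultimately show ?case unfolding xT' T using M 0(1) T \<open>M \<notin> \<Union>(set Rs)\<close> by (auto simp: below_remove)
next
  case (Suc r)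
  then obtain R Rs where T: "T = R # Rs" by (cases T) auto
  obtain y Rs' where e: "row_extract r Rs = (y, Rs')" by fastforce
  have tabT: "tableau (R # Rs)" using Suc T by simp
  then have fin: "finite R" and tab: "tableau Rs" and dj: "R \<inter> \<Union>(set Rs) = {}"
    and le: "\<And>m. below (hd_row Rs) m \<le> below R m" by auto
  have IH: "tableau Rs'" "length Rs' = length Rs" "y \<in> hd_row Rs" "row_insert y Rs' = Rs"
    "landing y Rs' = r" "\<Union>(set Rs') = \<Union>(set Rs) - {y}"
    "\<And>m. below (hd_row Rs') m \<le> below (hd_row Rs) m"
    using Suc.IH[OF tab _ e] Suc.prems T by auto
  have yU: "y \<in> \<Union>(set Rs)" "y \<notin> R" using IH(3) hd_row_subset[of Rs] dj by auto
  have ex: "\<exists>z\<in>R. z < y" using tableau_smaller_above[OF tabT IH(3)] .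
  define z where "z = Max {z\<in>R. z < y}"
  note z = greatest_below[OF fin ex, folded z_def]
  have xT': "x = z" "T' = insert y (R - {z}) # Rs'"
    using Suc.prems(3) T e by (auto simp: Let_def z_def)
  have R': "below (insert y (R - {z})) m = below R m - of_bool (z < m) + of_bool (y < m)" for m
    using yU z by (simp add: below_insert below_remove)
  have pos: "below R m \<ge> 1" if "z < m" for m
  proof -
    have "below R (Suc z) \<ge> 1" using z(1) by (simp add: below_Suc)
    then show ?thesis using that below_mono[of "Suc z" m R] by simp
  qed
  have hdle: "below (hd_row Rs') m \<le> below (insert y (R - {z})) m" for m
  proof (cases "z < m \<and> \<not> y < m")
    case True
    have "below R m = below R (Suc y)"
    proof (rule below_eq)
      show "m \<le> Suc y" using True by simp
      fix v assume "v \<in> R" "m \<le> v"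
      then show "\<not> v < Suc y" using z(3)[of v] yU True by (metis leD less_antisym less_le_trans)
    qed
    have "Suc (below (hd_row Rs) y) = below (hd_row Rs) (Suc y)" using IH(3) by (simp add: below_Suc)
    moreover have "below (hd_row Rs) m \<le> below (hd_row Rs) y" using True by (intro below_mono) auto
    ultimately have "Suc (below (hd_row Rs) m) \<le> below R m"
      using le[of "Suc y"] \<open>below R m = _\<close> by linarith
    then show ?thesis using IH(7)[of m] True unfolding R' by auto
  next
    case False
    then show ?thesis using IH(7)[of m] le[of m] pos[of m] z(2) unfolding R'
      by (cases "z < m"; cases "y < m") auto
  qed
  have "tableau T'" unfolding xT' using fin dj yU IH hdle by auto
  moreover have "Min {w \<in> insert y (R - {z}). z < w} = y"
    using fin z yU by (intro Min_eqI) (auto simp: not_le[symmetric])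
  moreover have "\<exists>w\<in>insert y (R - {z}). z < w" using z by auto
  moreover have "insert z (R - {z}) = R" using z by auto
  moreover have "insert y (R - {z}) - {y} = R - {z}" using yU by auto
  ultimately show ?case unfolding xT' T using IH z dj yU R' pos
    by (auto simp: le_Suc_eq not_less)
qed

lemma card_row_insert:
  assumes "tableau T" "x \<notin> \<Union>(set T)"
  shows "card (row (row_insert x T) r) = card (row T r) + of_bool (r = landing x T)"
  using assms
proof (induction T arbitrary: x r)
  case Nil
  then show ?case by (cases r) auto
next
  case (Cons R Rs)
  then have fin: "finite R" and x: "x \<notin> R" and tab: "tableau Rs" and dj: "R \<inter> \<Union>(set Rs) = {}"
    by auto
  show ?case
  proof (cases "\<exists>y\<in>R. x < y")
    case True
    define y where "y = Min {y\<in>R. x < y}"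
    note y = least_above[OF fin True, folded y_def]
    have yn: "y \<notin> \<Union>(set Rs)" using dj y by auto
    have eq: "row_insert x (R # Rs) = insert x (R - {y}) # row_insert y Rs"
      "landing x (R # Rs) = Suc (landing y Rs)"
      using True by (simp_all add: y_def)
    have "card (insert x (R - {y})) = card R"
      using card.remove[OF fin y(1)] fin x by simp
    then show ?thesis unfolding eq using Cons.IH[OF tab yn] by (cases r) auto
  next
    case False
    then show ?thesis using fin x by (cases r) auto
  qed
qed

lemma length_row_insert:
  "length (row_insert x T) = (if landing x T < length T then length T else Suc (length T))"
  by (induction T arbitrary: x) auto

lemma landing_le: "landing x T \<le> length T"
  by (induction T arbitrary: x) auto

text \<open>
  A list of sets stands for the word in which every set contributes its elements in increasing order;
  \<open>dchain u b m h\<close> says that this word has a decreasing subsequence of length \<open>h\<close> with values in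
  \<open>[b, m)\<close>. The bounds make the notion compatible with concatenation and with removing the largest
  entry.
\<close>

fun dchain :: "nat set list \<Rightarrow> nat \<Rightarrow> nat \<Rightarrow> nat \<Rightarrow> bool" where
  "dchain [] b m h \<longleftrightarrow> h = 0"
| "dchain (R # Rs) b m h \<longleftrightarrow> dchain Rs b m h \<or>
     (\<exists>h' r. h = Suc h' \<and> r \<in> R \<and> b \<le> r \<and> r < m \<and> dchain Rs b r h')"

lemma dchain_0 [simp]: "dchain u b m 0"
  by (induction u) auto

lemma dchain_empty_range: "m \<le> b \<Longrightarrow> dchain u b m h \<longleftrightarrow> h = 0"
  by (induction u) auto

lemma dchain_length: "dchain u b m h \<Longrightarrow> h \<le> length u"
  by (induction u arbitrary: m h) (auto intro: le_SucI)

lemma dchain_append: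
  assumes "b \<le> m"
  shows "dchain (u @ v) b m h \<longleftrightarrow>
    (\<exists>c h1 h2. h = h1 + h2 \<and> b \<le> c \<and> c \<le> m \<and> dchain u c m h1 \<and> dchain v b c h2)"
  using assms
proof (induction u arbitrary: m h)
  case Nil
  show ?case
  proof
    assume "dchain ([] @ v) b m h"
    then show "\<exists>c h1 h2. h = h1 + h2 \<and> b \<le> c \<and> c \<le> m \<and> dchain [] c m h1 \<and> dchain v b c h2"
      using Nil by (intro exI[of _ m] exI[of _ 0] exI[of _ h]) auto
  next
    have "dchain v b c h \<Longrightarrow> c \<le> m \<Longrightarrow> dchain v b m h" for c
      by (induction v arbitrary: c h) (auto intro: less_le_trans)
    then show "\<exists>c h1 h2. h = h1 + h2 \<and> b \<le> c \<and> c \<le> m \<and> dchain [] c m h1 \<and> dchain v b c h2 \<Longrightarrow>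
      dchain ([] @ v) b m h" by auto
  qed
next
  case (Cons R u)
  show ?case
  proof
    assume "dchain ((R # u) @ v) b m h"
    then consider "dchain (u @ v) b m h"
      | h' r where "h = Suc h'" "r \<in> R" "b \<le> r" "r < m" "dchain (u @ v) b r h'"
      by auto
    then show "\<exists>c h1 h2. h = h1 + h2 \<and> b \<le> c \<and> c \<le> m \<and> dchain (R # u) c m h1 \<and> dchain v b c h2"
    proof cases
      case 1
      then show ?thesis using Cons by auto
    next
      case 2
      then obtain c h1 h2 where "h' = h1 + h2" "b \<le> c" "c \<le> r" "dchain u c r h1" "dchain v b c h2"
        using Cons.IH[of r h'] by auto
      then show ?thesis using 2
        by (intro exI[of _ c] exI[of _ "Suc h1"] exI[of _ h2]) auto
    qed
  next
    assume "\<exists>c h1 h2. h = h1 + h2 \<and> b \<le> c \<and> c \<le> m \<and> dchain (R # u) c m h1 \<and> dchain v b c h2"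
    then obtain c h1 h2 where c: "h = h1 + h2" "b \<le> c" "c \<le> m" "dchain (R # u) c m h1" "dchain v b c h2"
      by blast
    from c(4) consider "dchain u c m h1"
      | h' r where "h1 = Suc h'" "r \<in> R" "c \<le> r" "r < m" "dchain u c r h'"
      by auto
    then show "dchain ((R # u) @ v) b m h"
    proof cases
      case 1
      then show ?thesis using Cons c by auto
    next
      case 2
      then have "dchain (u @ v) b r (h' + h2)" using c by (subst Cons.IH) auto
      then show ?thesis using 2 c by auto
    qed
  qed
qed

lemma dchain_cong_left:
  assumes "\<And>b m h. m \<le> M \<Longrightarrow> dchain u b m h \<longleftrightarrow> dchain u' b m h" "m \<le> M"
  shows "dchain (u @ v) b m h \<longleftrightarrow> dchain (u' @ v) b m h"
proof (cases "b \<le> m")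
  case True
  then show ?thesis using assms by (simp add: dchain_append)
next
  case False
  then show ?thesis by (simp add: dchain_empty_range)
qed

lemma dchain_cong_right:
  assumes "\<And>b m h. dchain v b m h \<longleftrightarrow> dchain v' b m h"
  shows "dchain (u @ v) b m h \<longleftrightarrow> dchain (u @ v') b m h"
  by (induction u arbitrary: m h) (auto simp: assms)

lemma dchain_row_insert:
  assumes "tableau T" "x \<notin> \<Union>(set T)"
  shows "dchain (rev (row_insert x T)) b m h \<longleftrightarrow> dchain (rev T @ [{x}]) b m h"
  using assms
proof (induction T arbitrary: x b m h)
  case (Cons R Rs)
  then have fin: "finite R" and x: "x \<notin> R" and tab: "tableau Rs" and dj: "R \<inter> \<Union>(set Rs) = {}"
    by auto
  show ?case
  proof (cases "\<exists>y\<in>R. x < y")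
    case True
    define y where "y = Min {y\<in>R. x < y}"
    note y = least_above[OF fin True, folded y_def]
    have yn: "y \<notin> \<Union>(set Rs)" using dj y by auto
    have eq: "row_insert x (R # Rs) = insert x (R - {y}) # row_insert y Rs"
      using True by (simp_all add: y_def)
    have gap: "r \<le> x" if "r \<in> R" "r < y" for r using y(3)[of r] that by (meson leI not_le)
    have "dchain (rev (row_insert x (R # Rs))) b m h \<longleftrightarrow>
      dchain (rev (row_insert y Rs) @ [insert x (R - {y})]) b m h" by (simp only: eq rev.simps)
    also have "\<dots> \<longleftrightarrow> dchain ((rev Rs @ [{y}]) @ [insert x (R - {y})]) b m h"
      by (rule dchain_cong_left[where M = m]) (use Cons.IH[OF tab yn] in auto)
    also have "\<dots> \<longleftrightarrow> dchain (rev Rs @ [{y}, insert x (R - {y})]) b m h" by simp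
    also have "\<dots> \<longleftrightarrow> dchain (rev Rs @ [R, {x}]) b m h"
    proof (rule dchain_cong_right)
      fix b m h
      show "dchain [{y}, insert x (R - {y})] b m h \<longleftrightarrow> dchain [R, {x}] b m h" (is "?L \<longleftrightarrow> ?R")
      proof -
        consider "h = 0" | "h = 1" | "h = 2" | "h > 2" by linarith
        then show ?thesis
        proof cases
          case 3
          have "?L \<longleftrightarrow> b \<le> y \<and> y < m \<and> (\<exists>r. (r = x \<or> r \<in> R \<and> r \<noteq> y) \<and> b \<le> r \<and> r < y)"
            using 3 by (auto simp: numeral_2_eq_2)
          also have "\<dots> \<longleftrightarrow> y < m \<and> b \<le> x" using y gap by (auto intro: le_trans)
          also have "\<dots> \<longleftrightarrow> (\<exists>r\<in>R. r < m \<and> b \<le> x \<and> x < r)" using y by (auto intro: le_less_trans)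
          also have "\<dots> \<longleftrightarrow> ?R" using 3 by (auto simp: numeral_2_eq_2)
          finally show ?thesis .
        qed (use y in \<open>auto simp: numeral_2_eq_2 gr0_conv_Suc\<close>)
      qed
    qed
    finally show ?thesis by simp
  next
    case False
    have "dchain (rev Rs @ [insert x R]) b m h \<longleftrightarrow> dchain (rev Rs @ [R, {x}]) b m h"
      by (rule dchain_cong_right) (use False in auto)
    then show ?thesis using False by simp
  qed
qed simp

lemma tableau_dchain:
  assumes "tableau T" "T \<noteq> []" "last T \<noteq> {}" "\<Union>(set T) \<subseteq> {..<m}"
  shows "\<exists>y\<in>hd_row T. dchain (rev T) y m (length T)"
  using assms
proof (induction T)
  case (Cons R Rs)
  show ?case
  proof (cases "Rs = []")
    case True
    then show ?thesis using Cons.prems by fastforce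
  next
    case False
    then obtain y where y: "y \<in> hd_row Rs" "dchain (rev Rs) y m (length Rs)" using Cons by auto
    obtain z where z: "z \<in> R" "z < y" using tableau_smaller_above[OF Cons.prems(1) y(1)] by blast
    have "y < m" using y hd_row_subset[of Rs] Cons.prems by auto
    have "dchain (rev Rs @ [R]) z m (length Rs + 1)"
      unfolding dchain_append[OF less_imp_le[OF less_trans[OF z(2) \<open>y < m\<close>]]]
      using z y \<open>y < m\<close> by (intro exI[of _ y] exI[of _ "length Rs"] exI[of _ 1]) auto
    then show ?thesis using z by auto
  qed
qed simp

section \<open>Matchings as walks\<close>

datatype move = Skip | Open nat | Close nat

fun act :: "nat \<Rightarrow> move \<Rightarrow> nat set list \<Rightarrow> nat set list" where
  "act t Skip T = T"
| "act t (Open r) T = T[r := insert (Suc t) (T ! r)]"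
| "act t (Close r) T = snd (row_extract r T)"

fun arc :: "nat \<Rightarrow> move \<Rightarrow> nat set list \<Rightarrow> (nat \<times> nat) set" where
  "arc t (Close r) T = {(fst (row_extract r T), Suc t)}"
| "arc t mv T = {}"

fun decode :: "nat \<Rightarrow> nat set list \<Rightarrow> move list \<Rightarrow> (nat \<times> nat) set" where
  "decode t T [] = {}"
| "decode t T (mv # ws) = arc t mv T \<union> decode (Suc t) (act t mv T) ws"

lemma card_row_mono:
  assumes "tableau T"
  shows "card (row T (Suc r)) \<le> card (row T r)"
  using assms
proof (induction T arbitrary: r)
  case (Cons R Rs)
  show ?case
  proof (cases r)
    case 0
    have fin: "finite R" "finite (hd_row Rs)" using Cons.prems by (auto, cases Rs) auto
    define m where "m = Suc (Max (insert 0 (R \<union> hd_row Rs)))"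
    have "R \<union> hd_row Rs \<subseteq> {..<m}" unfolding m_def using fin by (auto simp: less_Suc_eq_le)
    then have "below R m = card R" "below (hd_row Rs) m = card (hd_row Rs)"
      unfolding below_def by (auto intro!: arg_cong[of _ _ card])
    moreover have "below (hd_row Rs) m \<le> below R m" using Cons.prems by auto
    ultimately show ?thesis using 0 by (simp add: row_0)
  qed (use Cons in auto)
qed auto

lemma partial_matching_alt:
  "partial_matching n \<mu> \<longleftrightarrow> \<mu> \<subseteq> {(i, j). 1 \<le> i \<and> i < j \<and> j \<le> n} \<and>
     (\<forall>e\<in>\<mu>. \<forall>e'\<in>\<mu>. {fst e, snd e} \<inter> {fst e', snd e'} \<noteq> {} \<longrightarrow> e = e')"
proof (cases "\<mu> \<subseteq> {(i, j). 1 \<le> i \<and> i < j \<and> j \<le> n}")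
  case True
  then have "\<mu> \<subseteq> {1..n} \<times> {1..n}" by auto
  then have fin: "finite \<mu>" by (rule finite_subset) auto
  have "(\<forall>v\<in>{1..n}. card {e \<in> \<mu>. v = fst e \<or> v = snd e} \<le> 1) \<longleftrightarrow>
    (\<forall>v\<in>{1..n}. \<forall>e\<in>\<mu>. \<forall>e'\<in>\<mu>. (v = fst e \<or> v = snd e) \<and> (v = fst e' \<or> v = snd e') \<longrightarrow> e = e')"
  proof (rule ball_cong[OF refl])
    fix v
    have "card {e \<in> \<mu>. v = fst e \<or> v = snd e} \<le> Suc 0 \<longleftrightarrow>
      (\<forall>e\<in>{e \<in> \<mu>. v = fst e \<or> v = snd e}. \<forall>e'\<in>{e \<in> \<mu>. v = fst e \<or> v = snd e}. e = e')"
      using fin by (intro card_le_Suc0_iff_eq) auto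
    then show "card {e \<in> \<mu>. v = fst e \<or> v = snd e} \<le> 1 \<longleftrightarrow>
      (\<forall>e\<in>\<mu>. \<forall>e'\<in>\<mu>. (v = fst e \<or> v = snd e) \<and> (v = fst e' \<or> v = snd e') \<longrightarrow> e = e')"
      unfolding One_nat_def by blast
  qed
  also have "\<dots> \<longleftrightarrow> (\<forall>e\<in>\<mu>. \<forall>e'\<in>\<mu>. {fst e, snd e} \<inter> {fst e', snd e'} \<noteq> {} \<longrightarrow> e = e')"
  proof (intro iffI ballI impI)
    fix e e' assume a: "\<forall>v\<in>{1..n}. \<forall>e\<in>\<mu>. \<forall>e'\<in>\<mu>. (v = fst e \<or> v = snd e) \<and> (v = fst e' \<or> v = snd e') \<longrightarrow> e = e'"
      and e: "e \<in> \<mu>" "e' \<in> \<mu>" "{fst e, snd e} \<inter> {fst e', snd e'} \<noteq> {}"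
    then obtain v where "v = fst e \<or> v = snd e" "v = fst e' \<or> v = snd e'" by auto
    moreover from this have "v \<in> {1..n}" using e True by fastforce
    ultimately show "e = e'" using a e by blast
  next
    fix v e e' assume a: "\<forall>e\<in>\<mu>. \<forall>e'\<in>\<mu>. {fst e, snd e} \<inter> {fst e', snd e'} \<noteq> {} \<longrightarrow> e = e'"
      and e: "e \<in> \<mu>" "e' \<in> \<mu>" "(v = fst e \<or> v = snd e) \<and> (v = fst e' \<or> v = snd e')"
    have "v \<in> {fst e, snd e} \<inter> {fst e', snd e'}" using e(3) by auto
    then have "{fst e, snd e} \<inter> {fst e', snd e'} \<noteq> {}" by blast
    then show "e = e'" using a e by blast
  qed
  finally show ?thesis using True by (simp add: partial_matching_def)
qed (auto simp: partial_matching_def)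

definition desc :: "nat \<times> nat \<Rightarrow> nat \<times> nat \<Rightarrow> bool" where
  "desc p q \<longleftrightarrow> fst q < fst p \<and> snd q < snd p"

lemma dchain_pairs:
  assumes "sorted_wrt (>) js"
  shows "dchain (map (\<lambda>j. {i. (i, j) \<in> \<mu>}) js) b m h \<longleftrightarrow>
    (\<exists>ps. length ps = h \<and> set ps \<subseteq> \<mu> \<and> snd ` set ps \<subseteq> set js \<and> sorted_wrt desc ps \<and>
      (\<forall>p\<in>set ps. b \<le> fst p \<and> fst p < m))"
  using assms
proof (induction js arbitrary: m h)
  case Nil
  then show ?case by auto
next
  case (Cons j js)
  let ?P = "\<lambda>js m h ps. length ps = h \<and> set ps \<subseteq> \<mu> \<and> snd ` set ps \<subseteq> set js \<and> sorted_wrt desc ps \<and>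
      (\<forall>p\<in>set ps. b \<le> fst p \<and> fst p < m)"
  have IH: "dchain (map (\<lambda>j. {i. (i, j) \<in> \<mu>}) js) b m h \<longleftrightarrow> (\<exists>ps. ?P js m h ps)" for m h
    using Cons by simp
  have lt: "\<And>j'. j' \<in> set js \<Longrightarrow> j' < j" using Cons.prems by auto
  show ?case
  proof
    assume "dchain (map (\<lambda>j. {i. (i, j) \<in> \<mu>}) (j # js)) b m h"
    then consider "dchain (map (\<lambda>j. {i. (i, j) \<in> \<mu>}) js) b m h"
      | h' r where "h = Suc h'" "(r, j) \<in> \<mu>" "b \<le> r" "r < m"
        "dchain (map (\<lambda>j. {i. (i, j) \<in> \<mu>}) js) b r h'" by auto
    then show "\<exists>ps. ?P (j # js) m h ps"
    proof cases
      case 1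
      then obtain ps where "?P js m h ps" unfolding IH by blast
      then show ?thesis by (intro exI[of _ ps]) auto
    next
      case 2
      then obtain ps where ps: "?P js r h' ps" unfolding IH by blast
      then have "\<And>p. p \<in> set ps \<Longrightarrow> snd p < j" using lt by auto
      then show ?thesis using ps 2 by (intro exI[of _ "(r, j) # ps"]) (auto simp: desc_def)
    qed
  next
    assume "\<exists>ps. ?P (j # js) m h ps"
    then obtain ps where ps: "?P (j # js) m h ps" by blast
    show "dchain (map (\<lambda>j. {i. (i, j) \<in> \<mu>}) (j # js)) b m h"
    proof (cases "snd ` set ps \<subseteq> set js")
      case True
      then have "dchain (map (\<lambda>j. {i. (i, j) \<in> \<mu>}) js) b m h" unfolding IH using ps by blast
      then show ?thesis by simp
    next
      case False
      then obtain p where "p \<in> set ps" "snd p \<notin> set js" by auto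
      then have p: "p \<in> set ps" "snd p = j" using ps by auto
      then obtain q qs where qs: "ps = q # qs" by (cases ps) auto
      have "q = p"
      proof (rule ccontr)
        assume "q \<noteq> p"
        then have "desc q p" using p qs ps by auto
        then have "j < snd q" using p by (auto simp: desc_def)
        moreover have "snd q = j \<or> snd q \<in> set js" using ps qs by auto
        ultimately show False using lt by force
      qed
      have d: "\<And>s. s \<in> set qs \<Longrightarrow> desc q s" using ps qs by auto
      have "?P js (fst q) (h - 1) qs"
      proof (intro conjI ballI)
        show "snd ` set qs \<subseteq> set js"
        proof
          fix x assume "x \<in> snd ` set qs"
          then obtain s where s: "s \<in> set qs" "x = snd s" by auto
          then have "x < j" using d[of s] p \<open>q = p\<close> by (auto simp: desc_def)
          moreover have "x = j \<or> x \<in> set js" using ps qs s by auto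
          ultimately show "x \<in> set js" by auto
        qed
      qed (use ps qs d in \<open>auto simp: desc_def\<close>)
      then have "dchain (map (\<lambda>j. {i. (i, j) \<in> \<mu>}) js) b (fst q) (h - 1)" unfolding IH by blast
      moreover have "(fst q, j) \<in> \<mu>" using ps qs p \<open>q = p\<close> by auto
      moreover have "h = Suc (h - 1)" "b \<le> fst q" "fst q < m" using ps qs by auto
      ultimately show ?thesis by auto
    qed
  qed
qed

lemma is_crossing_alt:
  assumes "k \<ge> 1"
  shows "is_crossing k S \<longleftrightarrow> (\<exists>ps. length ps = k \<and> S = set ps \<and> sorted_wrt desc ps \<and>
    fst (hd ps) < snd (last ps))"
proof
  assume "is_crossing k S"
  then obtain i j where ij: "S = (\<lambda>r. (i r, j r)) ` {1..k}" "strict_mono_on {1..k} i"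
    "i k < j 1" "strict_mono_on {1..k} j" unfolding is_crossing_def by blast
  define ps where "ps = map (\<lambda>a. (i (k - a), j (k - a))) [0..<k]"
  have "S = set ps"
  proof -
    have "(-) k ` {0..<k} = {1..k}"
    proof
      show "{1..k} \<subseteq> (-) k ` {0..<k}"
      proof
        fix x assume "x \<in> {1..k}"
        then show "x \<in> (-) k ` {0..<k}" by (intro image_eqI[of _ _ "k - x"]) auto
      qed
    qed auto
    then have "S = (\<lambda>r. (i r, j r)) ` (-) k ` {0..<k}" using ij(1) by simp
    then show ?thesis unfolding ps_def by (simp add: image_image)
  qed
  moreover have "sorted_wrt desc ps"
    unfolding sorted_wrt_iff_nth_less
  proof (intro allI impI)
    fix a b assume "a < b" "b < length ps"
    then have "k - b \<in> {1..k}" "k - a \<in> {1..k}" "k - b < k - a" "a < k" "b < k" by (auto simp: ps_def)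
    then show "desc (ps ! a) (ps ! b)"
      using strict_mono_onD[OF ij(2)] strict_mono_onD[OF ij(4)] by (simp add: ps_def desc_def)
  qed
  moreover have "fst (hd ps) = i k" "snd (last ps) = j 1"
    using assms unfolding ps_def by (auto simp: hd_map last_map)
  ultimately show "\<exists>ps. length ps = k \<and> S = set ps \<and> sorted_wrt desc ps \<and> fst (hd ps) < snd (last ps)"
    using ij(3) by (intro exI[of _ ps]) (auto simp: ps_def)
next
  assume "\<exists>ps. length ps = k \<and> S = set ps \<and> sorted_wrt desc ps \<and> fst (hd ps) < snd (last ps)"
  then obtain ps where ps: "length ps = k" "S = set ps" "sorted_wrt desc ps"
    "fst (hd ps) < snd (last ps)" by blast
  define i j where "i = (\<lambda>r. fst (ps ! (k - r)))" and "j = (\<lambda>r. snd (ps ! (k - r)))"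
  have "ps \<noteq> []" using ps assms by auto
  have "S = (\<lambda>r. (i r, j r)) ` {1..k}"
  proof
    show "S \<subseteq> (\<lambda>r. (i r, j r)) ` {1..k}"
    proof
      fix p assume "p \<in> S"
      then obtain a where "a < k" "p = ps ! a" using ps by (metis in_set_conv_nth)
      then show "p \<in> (\<lambda>r. (i r, j r)) ` {1..k}"
        by (intro image_eqI[of _ _ "k - a"]) (auto simp: i_def j_def)
    qed
    show "(\<lambda>r. (i r, j r)) ` {1..k} \<subseteq> S" using ps by (auto simp: i_def j_def)
  qed
  moreover have "desc (ps ! (k - b)) (ps ! (k - a))" if "a \<in> {1..k}" "b \<in> {1..k}" "a < b" for a b
    using ps(1,3) that unfolding sorted_wrt_iff_nth_less by auto
  then have "strict_mono_on {1..k} i" "strict_mono_on {1..k} j"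
    by (auto simp: strict_mono_on_def i_def j_def desc_def)
  moreover have "i k < j 1" using ps \<open>ps \<noteq> []\<close> by (auto simp: i_def j_def hd_conv_nth last_conv_nth)
  ultimately show "is_crossing k S" unfolding is_crossing_def by blast
qed

lemma dchain_restrict:
  assumes "m \<le> M"
  shows "dchain (map (\<lambda>R. R \<inter> {..<M}) u) b m h \<longleftrightarrow> dchain u b m h"
  using assms by (induction u arbitrary: m h) auto

lemma dchain_empty_rows: "\<Union>(set u) = {} \<Longrightarrow> dchain u b m h \<longleftrightarrow> h = 0"
  by (induction u) auto

lemma tableau_disjoint:
  assumes "tableau T" "i < length T" "j < length T" "i \<noteq> j"
  shows "T ! i \<inter> T ! j = {}"
  using assms
proof (induction T arbitrary: i j)
  case (Cons R Rs)
  have R: "R \<inter> Rs ! l = {}" if "l < length Rs" for l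
  proof -
    have "Rs ! l \<subseteq> \<Union>(set Rs)" using nth_mem[OF that] by blast
    then show ?thesis using Cons.prems(1) by auto
  qed
  show ?case
  proof (cases "i = 0 \<or> j = 0")
    case True
    then show ?thesis using R[of "i - 1"] R[of "j - 1"] Cons.prems(2-4)
      by (cases i; cases j) (simp_all add: Int_commute)
  next
    case False
    then show ?thesis using Cons.IH[of "i - 1" "j - 1"] Cons.prems by (cases i; cases j) simp_all
  qed
qed simp

lemma tableau_remove_max:
  assumes "tableau T" "\<Union>(set T) \<subseteq> {..t}"
  shows "tableau (map (\<lambda>R. R - {t}) T)"
  using assms
proof (induction T)
  case (Cons R Rs)
  have eq: "below (Q - {t}) m = below Q (min m t)" if "Q \<subseteq> {..t}" for Q m
  proof -
    have "(Q - {t}) \<inter> {..<m} = Q \<inter> {..<min m t}"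
      using that by (auto simp: min_def)
    then show ?thesis by (simp add: below_def)
  qed
  have "hd_row (map (\<lambda>R. R - {t}) Rs) = hd_row Rs - {t}" by (cases Rs) auto
  then show ?case using Cons eq[of R] eq[of "hd_row Rs"] hd_row_subset[of Rs] by auto
qed simp

lemma tableau_add_max:
  assumes "tableau T" "\<Union>(set T) \<subseteq> {..<t}" "r < length T"
    "r = 0 \<or> card (row T r) < card (row T (r - 1))"
  shows "tableau (T[r := insert t (T ! r)])"
  using assms
proof (induction T arbitrary: r)
  case (Cons R Rs)
  have full: "below Q m = card Q" if "Q \<subseteq> {..<t}" "t < m" for Q m
  proof -
    have "Q \<inter> {..<m} = Q" using that by force
    then show ?thesis by (simp add: below_def)
  qed
  have tn: "t \<notin> R" "t \<notin> \<Union>(set Rs)" using Cons.prems by auto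
  show ?case
  proof (cases r)
    case 0
    then show ?thesis using Cons.prems tn by (auto simp: below_insert intro: le_SucI trans_le_add1)
  next
    case (Suc s)
    have hd: "below (hd_row (Rs[s := insert t (Rs ! s)])) m \<le> below R m" for m
    proof (cases "s = 0")
      case True
      obtain S Ss where S: "Rs = S # Ss" using Suc Cons.prems by (cases Rs) auto
      have "t \<notin> S" "below S m \<le> below R m" using tn S Cons.prems by auto
      moreover have "Suc (below S m) \<le> below R m" if "t < m"
        using Cons.prems that Suc True S full[of S m] full[of R m] by auto
      ultimately show ?thesis using True S by (auto simp: below_insert)
    next
      case False
      then have "hd_row (Rs[s := insert t (Rs ! s)]) = hd_row Rs" by (cases Rs; cases s) auto
      then show ?thesis using Cons.prems by simp
    qed
    have "tableau (Rs[s := insert t (Rs ! s)])"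
      by (rule Cons.IH) (use Cons.prems Suc in \<open>auto simp: row_def split: if_splits nat.splits\<close>)
    moreover have "\<Union>(set (Rs[s := insert t (Rs ! s)])) \<subseteq> insert t (\<Union>(set Rs))"
      using set_update_subset_insert[of Rs s "insert t (Rs ! s)"] Suc Cons.prems(3) nth_mem[of s Rs] by fastforce
    moreover from this have "R \<inter> \<Union>(set (Rs[s := insert t (Rs ! s)])) = {}"
      using tn Cons.prems(1) by (simp only: tableau.simps) blast
    ultimately show ?thesis using Suc hd Cons.prems by simp
  qed
qed simp

text \<open>
  The shape with row lengths \<open>l\<close> is encoded by the number with digits \<open>l r - l (r + 1) + 1\<close> in base
  \<open>n + 3\<close>. Changing the length of row \<open>r\<close> by one is then an addition or subtraction of \<open>stride r\<close>,
  which causes no carry, and a move leaves the Weyl chamber iff it produces a digit 0.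
\<close>

locale walk_graph =
  fixes K n :: nat
begin

definition base :: nat where "base = n + 3"

definition stride :: "nat \<Rightarrow> nat" where
  "stride r = base ^ r - (if r = 0 then 0 else base ^ (r - 1))"

definition key :: "(nat \<Rightarrow> nat) \<Rightarrow> nat" where
  "key v = (\<Sum>r<K. v r * base ^ r)"

definition origin :: nat where "origin = key (\<lambda>_. 1)"

fun inside :: "nat \<Rightarrow> nat \<Rightarrow> bool" where
  "inside 0 x \<longleftrightarrow> True"
| "inside (Suc r) x \<longleftrightarrow> x mod base \<noteq> 0 \<and> x mod base < n + 2 \<and> inside r (x div base)"

fun target :: "move \<Rightarrow> nat \<Rightarrow> nat" where
  "target Skip x = x"
| "target (Open r) x = x + stride r"
| "target (Close r) x = x - stride r"

definition moves :: "move list" where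
  "moves = map Open [0..<K] @ map Close [0..<K]"

fun walks :: "nat \<Rightarrow> nat \<Rightarrow> move list set" where
  "walks 0 x = {ws. ws = [] \<and> x = origin}"
| "walks (Suc m) x = {mv # ws | mv ws. inside K x \<and> mv \<in> insert Skip (set moves) \<and>
     ws \<in> walks m (target mv x)}"

definition vec :: "nat set list \<Rightarrow> nat \<Rightarrow> nat" where
  "vec T r = card (row T r) - card (row T (Suc r)) + 1"

definition shape_key :: "nat set list \<Rightarrow> nat" where
  "shape_key T = key (vec T)"

definition state :: "nat \<Rightarrow> nat set list \<Rightarrow> bool" where
  "state t T \<longleftrightarrow> tableau T \<and> length T = K \<and> \<Union>(set T) \<subseteq> {1..t}"

lemma base_gt: "base > 2" by (simp add: base_def)

lemma inside_sum:
  assumes "\<And>r. r < j \<Longrightarrow> v r < base"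
  shows "inside j (\<Sum>r<j. v r * base ^ r) \<longleftrightarrow> (\<forall>r<j. 1 \<le> v r \<and> v r \<le> n + 1)"
  using assms
proof (induction j arbitrary: v)
  case (Suc j)
  have eq: "(\<Sum>r<Suc j. v r * base ^ r) = v 0 + base * (\<Sum>r<j. v (Suc r) * base ^ r)"
    unfolding sum.lessThan_Suc_shift by (simp add: sum_distrib_left algebra_simps)
  have "v 0 < base" using Suc.prems by simp
  then have "(\<Sum>r<Suc j. v r * base ^ r) mod base = v 0"
    "(\<Sum>r<Suc j. v r * base ^ r) div base = (\<Sum>r<j. v (Suc r) * base ^ r)"
    unfolding eq using base_gt by auto
  then have "inside (Suc j) (\<Sum>r<Suc j. v r * base ^ r) \<longleftrightarrow>
    v 0 \<noteq> 0 \<and> v 0 < n + 2 \<and> (\<forall>r<j. 1 \<le> v (Suc r) \<and> v (Suc r) \<le> n + 1)"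
    using Suc.IH[of "\<lambda>r. v (Suc r)"] Suc.prems by simp
  also have "\<dots> \<longleftrightarrow> (\<forall>r<Suc j. 1 \<le> v r \<and> v r \<le> n + 1)"
    unfolding All_less_Suc2 by auto
  finally show ?case .
qed simp

lemma inside_key:
  assumes "\<And>r. r < K \<Longrightarrow> v r < base"
  shows "inside K (key v) \<longleftrightarrow> (\<forall>r<K. 1 \<le> v r \<and> v r \<le> n + 1)"
  unfolding key_def using inside_sum[of K v] assms by simp

lemma inside_origin: "inside K origin"
  unfolding origin_def by (subst inside_key) (auto simp: base_def)

lemma sum_less_power:
  assumes "\<And>r. r < j \<Longrightarrow> v r < base"
  shows "(\<Sum>r<j. v r * base ^ r) < base ^ j"
  using assms
proof (induction j)
  case (Suc j)
  then have "(\<Sum>r<j. v r * base ^ r) < base ^ j" by simp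
  moreover have "Suc (v j) \<le> base" using Suc.prems[of j] by simp
  then have "Suc (v j) * base ^ j \<le> base * base ^ j" by (rule mult_le_mono1)
  ultimately show ?case by simp
qed simp

lemma key_less: "(\<And>r. r < K \<Longrightarrow> v r < base) \<Longrightarrow> key v < base ^ K"
  unfolding key_def by (rule sum_less_power)

lemma digits: "x < base ^ j \<Longrightarrow> (\<Sum>r<j. (x div base ^ r mod base) * base ^ r) = x"
proof (induction j arbitrary: x)
  case (Suc j)
  have "x div base < base ^ j" using Suc.prems base_gt by (simp add: less_mult_imp_div_less mult.commute)
  then have IH: "(\<Sum>r<j. (x div base div base ^ r mod base) * base ^ r) = x div base" by (rule Suc.IH)
  have "(\<Sum>r<Suc j. (x div base ^ r mod base) * base ^ r) =
    x mod base + base * (\<Sum>r<j. (x div base div base ^ r mod base) * base ^ r)"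
    unfolding sum.lessThan_Suc_shift
    by (simp add: sum_distrib_left algebra_simps div_mult2_eq)
  then show ?case unfolding IH by simp
qed simp

lemma key_exists:
  assumes "x < base ^ K"
  obtains v where "x = key v" "\<forall>r. v r < base"
  using digits[OF assms] base_gt that[of "\<lambda>r. x div base ^ r mod base"] by (auto simp: key_def)

lemma stride_le: "stride r \<le> base ^ r" by (simp add: stride_def)

lemma stride_add: "stride r + (if r = 0 then 0 else base ^ (r - 1)) = base ^ r"
  using base_gt by (simp add: stride_def power_increasing)

lemma key_step:
  assumes "r < K" "\<And>i. i < K \<Longrightarrow> v' i + of_bool (Suc i = r) = v i + of_bool (i = r)"
  shows "key v' = key v + stride r"
proof -
  have "(\<Sum>i<K. v' i * base ^ i + of_bool (Suc i = r) * base ^ i) =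
    (\<Sum>i<K. v i * base ^ i + of_bool (i = r) * base ^ i)"
    using assms(2) by (intro sum.cong) (auto simp flip: add_mult_distrib)
  moreover have "(\<Sum>i<K. of_bool (i = r) * base ^ i) = base ^ r"
    using assms(1) by (simp add: of_bool_def if_distrib[of "\<lambda>x. x * _"] sum.delta cong: if_cong)
  moreover have "(\<Sum>i<K. of_bool (Suc i = r) * base ^ i) = (if r = 0 then 0 else base ^ (r - 1))"
  proof (cases r)
    case (Suc s)
    then show ?thesis
      using assms(1) by (simp add: of_bool_def if_distrib[of "\<lambda>x. x * _"] sum.delta cong: if_cong)
  qed simp
  ultimately have "key v' + (if r = 0 then 0 else base ^ (r - 1)) = key v + base ^ r"
    by (simp add: sum.distrib key_def)
  then show ?thesis using stride_add[of r] by linarith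
qed

lemma inside_open:
  assumes "\<And>i. i < K \<Longrightarrow> 1 \<le> v i \<and> v i \<le> n + 1" "r < K" "inside K (key v + stride r)" "r > 0"
  shows "v (r - 1) > 1"
proof -
  define v' where "v' = (\<lambda>i. if i = r then v i + 1 else if Suc i = r then v i - 1 else v i)"
  have "key v' = key v + stride r"
    by (rule key_step[OF assms(2)]) (use assms(1) in \<open>force simp: v'_def\<close>)
  moreover have "v' i < base" if "i < K" for i
    using assms(1)[OF that] by (auto simp: v'_def base_def)
  ultimately have "1 \<le> v' (r - 1)" using assms inside_key[of v'] by auto
  then show ?thesis using assms(4) by (auto simp: v'_def split: if_splits)
qed

lemma inside_close:
  assumes "\<And>i. i < K \<Longrightarrow> 1 \<le> v i \<and> v i \<le> n + 1" "r < K" "inside K (key v - stride r)"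
  shows "v r > 1"
proof -
  define v' where "v' = (\<lambda>i. if i = r then v i - 1 else if Suc i = r then v i + 1 else v i)"
  have "key v = key v' + stride r"
    by (rule key_step[OF assms(2)]) (use assms(1) in \<open>force simp: v'_def\<close>)
  moreover have "v' i < base" if "i < K" for i
    using assms(1)[OF that] by (auto simp: v'_def base_def)
  ultimately have "1 \<le> v' r" using assms inside_key[of v'] by auto
  then show ?thesis by (auto simp: v'_def)
qed

lemma target_bounds:
  assumes "inside K x" "x < base ^ K" "r < K"
  shows "stride r \<le> x" "x + stride r < base ^ K"
proof -
  obtain v where v: "x = key v" "\<forall>r. v r < base" by (rule key_exists[OF assms(2)])
  then have r: "\<And>r. r < K \<Longrightarrow> 1 \<le> v r \<and> v r \<le> n + 1" using inside_key[of v] assms by auto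
  have "v r * base ^ r \<le> key v" unfolding key_def using assms(3) by (intro member_le_sum) auto
  moreover have "1 * base ^ r \<le> v r * base ^ r" using r[OF assms(3)] by (intro mult_le_mono1) auto
  ultimately show "stride r \<le> x" using stride_le[of r] v by linarith
  define v' where "v' = (\<lambda>i. if i = r then v i + 1 else if Suc i = r then v i - 1 else v i)"
  have "key v' = key v + stride r"
    by (rule key_step[OF assms(3)]) (use r in \<open>force simp: v'_def\<close>)
  moreover have "key v' < base ^ K"
    by (rule key_less) (use r in \<open>force simp: v'_def base_def\<close>)
  ultimately show "x + stride r < base ^ K" using v by simp
qed

lemma target_less:
  assumes "inside K x" "x < base ^ K" "mv \<in> insert Skip (set moves)"
  shows "target mv x < base ^ K"
  using assms target_bounds(2)[OF assms(1,2)] by (auto simp: moves_def intro: le_less_trans[OF diff_le_self])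

lemma vec_ge: "vec T r \<ge> 1" by (simp add: vec_def)

lemma vec_le:
  assumes "state t T" "t \<le> n"
  shows "vec T r \<le> n + 1"
proof -
  have "row T r \<subseteq> {1..n}" using assms row_subset[of T r] by (force simp: state_def)
  from card_mono[OF _ this] show ?thesis by (simp add: vec_def)
qed

lemma vec_less_base: "state t T \<Longrightarrow> t \<le> n \<Longrightarrow> vec T r < base"
  using vec_le[of t T r] by (simp add: base_def)

lemma inside_shape_key:
  assumes "state t T" "t \<le> n"
  shows "inside K (shape_key T)"
  unfolding shape_key_def using vec_le[OF assms] vec_ge vec_less_base[OF assms]
  by (subst inside_key) auto

lemma shape_key_less:
  assumes "state t T" "t \<le> n"
  shows "shape_key T < base ^ K"
  unfolding shape_key_def using vec_less_base[OF assms] by (intro key_less)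

lemma shape_key_step:
  assumes "tableau T" "tableau T'" "r < K" "\<And>i. card (row T' i) = card (row T i) + of_bool (i = r)"
  shows "shape_key T' = shape_key T + stride r"
  unfolding shape_key_def
proof (rule key_step[OF assms(3)])
  fix i
  show "vec T' i + of_bool (Suc i = r) = vec T i + of_bool (i = r)"
    using card_row_mono[OF assms(1), of i] card_row_mono[OF assms(2), of i] unfolding vec_def assms(4)
    by auto
qed

lemma shape_key_origin:
  assumes "tableau T" "length T = K" "shape_key T = origin"
  shows "\<Union>(set T) = {}"
proof -
  have "1 * base ^ i = vec T i * base ^ i" if "i < K" for i
    using assms(3) that vec_ge unfolding shape_key_def origin_def key_def
    by (intro sum_mono_inv[of "\<lambda>i. 1 * base ^ i" "{..<K}" "\<lambda>i. vec T i * base ^ i" i]) auto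
  then have eq: "card (row T i) = card (row T (Suc i))" if "i < K" for i
    using that card_row_mono[OF assms(1), of i] base_gt by (force simp: vec_def)
  have "card (row T i) = 0" if "i \<le> K" for i
    using that
  proof (induction rule: inc_induct)
    case base
    show ?case by (simp add: row_def assms(2))
  qed (simp add: eq)
  then have "row T i = {}" if "i < K" for i
    using less_imp_le[OF that] tableau_finite[OF assms(1), of "row T i"] that assms(2)
    by (metis card_0_eq nth_mem row_def)
  then show ?thesis using assms(2) by (auto simp: row_def in_set_conv_nth)
qed

lemma shape_key_empty: "shape_key (replicate K {}) = origin"
proof -
  have "vec (replicate K {}) = (\<lambda>_. 1)" by (auto simp: vec_def row_def fun_eq_iff)
  then show ?thesis by (simp add: shape_key_def origin_def)
qed

lemma state_empty: "state 0 (replicate K {})"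
proof -
  have "tableau (replicate j {})" for j
  proof (induction j)
    case (Suc j)
    moreover have "hd_row (replicate j {}) = {}" by (cases j) auto
    ultimately show ?case by simp
  qed simp
  then show ?thesis by (auto simp: state_def)
qed

lemma walks_inside: "ws \<in> walks m x \<Longrightarrow> inside K x"
  using inside_origin by (cases m) auto

lemma walks_length: "ws \<in> walks m x \<Longrightarrow> length ws = m"
  by (induction m arbitrary: ws x) auto

lemma card_row_open:
  assumes "r < length T" "x \<notin> T ! r" "finite (T ! r)"
  shows "card (row (T[r := insert x (T ! r)]) i) = card (row T i) + of_bool (i = r)"
  using assms by (auto simp: row_def)

lemma Union_open:
  assumes "r < length T"
  shows "\<Union>(set (T[r := insert x (T ! r)])) = insert x (\<Union>(set T))"
proof -
  have "set T = insert (T ! r) (set (take r T) \<union> set (drop (Suc r) T))"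
    by (subst id_take_nth_drop[OF assms]) auto
  moreover have "set (T[r := insert x (T ! r)]) = insert (insert x (T ! r)) (set (take r T) \<union> set (drop (Suc r) T))"
    by (subst upd_conv_take_nth_drop[OF assms]) auto
  ultimately show ?thesis by auto
qed

lemma forward_open:
  assumes "state t T" "t < n" "r < K" "inside K (shape_key T + stride r)"
  shows "state (Suc t) (act t (Open r) T)" "shape_key (act t (Open r) T) = shape_key T + stride r"
    "\<Union>(set (act t (Open r) T)) = insert (Suc t) (\<Union>(set T))"
proof -
  have tab: "tableau T" "length T = K" and sub: "\<Union>(set T) \<subseteq> {1..t}" using assms by (auto simp: state_def)
  have U: "\<Union>(set (act t (Open r) T)) = insert (Suc t) (\<Union>(set T))"
    using assms(3) tab by (simp add: Union_open)
  have add: "r = 0 \<or> card (row T r) < card (row T (r - 1))"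
    using inside_open[of "vec T" r] vec_ge vec_le[OF assms(1)] assms(2-4)
    by (auto simp: shape_key_def vec_def)
  have tab': "tableau (act t (Open r) T)"
    using tableau_add_max[of T "Suc t" r] tab add sub assms(3) by force
  show "state (Suc t) (act t (Open r) T)" using tab' U tab sub by (auto simp: state_def)
  have "Suc t \<notin> T ! r" using sub tab(2) assms(3) nth_mem[of r T] by fastforce
  then show "shape_key (act t (Open r) T) = shape_key T + stride r"
    using tab tab' assms(3) tableau_finite[OF tab(1)]
    by (intro shape_key_step) (auto simp: card_row_open)
  show "\<Union>(set (act t (Open r) T)) = insert (Suc t) (\<Union>(set T))" by (rule U)
qed

lemma forward_close:
  assumes "state t T" "t < n" "r < K" "inside K (shape_key T - stride r)"
  obtains x where "row_extract r T = (x, act t (Close r) T)" "state t (act t (Close r) T)"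
    "shape_key (act t (Close r) T) = shape_key T - stride r"
    "\<Union>(set (act t (Close r) T)) = \<Union>(set T) - {x}" "x \<in> \<Union>(set T)"
    "row_insert x (act t (Close r) T) = T" "landing x (act t (Close r) T) = r"
    "card (row T (Suc r)) < card (row T r)"
proof -
  have tab: "tableau T" "length T = K" and sub: "\<Union>(set T) \<subseteq> {1..t}" using assms by (auto simp: state_def)
  have rem: "card (row T (Suc r)) < card (row T r)"
    using inside_close[of "vec T" r] vec_ge vec_le[OF assms(1)] assms(2-4)
    by (auto simp: shape_key_def vec_def)
  obtain x T' where e: "row_extract r T = (x, T')" by fastforce
  note p = row_extract_props[OF tab(1) rem e]
  have "x \<in> \<Union>(set T)" using p hd_row_subset by blast
  have "shape_key T = shape_key T' + stride r"
    by (rule shape_key_step) (use p tab assms(3) card_row_insert[of T' x] in auto)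
  then show ?thesis using that[of x] p e tab sub rem \<open>x \<in> \<Union>(set T)\<close> by (auto simp: state_def)
qed

lemma forward:
  assumes "state t T" "t < n" "mv # ws \<in> walks (n - t) (shape_key T)"
  shows "state (Suc t) (act t mv T)" "shape_key (act t mv T) = target mv (shape_key T)"
    "ws \<in> walks (n - Suc t) (shape_key (act t mv T))"
proof -
  have nt: "n - t = Suc (n - Suc t)" using assms by simp
  have w: "ws \<in> walks (n - Suc t) (target mv (shape_key T))" "mv \<in> insert Skip (set moves)"
    using assms(3) unfolding nt by auto
  note i = walks_inside[OF w(1)]
  have "state (Suc t) (act t mv T) \<and> shape_key (act t mv T) = target mv (shape_key T)"
  proof (cases mv)
    case Skip
    then show ?thesis using assms(1) by (auto simp: state_def)
  next
    case (Open r)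
    then show ?thesis using forward_open[OF assms(1,2), of r] i w by (auto simp: moves_def)
  next
    case (Close r)
    then have "r < K" using w by (auto simp: moves_def)
    from forward_close[OF assms(1,2) this] Close i obtain x where
      "state t (act t (Close r) T)" "shape_key (act t (Close r) T) = shape_key T - stride r" by auto
    then show ?thesis using Close by (auto simp: state_def)
  qed
  then show "state (Suc t) (act t mv T)" "shape_key (act t mv T) = target mv (shape_key T)"
    "ws \<in> walks (n - Suc t) (shape_key (act t mv T))" using w by auto
qed

lemma decode_snd: "(i, j) \<in> decode t T ws \<Longrightarrow> t < j"
proof (induction ws arbitrary: t T)
  case (Cons mv ws)
  show ?case using Cons.IH[of "Suc t" "act t mv T"] Cons.prems by (cases mv) auto
qed simp

lemma decode_arcs_conj:
  assumes "state t T" "t \<le> n" "ws \<in> walks (n - t) (shape_key T)"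
  shows "(\<forall>(i, j)\<in>decode t T ws. 1 \<le> i \<and> i < j \<and> t < j \<and> j \<le> n \<and> (i \<le> t \<longrightarrow> i \<in> \<Union>(set T))) \<and>
    (\<forall>e\<in>decode t T ws. \<forall>e'\<in>decode t T ws. {fst e, snd e} \<inter> {fst e', snd e'} \<noteq> {} \<longrightarrow> e = e')"
  using assms
proof (induction ws arbitrary: t T)
  case (Cons mv ws)
  have "t < n" using walks_length[OF Cons.prems(3)] by simp
  note f = forward[OF Cons.prems(1) this Cons.prems(3)]
  define T' D where "T' = act t mv T" and "D = decode (Suc t) T' ws"
  have IH: "\<And>i j. (i, j) \<in> D \<Longrightarrow> 1 \<le> i \<and> i < j \<and> Suc t < j \<and> j \<le> n \<and> (i \<le> Suc t \<longrightarrow> i \<in> \<Union>(set T'))"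
    "\<And>e e'. e \<in> D \<Longrightarrow> e' \<in> D \<Longrightarrow> {fst e, snd e} \<inter> {fst e', snd e'} \<noteq> {} \<Longrightarrow> e = e'"
    using Cons.IH[OF f(1) _ f(3)] \<open>t < n\<close> unfolding D_def T'_def by (auto simp: Suc_le_eq)
  have dec: "decode t T (mv # ws) = arc t mv T \<union> D" by (simp add: D_def T'_def)
  have nt: "n - t = Suc (n - Suc t)" using \<open>t < n\<close> by simp
  have mv: "mv \<in> insert Skip (set moves)" "inside K (target mv (shape_key T))"
    using Cons.prems(3) walks_inside unfolding nt by auto
  have sub: "\<Union>(set T) \<subseteq> {1..t}" using Cons.prems by (simp add: state_def)
  show ?case
  proof (cases mv)
    case Skip
    then have D: "decode t T (mv # ws) = D" "T' = T" using dec by (auto simp: T'_def)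
    have "1 \<le> i \<and> i < j \<and> t < j \<and> j \<le> n \<and> (i \<le> t \<longrightarrow> i \<in> \<Union>(set T))" if "(i, j) \<in> D" for i j
      using IH(1)[OF that] D(2) by auto
    then show ?thesis unfolding D(1) using IH(2) by blast
  next
    case (Open r)
    then have D: "decode t T (mv # ws) = D" using dec by auto
    have U: "\<Union>(set T') = insert (Suc t) (\<Union>(set T))" unfolding T'_def Open
      by (rule forward_open(3)[OF Cons.prems(1) \<open>t < n\<close>]) (use Open mv in \<open>auto simp: moves_def\<close>)
    have "1 \<le> i \<and> i < j \<and> t < j \<and> j \<le> n \<and> (i \<le> t \<longrightarrow> i \<in> \<Union>(set T))" if "(i, j) \<in> D" for i j
      using IH(1)[OF that] U by auto
    then show ?thesis unfolding D using IH(2) by blast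
  next
    case (Close r)
    have "r < K" "inside K (shape_key T - stride r)" using Close mv by (auto simp: moves_def)
    from forward_close[OF Cons.prems(1) \<open>t < n\<close> this] obtain x where
      x: "row_extract r T = (x, T')" "\<Union>(set T') = \<Union>(set T) - {x}" "x \<in> \<Union>(set T)"
      unfolding T'_def Close by metis
    then have D: "decode t T (mv # ws) = insert (x, Suc t) D" using dec Close by auto
    have xt: "1 \<le> x" "x \<le> t" using x sub by auto
    have new: "{fst e, snd e} \<inter> {x, Suc t} = {}" if "e \<in> D" for e
    proof -
      have e: "(fst e, snd e) \<in> D" using that by simp
      have "fst e \<noteq> x" "fst e \<noteq> Suc t" using IH(1)[OF e] x sub xt by auto
      then show ?thesis using IH(1)[OF e] xt by auto
    qed
    have "1 \<le> i \<and> i < j \<and> t < j \<and> j \<le> n \<and> (i \<le> t \<longrightarrow> i \<in> \<Union>(set T))"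
      if "(i, j) \<in> insert (x, Suc t) D" for i j
      using that IH(1)[of i j] xt x(2,3) \<open>t < n\<close> by auto
    moreover have "e = e'" if e: "e \<in> insert (x, Suc t) D" "e' \<in> insert (x, Suc t) D"
      "{fst e, snd e} \<inter> {fst e', snd e'} \<noteq> {}" for e e'
    proof -
      consider "e \<in> D" "e' \<in> D" | "e = (x, Suc t)" "e' \<in> D" | "e \<in> D" "e' = (x, Suc t)"
        | "e = (x, Suc t)" "e' = (x, Suc t)" using e(1,2) by blast
      then show ?thesis
      proof cases
        case 2
        then show ?thesis using new[of e'] e(3) by (simp only: fst_conv snd_conv Int_commute)
      next
        case 3
        then show ?thesis using new[of e] e(3) by (simp only: fst_conv snd_conv)
      qed (use IH(2) e in auto)
    qed
    ultimately show ?thesis unfolding D by blast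
  qed
qed auto

lemmas decode_arcs = decode_arcs_conj[THEN conjunct1] decode_arcs_conj[THEN conjunct2]

text \<open>Reading the closers from right to left, \<open>word t\<close> lists their openers.\<close>

definition word :: "nat \<Rightarrow> (nat \<times> nat) set \<Rightarrow> nat set list" where
  "word t \<mu> = map (\<lambda>j. {i. (i, j) \<in> \<mu>}) (rev [Suc t..<Suc n])"

lemma word_Suc:
  assumes "t < n"
  shows "word t \<mu> = word (Suc t) \<mu> @ [{i. (i, Suc t) \<in> \<mu>}]"
proof -
  have "[Suc t..<Suc n] = Suc t # [Suc (Suc t)..<Suc n]" using assms by (simp add: upt_conv_Cons)
  then show ?thesis by (simp add: word_def del: upt_Suc)
qed

lemma word_dchain:
  assumes "state t T" "t \<le> n" "ws \<in> walks (n - t) (shape_key T)" "m \<le> Suc t"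
  shows "dchain (word t (decode t T ws)) b m h \<longleftrightarrow> dchain (rev T) b m h"
  using assms
proof (induction ws arbitrary: t T b m h)
  case Nil
  have "n - t = 0" using walks_length[OF Nil(3)] by simp
  then have "t = n" using Nil(2) by simp
  have "shape_key T = origin" using Nil(3) \<open>n - t = 0\<close> by simp
  then have "\<Union>(set (rev T)) = {}" using shape_key_origin[of T] Nil(1) unfolding state_def set_rev by blast
  then show ?case using \<open>t = n\<close> by (subst dchain_empty_rows) (auto simp: word_def)
next
  case (Cons mv ws)
  have "t < n" using walks_length[OF Cons.prems(3)] by simp
  note f = forward[OF Cons.prems(1) this Cons.prems(3)]
  define T' D where "T' = act t mv T" and "D = decode (Suc t) T' ws"
  have IH: "\<And>b m h. m \<le> Suc (Suc t) \<Longrightarrow> dchain (word (Suc t) D) b m h \<longleftrightarrow> dchain (rev T') b m h"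
    using Cons.IH[OF f(1) _ f(3)] \<open>t < n\<close> unfolding D_def T'_def by (auto simp: Suc_le_eq)
  have dec: "decode t T (mv # ws) = arc t mv T \<union> D" by (simp add: D_def T'_def)
  have nt: "n - t = Suc (n - Suc t)" using \<open>t < n\<close> by simp
  have mv: "mv \<in> insert Skip (set moves)" "inside K (target mv (shape_key T))"
    using Cons.prems(3) walks_inside unfolding nt by auto
  have D0: "(i, Suc t) \<notin> D" for i using decode_snd unfolding D_def by blast
  have w1: "word (Suc t) (decode t T (mv # ws)) = word (Suc t) D"
    unfolding word_def dec by (cases mv) auto
  have sub: "\<Union>(set T) \<subseteq> {1..t}" "length T = K" "tableau T" using Cons.prems by (auto simp: state_def)
  have empty: "dchain (word t (decode t T (mv # ws))) b m h \<longleftrightarrow> dchain (rev T') b m h"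
    if "arc t mv T = {}"
  proof -
    have "word t (decode t T (mv # ws)) = word (Suc t) D @ [{}]"
      using that D0 unfolding word_Suc[OF \<open>t < n\<close>] w1 dec by simp
    then have "dchain (word t (decode t T (mv # ws))) b m h \<longleftrightarrow> dchain (word (Suc t) D @ []) b m h"
      by (simp only:) (rule dchain_cong_right, auto)
    then show ?thesis using IH[of m] Cons.prems by simp
  qed
  show ?case
  proof (cases mv)
    case Skip
    then show ?thesis using empty by (simp add: T'_def)
  next
    case (Open r)
    have "r < length T" using Open mv sub by (auto simp: moves_def)
    have "map (\<lambda>R. R \<inter> {..<Suc t}) T' = map (\<lambda>R. R \<inter> {..<Suc t}) T"
      unfolding T'_def Open using \<open>r < length T\<close>
      by (intro nth_equalityI) (auto simp: nth_list_update)
    then have "map (\<lambda>R. R \<inter> {..<Suc t}) (rev T') = map (\<lambda>R. R \<inter> {..<Suc t}) (rev T)"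
      by (simp only: rev_map[symmetric])
    then have "dchain (rev T') b m h \<longleftrightarrow> dchain (rev T) b m h"
      using dchain_restrict[of m "Suc t"] Cons.prems(4) by metis
    then show ?thesis using empty Open by simp
  next
    case (Close r)
    have "r < K" "inside K (shape_key T - stride r)" using Close mv by (auto simp: moves_def)
    from forward_close[OF Cons.prems(1) \<open>t < n\<close> this] obtain x where
      x: "row_extract r T = (x, T')" "state t T'" "\<Union>(set T') = \<Union>(set T) - {x}" "row_insert x T' = T"
      unfolding T'_def Close by metis
    have "{i. (i, Suc t) \<in> decode t T (mv # ws)} = {x}"
      unfolding dec using D0 x(1) Close by auto
    then have "word t (decode t T (mv # ws)) = word (Suc t) D @ [{x}]"
      unfolding word_Suc[OF \<open>t < n\<close>] w1 by (simp only:)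
    then have "dchain (word t (decode t T (mv # ws))) b m h \<longleftrightarrow> dchain (rev T' @ [{x}]) b m h"
      by (simp only:) (rule dchain_cong_left[where M = "Suc (Suc t)"], use IH Cons.prems in auto)
    also have "\<dots> \<longleftrightarrow> dchain (rev (row_insert x T')) b m h"
      by (rule dchain_row_insert[symmetric]) (use x in \<open>auto simp: state_def\<close>)
    finally show ?thesis using x by simp
  qed
qed

lemma sorted_rev_upt: "sorted_wrt (>) (rev [a..<b])"
  by (simp add: sorted_wrt_rev)

lemma decode_noncrossing:
  assumes "state t T" "t \<le> n" "ws \<in> walks (n - t) (shape_key T)"
  shows "noncrossing (Suc K) (decode t T ws)"
  using assms
proof (induction ws arbitrary: t T)
  case Nil
  then show ?case by (auto simp: noncrossing_def is_crossing_def)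
next
  case (Cons mv ws)
  have "t < n" using walks_length[OF Cons.prems(3)] by simp
  note f = forward[OF Cons.prems(1) this Cons.prems(3)]
  have IH: "noncrossing (Suc K) (decode (Suc t) (act t mv T) ws)"
    using Cons.IH[OF f(1) _ f(3)] \<open>t < n\<close> by simp
  let ?D = "decode t T (mv # ws)"
  note arcs = decode_arcs(1)[OF Cons.prems]
  show ?case unfolding noncrossing_def
  proof
    assume "\<exists>S\<subseteq>?D. is_crossing (Suc K) S"
    then obtain ps where ps: "length ps = Suc K" "set ps \<subseteq> ?D" "sorted_wrt desc ps"
      "fst (hd ps) < snd (last ps)" by (auto simp: is_crossing_alt)
    then obtain p qs where p: "ps = p # qs" by (cases ps) auto
    have hd: "fst q \<le> fst (hd ps)" if "q \<in> set ps" for q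
      using that ps(3) p by (auto simp: desc_def)
    have last: "snd (last ps) \<le> snd q" if "q \<in> set ps" for q
    proof -
      have "ps = butlast ps @ [last ps]" using p by simp
      then have "sorted_wrt desc (butlast ps @ [last ps])" "set ps = set (butlast ps @ [last ps])"
        using ps(3) by simp_all
      then show ?thesis using that by (auto simp: sorted_wrt_append desc_def intro: less_imp_le)
    qed
    show False
    proof (cases "fst (hd ps) \<le> t")
      case True
      have "dchain (word t ?D) 0 (Suc t) (Suc K)"
        unfolding word_def dchain_pairs[OF sorted_rev_upt]
      proof (intro exI[of _ ps] conjI ballI)
        have "snd q \<in> set (rev [Suc t..<Suc n])" if "q \<in> set ps" for q
          using bspec[OF arcs, of q] ps(2) that by (auto simp: case_prod_beta)
        then show "snd ` set ps \<subseteq> set (rev [Suc t..<Suc n])" by blast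
        show "fst q < Suc t" if "q \<in> set ps" for q using hd[OF that] True by simp
      qed (use ps in auto)
      then have "dchain (rev T) 0 (Suc t) (Suc K)" using word_dchain[OF Cons.prems, of "Suc t"] by simp
      then show False using dchain_length Cons.prems(1) by (fastforce simp: state_def)
    next
      case False
      have "set ps \<subseteq> decode (Suc t) (act t mv T) ws"
      proof
        fix q assume q: "q \<in> set ps"
        then have "Suc t < snd q" using last[OF q] ps(4) False by simp
        then show "q \<in> decode (Suc t) (act t mv T) ws" using q ps(2) by (cases mv) auto
      qed
      then show False using IH ps unfolding noncrossing_def by (auto simp: is_crossing_alt)
    qed
  qed
qed

lemma decode_in_nc_matchings:
  assumes "ws \<in> walks n origin"
  shows "decode 0 (replicate K {}) ws \<in> nc_matchings (Suc K) n"
  using decode_noncrossing[OF state_empty] decode_arcs[OF state_empty] assms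
  by (fastforce simp: nc_matchings_def partial_matching_alt shape_key_empty)

lemma decode_inj:
  assumes "state t T" "state t T'" "t \<le> n" "ws \<in> walks (n - t) (shape_key T)"
    "ws' \<in> walks (n - t) (shape_key T')" "decode t T ws = decode t T' ws'"
  shows "T = T' \<and> ws = ws'"
  using assms
proof (induction ws arbitrary: t T T' ws')
  case Nil
  have "n - t = 0" using walks_length[OF Nil(4)] by simp
  then have "shape_key T = origin" "shape_key T' = origin" "ws' = []"
    using Nil(4,5) by simp_all
  then have "\<Union>(set T) = {}" "\<Union>(set T') = {}"
    using Nil(1,2) shape_key_origin[of T] shape_key_origin[of T'] unfolding state_def by blast+
  then have "T = replicate K {}" "T' = replicate K {}"
    using Nil by (auto simp: state_def intro!: replicate_eqI)
  then show ?case using \<open>ws' = []\<close> by simp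
next
  case (Cons mv ws)
  have "t < n" using walks_length[OF Cons.prems(4)] by simp
  obtain mv' vs where ws': "ws' = mv' # vs"
    using walks_length[OF Cons.prems(5)] \<open>t < n\<close> by (cases ws') auto
  note f = forward[OF Cons.prems(1) \<open>t < n\<close> Cons.prems(4)]
  note f' = forward[OF Cons.prems(2) \<open>t < n\<close> Cons.prems(5)[unfolded ws']]
  have nt: "n - t = Suc (n - Suc t)" using \<open>t < n\<close> by simp
  have mv: "mv \<in> insert Skip (set moves)" "inside K (target mv (shape_key T))"
    using Cons.prems(4) walks_inside unfolding nt by auto
  have mv': "mv' \<in> insert Skip (set moves)" "inside K (target mv' (shape_key T'))"
    using Cons.prems(5) walks_inside unfolding nt ws' by auto
  have split: "arc t mv S = {e \<in> decode t S (mv # us). snd e = Suc t}"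
    "decode (Suc t) (act t mv S) us = {e \<in> decode t S (mv # us). snd e \<noteq> Suc t}" for S us mv
  proof -
    have "\<forall>e\<in>decode (Suc t) (act t mv S) us. snd e \<noteq> Suc t"
      using decode_snd[of _ _ "Suc t" "act t mv S" us] by fastforce
    moreover have "\<forall>e\<in>arc t mv S. snd e = Suc t" by (cases mv) auto
    ultimately show "arc t mv S = {e \<in> decode t S (mv # us). snd e = Suc t}"
      "decode (Suc t) (act t mv S) us = {e \<in> decode t S (mv # us). snd e \<noteq> Suc t}"
      unfolding decode.simps by blast+
  qed
  have eqs: "arc t mv T = arc t mv' T'"
    "decode (Suc t) (act t mv T) ws = decode (Suc t) (act t mv' T') vs"
    by (simp_all only: split[of mv T ws] split[of mv' T' vs] Cons.prems(6) ws')
  have IH: "act t mv T = act t mv' T'" "ws = vs"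
    using Cons.IH[OF f(1) f'(1) _ f(3) f'(3) eqs(2)] \<open>t < n\<close> by auto
  have U: "Suc t \<in> \<Union>(set (act t mv S)) \<longleftrightarrow> (\<exists>r. mv = Open r)"
    if "state t S" "mv \<in> insert Skip (set moves)" "inside K (target mv (shape_key S))" for mv S
  proof (cases mv)
    case Skip
    then show ?thesis using that by (auto simp: state_def)
  next
    case (Open r)
    have "\<Union>(set (act t mv S)) = insert (Suc t) (\<Union>(set S))" unfolding Open
      by (rule forward_open(3)[OF that(1) \<open>t < n\<close>]) (use that Open in \<open>auto simp: moves_def\<close>)
    then show ?thesis using Open by blast
  next
    case (Close r)
    have "r < K" "inside K (shape_key S - stride r)" using Close that by (auto simp: moves_def)
    from forward_close[OF that(1) \<open>t < n\<close> this]
    have "state t (act t mv S)" unfolding Close by metis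
    then show ?thesis using Close by (auto simp: state_def)
  qed
  have key: "mv = mv' \<and> T = T'"
  proof (cases mv)
    case Skip
    then have "mv' = Skip" using eqs(1) U[OF Cons.prems(1) mv] U[OF Cons.prems(2) mv'] IH by (cases mv') auto
    then show ?thesis using IH Skip by simp
  next
    case (Open r)
    then obtain r' where r': "mv' = Open r'"
      using U[OF Cons.prems(1) mv] U[OF Cons.prems(2) mv'] IH by auto
    have len: "length T = K" "length T' = K" "r < K" "r' < K"
      using Cons.prems mv mv' Open r' by (auto simp: state_def moves_def)
    have "Suc t \<notin> \<Union>(set T)" "Suc t \<notin> \<Union>(set T')"
      using Cons.prems(1,2) by (auto simp: state_def)
    then have nin: "Suc t \<notin> T ! i" "Suc t \<notin> T' ! i" if "i < K" for i
      using that len nth_mem[of i T] nth_mem[of i T'] by auto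
    have e: "T[r := insert (Suc t) (T ! r)] = T'[r' := insert (Suc t) (T' ! r')]"
      using IH Open r' by simp
    have "r = r'"
    proof (rule ccontr)
      assume "r \<noteq> r'"
      then have "T' ! r = insert (Suc t) (T ! r)" using arg_cong[OF e, of "\<lambda>l. l ! r"] len by simp
      then show False using nin len by auto
    qed
    have "T ! i = T' ! i" if "i < K" for i
    proof (cases "i = r")
      case True
      then have "insert (Suc t) (T ! i) = insert (Suc t) (T' ! i)"
        using arg_cong[OF e, of "\<lambda>l. l ! r"] len \<open>r = r'\<close> by simp
      then show ?thesis using nin[OF that] by (simp add: insert_ident)
    next
      case False
      then show ?thesis using arg_cong[OF e, of "\<lambda>l. l ! i"] len \<open>r = r'\<close> that by simp
    qed
    then have "T = T'" using len by (intro nth_equalityI) auto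
    then show ?thesis using Open r' \<open>r = r'\<close> by simp
  next
    case (Close r)
    then obtain r' where r': "mv' = Close r'" using eqs(1) by (cases mv') auto
    have "r < K" "inside K (shape_key T - stride r)" using Close mv by (auto simp: moves_def)
    from forward_close[OF Cons.prems(1) \<open>t < n\<close> this] obtain x where
      x: "row_extract r T = (x, act t mv T)" "row_insert x (act t mv T) = T" "landing x (act t mv T) = r"
      unfolding Close by metis
    have "r' < K" "inside K (shape_key T' - stride r')" using r' mv' by (auto simp: moves_def)
    from forward_close[OF Cons.prems(2) \<open>t < n\<close> this] obtain x' where
      x': "row_extract r' T' = (x', act t mv' T')" "row_insert x' (act t mv' T') = T'"
        "landing x' (act t mv' T') = r'"
      unfolding r' by metis
    have "arc t mv T = {(x, Suc t)}" "arc t mv' T' = {(x', Suc t)}"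
      unfolding Close r' arc.simps using x(1) x'(1) by (metis fst_conv)+
    then have "x = x'" using eqs(1) by simp
    then have "T = T'" using x(2) x'(2) IH(1) by metis
    moreover have "r = r'" using x(3) x'(3) IH(1) \<open>x = x'\<close> by metis
    ultimately show ?thesis using Close r' by simp
  qed
  then show ?case using IH ws' by simp
qed

lemma walks_extend:
  assumes "state t T" "t < n" "mv \<in> insert Skip (set moves)"
    "ws \<in> walks (n - Suc t) (target mv (shape_key T))"
  shows "mv # ws \<in> walks (n - t) (shape_key T)"
proof -
  have nt: "n - t = Suc (n - Suc t)" using assms by simp
  show ?thesis unfolding nt using assms inside_shape_key[of t T] by auto
qed

lemma decode_onto:
  assumes \<mu>: "\<mu> \<in> nc_matchings (Suc K) n" and "t \<le> n"
  shows "\<exists>T ws. state t T \<and> ws \<in> walks (n - t) (shape_key T) \<and>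
    decode t T ws = {(i, j) \<in> \<mu>. t < j} \<and> \<Union>(set T) = {i. i \<le> t \<and> (\<exists>j>t. (i, j) \<in> \<mu>)}"
  using assms(2)
proof (induction rule: inc_induct)
  case base
  have "\<mu> \<subseteq> {(i, j). 1 \<le> i \<and> i < j \<and> j \<le> n}" using \<mu> by (auto simp: nc_matchings_def partial_matching_def)
  moreover have "state n (replicate K {})" using state_empty by (auto simp: state_def)
  ultimately show ?case
    by (intro exI[of _ "replicate K {}"] exI[of _ "[]"]) (auto simp: shape_key_empty)
next
  case (step t)
  then have "t < n" by simp
  have arcs: "\<And>i j. (i, j) \<in> \<mu> \<Longrightarrow> 1 \<le> i \<and> i < j \<and> j \<le> n"
    and uniq: "\<And>e e'. e \<in> \<mu> \<Longrightarrow> e' \<in> \<mu> \<Longrightarrow> {fst e, snd e} \<inter> {fst e', snd e'} \<noteq> {} \<Longrightarrow> e = e'"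
    using \<mu> by (auto simp: nc_matchings_def partial_matching_alt)
  obtain T ws where T: "state (Suc t) T" "ws \<in> walks (n - Suc t) (shape_key T)"
    "decode (Suc t) T ws = {(i, j) \<in> \<mu>. Suc t < j}"
    "\<Union>(set T) = {i. i \<le> Suc t \<and> (\<exists>j>Suc t. (i, j) \<in> \<mu>)}"
    using step.IH by blast
  have tab: "tableau T" "length T = K" "\<Union>(set T) \<subseteq> {1..Suc t}" using T by (auto simp: state_def)
  consider (op) j where "(Suc t, j) \<in> \<mu>" | (cl) i where "(i, Suc t) \<in> \<mu>"
    | (iso) "\<And>j. (Suc t, j) \<notin> \<mu>" "\<And>i. (i, Suc t) \<notin> \<mu>" by blast
  then show ?case
  proof cases
    case op
    have nocl: "(i, Suc t) \<notin> \<mu>" for i using uniq[OF op, of "(i, Suc t)"] arcs[of i "Suc t"] by auto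
    have "Suc t \<in> \<Union>(set T)" using T(4) op arcs[OF op] by auto
    then obtain r where r: "r < K" "Suc t \<in> T ! r" using tab by (auto simp: in_set_conv_nth)
    define T0 where "T0 = map (\<lambda>R. R - {Suc t}) T"
    have "tableau T0" unfolding T0_def using tab by (intro tableau_remove_max) auto
    have U0: "\<Union>(set T0) = \<Union>(set T) - {Suc t}" by (auto simp: T0_def)
    have "\<Union>(set T0) \<subseteq> {1..t}" unfolding U0 using tab(3) by (auto simp: subset_iff le_Suc_eq)
    then have s0: "state t T0" using \<open>tableau T0\<close> tab(2) by (simp add: state_def T0_def)
    have disj: "Suc t \<notin> T ! i" if "i \<noteq> r" "i < K" for i
    proof -
      have "T ! i \<inter> T ! r = {}" by (rule tableau_disjoint) (use tab that r in auto)
      then show ?thesis using r by blast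
    qed
    have T0T: "T0[r := insert (Suc t) (T0 ! r)] = T"
    proof (rule nth_equalityI)
      fix i assume "i < length (T0[r := insert (Suc t) (T0 ! r)])"
      then have "i < K" using tab by (simp add: T0_def)
      then show "T0[r := insert (Suc t) (T0 ! r)] ! i = T ! i"
        using disj[of i] r tab by (cases "i = r") (auto simp: T0_def)
    qed (simp add: T0_def)
    have "shape_key T = shape_key T0 + stride r"
      by (rule shape_key_step[OF \<open>tableau T0\<close> tab(1) r(1)])
        (subst T0T[symmetric], rule card_row_open,
          use r tab tableau_finite[OF tab(1)] in \<open>auto simp: T0_def\<close>)
    then have "Open r # ws \<in> walks (n - t) (shape_key T0)"
      using T(2) r by (intro walks_extend[OF s0 \<open>t < n\<close>]) (auto simp: moves_def)
    moreover have "decode t T0 (Open r # ws) = {(i, j) \<in> \<mu>. t < j}"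
      using T(3) T0T nocl by (auto intro: Suc_lessD) (metis Suc_lessI)
    moreover have "\<Union>(set T0) = {i. i \<le> t \<and> (\<exists>j>t. (i, j) \<in> \<mu>)}"
      unfolding U0 T(4) using nocl by (auto simp: le_Suc_eq) (metis Suc_lessI Suc_lessD)+
    ultimately show ?thesis using s0 by blast
  next
    case cl
    have noop: "(Suc t, j) \<notin> \<mu>" for j using uniq[OF cl, of "(Suc t, j)"] arcs[OF cl] by auto
    have only: "(i', Suc t) \<in> \<mu> \<longleftrightarrow> i' = i" for i' using uniq[OF cl, of "(i', Suc t)"] cl by auto
    have once: "j = Suc t" if "(i, j) \<in> \<mu>" for j using uniq[OF cl that] by auto
    have later: "t < j \<longleftrightarrow> j = Suc t \<or> Suc t < j" for j by auto
    have it: "1 \<le> i" "i \<le> t" using arcs[OF cl] by auto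
    have UT: "\<Union>(set T) \<subseteq> {1..t}"
    proof
      fix x assume "x \<in> \<Union>(set T)"
      then show "x \<in> {1..t}" using T(4) tab(3) noop by (auto simp: le_Suc_eq)
    qed
    have iT: "i \<notin> \<Union>(set T)" unfolding T(4) using once by blast
    define T0 where "T0 = row_insert i T"
    have tab0: "tableau T0" unfolding T0_def by (rule tableau_row_insert[OF tab(1) iT])
    have U0: "\<Union>(set T0) = insert i (\<Union>(set T))" unfolding T0_def by (rule Union_row_insert[OF tab(1)])
    have land: "landing i T < K"
    proof (rule ccontr)
      assume "\<not> landing i T < K"
      then have l: "landing i T = K" using landing_le[of i T] tab by simp
      then have len: "length T0 = Suc K" unfolding T0_def length_row_insert using tab by simp
      have "card (row T0 K) = card (row T K) + 1"
        using card_row_insert[OF tab(1) iT, of K] l by (simp add: T0_def)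
      then have "T0 ! K \<noteq> {}" using len by (auto simp: row_def)
      then have "last T0 \<noteq> {}" using len by (subst last_conv_nth) auto
      moreover have "\<Union>(set T0) \<subseteq> {..<Suc t}" unfolding U0 using UT it by auto
      moreover have "T0 \<noteq> []" using len by auto
      ultimately obtain y where "dchain (rev T0) y (Suc t) (Suc K)"
        using tableau_dchain[OF tab0] len by metis
      then have "dchain (rev T @ [{i}]) y (Suc t) (Suc K)"
        unfolding T0_def by (simp only: dchain_row_insert[OF tab(1) iT])
      moreover have "dchain (rev T @ [{i}]) y (Suc t) (Suc K) \<longleftrightarrow>
          dchain (word (Suc t) (decode (Suc t) T ws) @ [{i}]) y (Suc t) (Suc K)"
      proof (rule dchain_cong_left[where M = "Suc t"])
        fix b m h assume "m \<le> Suc t"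
        then show "dchain (rev T) b m h \<longleftrightarrow> dchain (word (Suc t) (decode (Suc t) T ws)) b m h"
          using word_dchain[OF T(1) Suc_leI[OF \<open>t < n\<close>] T(2), of m b h] by simp
      qed simp
      moreover have "word (Suc t) (decode (Suc t) T ws) @ [{i}] = word t \<mu>"
      proof -
        have "{i'. (i', Suc t) \<in> \<mu>} = {i}" by (simp add: only)
        moreover have "word (Suc t) (decode (Suc t) T ws) = word (Suc t) \<mu>"
          unfolding T(3) word_def by auto
        ultimately show ?thesis using word_Suc[OF \<open>t < n\<close>] by simp
      qed
      ultimately have "dchain (word t \<mu>) y (Suc t) (Suc K)" by simp
      then obtain ps where ps: "length ps = Suc K" "set ps \<subseteq> \<mu>" "snd ` set ps \<subseteq> set (rev [Suc t..<Suc n])"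
        "sorted_wrt desc ps" "\<forall>p\<in>set ps. y \<le> fst p \<and> fst p < Suc t"
        unfolding word_def dchain_pairs[OF sorted_rev_upt] by blast
      then have "ps \<noteq> []" by auto
      then have "snd (last ps) \<in> set (rev [Suc t..<Suc n])" using ps(3) last_in_set[of ps] by blast
      then have "fst (hd ps) < Suc t" "Suc t \<le> snd (last ps)"
        using ps(5) hd_in_set[of ps] \<open>ps \<noteq> []\<close> by auto
      then have "is_crossing (Suc K) (set ps)"
        using ps by (subst is_crossing_alt) (auto intro!: exI[of _ ps])
      then show False using \<mu> ps(2) by (auto simp: nc_matchings_def noncrossing_def)
    qed
    define r where "r = landing i T"
    have len0: "length T0 = K" unfolding T0_def length_row_insert using land tab by simp
    have s0: "state t T0" using tab0 len0 U0 UT it by (auto simp: state_def)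
    have ex: "row_extract r T0 = (i, T)"
      unfolding r_def T0_def using row_extract_row_insert[OF tab(1) iT] land tab by simp
    have "shape_key T0 = shape_key T + stride r"
      by (rule shape_key_step[OF tab(1) tab0])
        (use land card_row_insert[OF tab(1) iT] in \<open>auto simp: r_def T0_def\<close>)
    then have "Close r # ws \<in> walks (n - t) (shape_key T0)"
      using T(2) land by (intro walks_extend[OF s0 \<open>t < n\<close>]) (auto simp: moves_def r_def)
    moreover have "decode t T0 (Close r # ws) = {(i, j) \<in> \<mu>. t < j}"
      unfolding decode.simps arc.simps act.simps ex fst_conv snd_conv T(3) later
      by (auto simp: only)
    moreover have "\<Union>(set T0) = {i. i \<le> t \<and> (\<exists>j>t. (i, j) \<in> \<mu>)}"
    proof -
      have "\<Union>(set T0) = insert i {i. i \<le> t \<and> (\<exists>j>Suc t. (i, j) \<in> \<mu>)}"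
        unfolding U0 T(4) using noop by (auto simp: le_Suc_eq)
      also have "\<dots> = {i. i \<le> t \<and> (\<exists>j>t. (i, j) \<in> \<mu>)}"
        unfolding later using it by (auto simp: only)
      finally show ?thesis .
    qed
    ultimately show ?thesis using s0 by blast
  next
    case iso
    have UT: "\<Union>(set T) = {i. i \<le> t \<and> (\<exists>j>t. (i, j) \<in> \<mu>)}"
      unfolding T(4) using iso by (auto simp: le_Suc_eq intro: Suc_lessD) (metis Suc_lessI)+
    have s0: "state t T" using T(1) UT by (auto simp: state_def)
    have "Skip # ws \<in> walks (n - t) (shape_key T)"
      using T(2) by (intro walks_extend[OF s0 \<open>t < n\<close>]) auto
    moreover have "decode t T (Skip # ws) = {(i, j) \<in> \<mu>. t < j}"
      using T(3) iso by (auto intro: Suc_lessD) (metis Suc_lessI)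
    ultimately show ?thesis using s0 UT by blast
  qed
qed

theorem decode_bij: "bij_betw (decode 0 (replicate K {})) (walks n origin) (nc_matchings (Suc K) n)"
  unfolding bij_betw_def
proof
  show "inj_on (decode 0 (replicate K {})) (walks n origin)"
    using decode_inj[OF state_empty state_empty] by (auto simp: inj_on_def shape_key_empty)
  show "decode 0 (replicate K {}) ` walks n origin = nc_matchings (Suc K) n"
  proof
    show "nc_matchings (Suc K) n \<subseteq> decode 0 (replicate K {}) ` walks n origin"
    proof
      fix \<mu> assume \<mu>: "\<mu> \<in> nc_matchings (Suc K) n"
      then obtain T ws where T: "state 0 T" "ws \<in> walks n (shape_key T)"
        "decode 0 T ws = {(i, j) \<in> \<mu>. 0 < j}" using decode_onto[OF \<mu>, of 0] by auto
      have "T = replicate K {}" using T(1) by (auto simp: state_def intro!: replicate_eqI)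
      moreover have "{(i, j) \<in> \<mu>. 0 < j} = \<mu>"
        using \<mu> by (auto simp: nc_matchings_def partial_matching_def)
      ultimately show "\<mu> \<in> decode 0 (replicate K {}) ` walks n origin"
        using T by (auto simp: shape_key_empty)
    qed
  qed (auto simp: decode_in_nc_matchings)
qed

end

section \<open>Unranking walks\<close>

fun pick :: "(move \<Rightarrow> nat) \<Rightarrow> move list \<Rightarrow> nat \<Rightarrow> move \<times> nat" where
  "pick f [] u = (Skip, u)"
| "pick f (mv # ms) u = (if u < f mv then (mv, u) else pick f ms (u - f mv))"

lemma pick_bij:
  assumes "distinct ms" "Skip \<notin> set ms"
  shows "bij_betw (pick f ms) {..<(\<Sum>mv\<leftarrow>ms. f mv) + f Skip} (SIGMA mv:insert Skip (set ms). {..<f mv})"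
  using assms
proof (induction ms)
  case Nil
  show ?case by (auto simp: bij_betw_def inj_on_def)
next
  case (Cons mv ms)
  let ?S = "(\<Sum>mv\<leftarrow>ms. f mv) + f Skip"
  have "bij_betw (\<lambda>u. u - f mv) {f mv..<f mv + ?S} {..<?S}"
    by (rule bij_betwI[where g = "\<lambda>u. u + f mv"]) auto
  from bij_betw_trans[OF this Cons.IH]
  have "bij_betw (pick f ms \<circ> (\<lambda>u. u - f mv)) {f mv..<f mv + ?S} (SIGMA mv:insert Skip (set ms). {..<f mv})"
    using Cons.prems by simp
  then have 1: "bij_betw (pick f (mv # ms)) {f mv..<f mv + ?S} (SIGMA mv:insert Skip (set ms). {..<f mv})"
    by (rule bij_betw_cong[THEN iffD1, rotated]) auto
  have 2: "bij_betw (pick f (mv # ms)) {..<f mv} ({mv} \<times> {..<f mv})"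
    by (auto simp: bij_betw_def inj_on_def)
  have "bij_betw (pick f (mv # ms)) ({..<f mv} \<union> {f mv..<f mv + ?S})
    ({mv} \<times> {..<f mv} \<union> (SIGMA mv:insert Skip (set ms). {..<f mv}))"
    by (rule bij_betw_combine[OF 2 1]) (use Cons.prems in auto)
  moreover have "{..<f mv} \<union> {f mv..<f mv + ?S} = {..<(\<Sum>mv\<leftarrow>mv # ms. f mv) + f Skip}" by auto
  moreover have "{mv} \<times> {..<f mv} \<union> (SIGMA mv:insert Skip (set ms). {..<f mv}) =
    (SIGMA mv:insert Skip (set (mv # ms)). {..<f mv})" by auto
  ultimately show ?case by (simp only:)
qed

context walk_graph
begin

fun count :: "nat \<Rightarrow> nat \<Rightarrow> nat" where
  "count 0 x = of_bool (x = origin)"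
| "count (Suc m) x = (if inside K x then (\<Sum>mv\<leftarrow>moves. count m (target mv x)) + count m x else 0)"

fun unrank :: "nat \<Rightarrow> nat \<Rightarrow> nat \<Rightarrow> move list" where
  "unrank 0 x u = []"
| "unrank (Suc m) x u = (let (mv, u') = pick (\<lambda>mv. count m (target mv x)) moves u
     in mv # unrank m (target mv x) u')"

lemma distinct_moves: "distinct moves" "Skip \<notin> set moves"
  by (auto simp: moves_def distinct_map inj_on_def)

lemma unrank_bij: "bij_betw (unrank m x) {..<count m x} (walks m x)"
proof (induction m arbitrary: x)
  case 0
  show ?case by (auto simp: bij_betw_def inj_on_def)
next
  case (Suc m)
  show ?case
  proof (cases "inside K x")
    case True
    let ?f = "\<lambda>mv. count m (target mv x)"
    let ?S = "SIGMA mv:insert Skip (set moves). {..<?f mv}"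
    let ?g = "\<lambda>(mv, u). mv # unrank m (target mv x) u"
    have "bij_betw (pick ?f moves) {..<count (Suc m) x} ?S"
      using pick_bij[OF distinct_moves, of ?f] True by simp
    moreover have "bij_betw ?g ?S (walks (Suc m) x)"
    proof (rule bij_betw_imageI)
      show "inj_on ?g ?S"
        using bij_betw_imp_inj_on[OF Suc.IH] by (auto simp: inj_on_def)
      have "?g ` ?S = (\<Union>mv\<in>insert Skip (set moves). (#) mv ` unrank m (target mv x) ` {..<?f mv})"
        by (auto simp: image_iff)
      also have "\<dots> = (\<Union>mv\<in>insert Skip (set moves). (#) mv ` walks m (target mv x))"
        using bij_betw_imp_surj_on[OF Suc.IH] by simp
      also have "\<dots> = walks (Suc m) x" using True by (auto simp: image_iff)
      finally show "?g ` ?S = walks (Suc m) x" .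
    qed
    ultimately have "bij_betw (?g \<circ> pick ?f moves) {..<count (Suc m) x} (walks (Suc m) x)"
      by (rule bij_betw_trans)
    then show ?thesis by (simp add: comp_def Let_def)
  qed (auto simp: bij_betw_def)
qed

lemma count_le: "count m x \<le> (2 * K + 1) ^ m"
proof (induction m arbitrary: x)
  case (Suc m)
  have "(\<Sum>mv\<leftarrow>moves. count m (target mv x)) \<le> (\<Sum>mv\<leftarrow>moves. (2 * K + 1) ^ m)"
    using Suc by (intro sum_list_mono) auto
  also have "\<dots> = 2 * K * (2 * K + 1) ^ m" by (simp add: moves_def sum_list_replicate map_replicate_const comp_def flip: mult_2)
  finally show ?case using Suc[of x] by (auto intro: add_mono)
qed simp

lemma unrank_matching_bij:
  "bij_betw (\<lambda>u. decode 0 (replicate K {}) (unrank n origin u)) {..<count n origin} (nc_matchings (Suc K) n)"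
  using bij_betw_trans[OF unrank_bij decode_bij] by (simp add: comp_def)

lemma card_nc_matchings: "fstar (Suc K) n = count n origin"
  using bij_betw_same_card[OF unrank_matching_bij] by (simp add: fstar_def)

lemma count_pos: "count n origin > 0"
proof -
  have "{} \<in> nc_matchings (Suc K) n"
    by (auto simp: nc_matchings_def partial_matching_def noncrossing_def is_crossing_def)
  then show ?thesis using bij_betw_imp_surj_on[OF unrank_matching_bij] by (cases "count n origin") auto
qed

end

lemma partner_arc:
  assumes "partial_matching n \<mu>" "(i, j) \<in> \<mu>"
  shows "partner \<mu> i = j" "partner \<mu> j = i"
proof -
  have all: "\<forall>e\<in>\<mu>. \<forall>e'\<in>\<mu>. {fst e, snd e} \<inter> {fst e', snd e'} \<noteq> {} \<longrightarrow> e = e'"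
    using assms(1) unfolding partial_matching_alt by blast
  have uniq: "e = (i, j)" if "e \<in> \<mu>" "{fst e, snd e} \<inter> {i, j} \<noteq> {}" for e
    using bspec[OF bspec[OF all that(1)] assms(2)] that(2) unfolding fst_conv snd_conv by blast
  have "i \<noteq> j" using assms by (auto simp: partial_matching_def)
  have "u = j" if "(u, i) \<in> \<mu> \<or> (i, u) \<in> \<mu>" for u
    using uniq[of "(u, i)"] uniq[of "(i, u)"] \<open>i \<noteq> j\<close> that by auto
  then have "(THE u. (u, i) \<in> \<mu> \<or> (i, u) \<in> \<mu>) = j" using assms(2) by blast
  then show "partner \<mu> i = j" using assms(2) by (auto simp: partner_def)
  have "u = i" if "(u, j) \<in> \<mu> \<or> (j, u) \<in> \<mu>" for u
    using uniq[of "(u, j)"] uniq[of "(j, u)"] \<open>i \<noteq> j\<close> that by auto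
  then have "(THE u. (u, j) \<in> \<mu> \<or> (j, u) \<in> \<mu>) = i" using assms(2) by blast
  then show "partner \<mu> j = i" using assms(2) by (auto simp: partner_def)
qed

lemma encode_inj: "inj_on (encode n) {\<mu>. partial_matching n \<mu>}"
proof (rule inj_onI)
  have sub: "\<mu> \<subseteq> \<nu>" if "partial_matching n \<mu>" "partial_matching n \<nu>" "encode n \<mu> = encode n \<nu>" for \<mu> \<nu>
  proof
    fix e assume "e \<in> \<mu>"
    then obtain i j where e: "e = (i, j)" "(i, j) \<in> \<mu>" by (cases e) auto
    have ij: "1 \<le> i" "i < j" "j \<le> n" using that e by (auto simp: partial_matching_def)
    have "partner \<nu> i = partner \<mu> i"
      using arg_cong[OF that(3), of "\<lambda>l. l ! (i - 1)"] ij by (simp add: encode_def del: upt_Suc)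
    then have p: "partner \<nu> i = j" using partner_arc[OF that(1) e(2)] by simp
    then obtain u where "(u, i) \<in> \<nu> \<or> (i, u) \<in> \<nu>" using ij by (auto simp: partner_def split: if_splits)
    then show "e \<in> \<nu>"
    proof
      assume "(u, i) \<in> \<nu>"
      then have "u = j" "u < i" using partner_arc[OF that(2)] p that(2) by (auto simp: partial_matching_def)
      then show ?thesis using ij by simp
    next
      assume "(i, u) \<in> \<nu>"
      then show ?thesis using partner_arc[OF that(2)] p e by auto
    qed
  qed
  fix \<mu> \<nu> assume "\<mu> \<in> {\<mu>. partial_matching n \<mu>}" "\<nu> \<in> {\<mu>. partial_matching n \<mu>}" "encode n \<mu> = encode n \<nu>"
  then show "\<mu> = \<nu>" using sub[of \<mu> \<nu>] sub[of \<nu> \<mu>] by auto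
qed

section \<open>Executing programs\<close>

text \<open>
  The set of used registers is left unspecified: a step accesses at most three registers, so the time
  bound already bounds the space.
\<close>

definition runs :: "nat \<Rightarrow> com \<Rightarrow> mem \<Rightarrow> nat \<Rightarrow> mem \<Rightarrow> nat list \<Rightarrow> bool" where
  "runs w c M t M' ys \<longleftrightarrow> (\<forall>cs U xs d. \<exists>U'.
     steps w (t + d) \<lparr>code = c # cs, mem = M, used = U, out = xs\<rparr> =
     steps w d \<lparr>code = cs, mem = M', used = U', out = xs @ ys\<rparr>)"

fun plain :: "com \<Rightarrow> bool" where
  "plain (Rand d a) \<longleftrightarrow> False"
| "plain (Write a) \<longleftrightarrow> False"
| "plain (While a c) \<longleftrightarrow> False"
| "plain (Seq c1 c2) \<longleftrightarrow> plain c1 \<and> plain c2"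
| "plain (Cond a c1 c2) \<longleftrightarrow> plain c1 \<and> plain c2"
| "plain _ \<longleftrightarrow> True"

fun sem :: "nat \<Rightarrow> com \<Rightarrow> mem \<Rightarrow> mem" where
  "sem w (Const d v) M = M(d := v mod 2 ^ w)"
| "sem w (Op f d a b) M = M(d := eval_op f (M a) (M b) mod 2 ^ w)"
| "sem w (Load d a) M = M(d := M (M a))"
| "sem w (Store a b) M = M(M a := M b)"
| "sem w (Seq c1 c2) M = sem w c2 (sem w c1 M)"
| "sem w (Cond a c1 c2) M = (if M a \<noteq> 0 then sem w c1 M else sem w c2 M)"
| "sem w _ M = M"

fun cost :: "com \<Rightarrow> nat" where
  "cost (Seq c1 c2) = 1 + cost c1 + cost c2"
| "cost (Cond a c1 c2) = 1 + max (cost c1) (cost c2)"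
| "cost _ = 1"

lemma step_exec [simp]:
  "step w \<lparr>code = c # cs, mem = M, used = U, out = xs\<rparr> = exec w c cs M (U \<union> accesses M c) xs"
  by (simp add: step_def)

lemma runs_atom:
  assumes "\<And>cs U xs. exec w c cs M U xs = return_pmf \<lparr>code = cs, mem = M', used = U, out = xs @ ys\<rparr>"
  shows "runs w c M 1 M' ys"
  unfolding runs_def using assms by (auto simp: bind_return_pmf)

lemma runs_Seq:
  assumes "runs w c1 M t1 M1 ys1" "runs w c2 M1 t2 M2 ys2"
  shows "runs w (Seq c1 c2) M (1 + t1 + t2) M2 (ys1 @ ys2)"
  unfolding runs_def
proof (intro allI)
  fix cs U xs d
  obtain U1 where 1: "steps w (t1 + (t2 + d)) \<lparr>code = c1 # c2 # cs, mem = M, used = U, out = xs\<rparr> =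
    steps w (t2 + d) \<lparr>code = c2 # cs, mem = M1, used = U1, out = xs @ ys1\<rparr>"
    using assms(1) unfolding runs_def by blast
  obtain U2 where 2: "steps w (t2 + d) \<lparr>code = c2 # cs, mem = M1, used = U1, out = xs @ ys1\<rparr> =
    steps w d \<lparr>code = cs, mem = M2, used = U2, out = (xs @ ys1) @ ys2\<rparr>"
    using assms(2) unfolding runs_def by blast
  show "\<exists>U'. steps w (1 + t1 + t2 + d) \<lparr>code = Seq c1 c2 # cs, mem = M, used = U, out = xs\<rparr> =
    steps w d \<lparr>code = cs, mem = M2, used = U', out = xs @ ys1 @ ys2\<rparr>"
    using 1 2 by (auto simp: bind_return_pmf add.assoc intro!: exI[of _ U2])
qed

lemma runs_Cond:
  assumes "runs w (if M a \<noteq> 0 then c1 else c2) M t M' ys"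
  shows "runs w (Cond a c1 c2) M (1 + t) M' ys"
  unfolding runs_def
proof (intro allI)
  fix cs U xs d
  obtain U' where "steps w (t + d) \<lparr>code = (if M a \<noteq> 0 then c1 else c2) # cs, mem = M,
      used = U \<union> accesses M (Cond a c1 c2), out = xs\<rparr> =
    steps w d \<lparr>code = cs, mem = M', used = U', out = xs @ ys\<rparr>"
    using assms unfolding runs_def by blast
  then show "\<exists>U'. steps w (1 + t + d) \<lparr>code = Cond a c1 c2 # cs, mem = M, used = U, out = xs\<rparr> =
    steps w d \<lparr>code = cs, mem = M', used = U', out = xs @ ys\<rparr>"
    by (auto simp: bind_return_pmf)
qed

lemma runs_While_stop:
  assumes "M a = 0"
  shows "runs w (While a c) M 1 M []"
  using assms by (intro runs_atom) auto

lemma runs_While_go: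
  assumes "M a \<noteq> 0" "runs w c M t1 M1 ys1" "runs w (While a c) M1 t2 M2 ys2"
  shows "runs w (While a c) M (1 + t1 + t2) M2 (ys1 @ ys2)"
  unfolding runs_def
proof (intro allI)
  fix cs U xs d
  obtain U1 where 1: "steps w (t1 + (t2 + d)) \<lparr>code = c # While a c # cs, mem = M,
      used = U \<union> accesses M (While a c), out = xs\<rparr> =
    steps w (t2 + d) \<lparr>code = While a c # cs, mem = M1, used = U1, out = xs @ ys1\<rparr>"
    using assms(2) unfolding runs_def by blast
  obtain U2 where 2: "steps w (t2 + d) \<lparr>code = While a c # cs, mem = M1, used = U1, out = xs @ ys1\<rparr> =
    steps w d \<lparr>code = cs, mem = M2, used = U2, out = (xs @ ys1) @ ys2\<rparr>"
    using assms(3) unfolding runs_def by blast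
  show "\<exists>U'. steps w (1 + t1 + t2 + d) \<lparr>code = While a c # cs, mem = M, used = U, out = xs\<rparr> =
    steps w d \<lparr>code = cs, mem = M2, used = U', out = xs @ ys1 @ ys2\<rparr>"
    using 1 2 assms(1) by (auto simp: bind_return_pmf add.assoc intro!: exI[of _ U2])
qed

lemma runs_sem:
  assumes "plain c"
  shows "\<exists>t\<le>cost c. runs w c M t (sem w c M) []"
  using assms
proof (induction c arbitrary: M)
  case (Seq c1 c2)
  then obtain t1 t2 where "t1 \<le> cost c1" "runs w c1 M t1 (sem w c1 M) []"
    "t2 \<le> cost c2" "runs w c2 (sem w c1 M) t2 (sem w c2 (sem w c1 M)) []" by fastforce
  then show ?case using runs_Seq[of w c1 M t1 "sem w c1 M" "[]" c2 t2] by (intro exI[of _ "1 + t1 + t2"]) auto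
next
  case (Cond a c1 c2)
  obtain t1 t2 where "t1 \<le> cost c1" "runs w c1 M t1 (sem w c1 M) []"
    "t2 \<le> cost c2" "runs w c2 M t2 (sem w c2 M) []" using Cond.IH(1)[of M] Cond.IH(2)[of M] Cond.prems by auto
  then obtain t where "t \<le> max (cost c1) (cost c2)"
    "runs w (if M a \<noteq> 0 then c1 else c2) M t (sem w (Cond a c1 c2) M) []"
    by (cases "M a \<noteq> 0") (auto simp: le_max_iff_disj)
  then show ?case using runs_Cond by (intro exI[of _ "1 + t"]) auto
qed (auto intro!: exI[of _ 1] runs_atom)

lemma runs_While_invariant:
  assumes "plain c" and go: "\<And>i M. I (Suc i) M \<Longrightarrow> M a \<noteq> 0 \<and> I i (sem w c M)"
    and stop: "\<And>M. I 0 M \<Longrightarrow> M a = 0" and "I i M"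
  shows "\<exists>t M'. t \<le> i * (cost c + 1) + 1 \<and> runs w (While a c) M t M' [] \<and> I 0 M'"
  using assms(4)
proof (induction i arbitrary: M)
  case 0
  then show ?case using stop runs_While_stop by (intro exI[of _ 1] exI[of _ M]) auto
next
  case (Suc i)
  obtain t1 where t1: "t1 \<le> cost c" "runs w c M t1 (sem w c M) []" using runs_sem[OF assms(1)] by blast
  obtain t2 M' where t2: "t2 \<le> i * (cost c + 1) + 1" "runs w (While a c) (sem w c M) t2 M' []" "I 0 M'"
    using Suc go by blast
  have "runs w (While a c) M (1 + t1 + t2) M' ([] @ [])"
    by (rule runs_While_go[OF _ t1(2) t2(2)]) (use go Suc in auto)
  then show ?case using t1 t2 by (intro exI[of _ "1 + t1 + t2"] exI[of _ M']) auto
qed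

lemma steps_halted: "code s = [] \<Longrightarrow> steps w t s = return_pmf s"
  by (induction t) (auto simp: step_def bind_return_pmf)

lemma steps_add: "steps w (t1 + t2) s = bind_pmf (steps w t1 s) (steps w t2)"
proof (induction t1 arbitrary: s)
  case (Suc t1)
  have "steps w (Suc t1 + t2) s = bind_pmf (step w s) (steps w (t1 + t2))" by simp
  also have "\<dots> = bind_pmf (step w s) (\<lambda>s. bind_pmf (steps w t1 s) (steps w t2))"
    using Suc by (intro bind_pmf_cong) auto
  finally show ?case by (simp add: bind_assoc_pmf)
qed (simp add: bind_return_pmf)

lemma runs_halts:
  assumes "runs w c M t M' ys" "t \<le> T"
  shows "\<exists>U'. steps w T \<lparr>code = [c], mem = M, used = U, out = xs\<rparr> =
    return_pmf \<lparr>code = [], mem = M', used = U', out = xs @ ys\<rparr>"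
proof -
  obtain U' where "steps w (t + (T - t)) \<lparr>code = [c], mem = M, used = U, out = xs\<rparr> =
    steps w (T - t) \<lparr>code = [], mem = M', used = U', out = xs @ ys\<rparr>"
    using assms(1) unfolding runs_def by blast
  then show ?thesis using assms(2) by (auto simp: steps_halted)
qed

lemma card_accesses: "finite (accesses M c) \<and> card (accesses M c) \<le> 3"
  by (cases c) (auto simp: card_insert_if)

lemma step_used:
  assumes "s' \<in> set_pmf (step w s)" "finite (used s)"
  shows "finite (used s') \<and> card (used s') \<le> card (used s) + 3"
proof (cases "code s")
  case Nil
  then show ?thesis using assms by (simp add: step_def)
next
  case (Cons c cs)
  then have "s' \<in> set_pmf (exec w c cs (mem s) (used s \<union> accesses (mem s) c) (out s))"
    using assms by (simp add: step_def)
  then have "used s' = used s \<union> accesses (mem s) c" by (cases c) auto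
  then show ?thesis using card_accesses[of "mem s" c] assms(2)
    by (metis add_le_mono card_Un_le finite_UnI le_refl le_trans)
qed

lemma steps_used:
  assumes "s' \<in> set_pmf (steps w t s)" "finite (used s)"
  shows "card (used s') \<le> card (used s) + 3 * t"
  using assms
proof (induction t arbitrary: s)
  case (Suc t)
  then obtain s1 where s1: "s1 \<in> set_pmf (step w s)" "s' \<in> set_pmf (steps w t s1)" by auto
  show ?case using step_used[OF s1(1) Suc.prems(2)] Suc.IH[OF s1(2)] by simp
qed simp

lemma runs_withinI:
  assumes "\<And>s. s \<in> set_pmf (run w c M t) \<Longrightarrow> code s = []"
  shows "runs_within w c M t (3 * t)"
  unfolding runs_within_def using assms steps_used[of _ w t] by (fastforce simp: run_def)

lemma final_mems_subset:
  assumes "\<And>s. s \<in> set_pmf (run w c M T) \<Longrightarrow> code s = [] \<and> mem s \<in> A"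
  shows "final_mems w c M \<subseteq> A"
proof
  fix M' assume "M' \<in> final_mems w c M"
  then obtain s t where s: "M' = mem s" "s \<in> set_pmf (run w c M t)" "code s = []"
    by (auto simp: final_mems_def)
  let ?s0 = "\<lparr>code = [c], mem = M, used = {}, out = []\<rparr>"
  have "s \<in> set_pmf (run w c M T)"
  proof (cases "t \<le> T")
    case True
    then have "run w c M T = bind_pmf (run w c M t) (steps w (T - t))"
      using steps_add[of w t "T - t" ?s0] by (simp add: run_def)
    then show ?thesis using s(2) steps_halted[OF s(3), of w "T - t"] by force
  next
    case False
    then have "run w c M t = bind_pmf (run w c M T) (steps w (t - T))"
      using steps_add[of w T "t - T" ?s0] by (simp add: run_def)
    also have "\<dots> = bind_pmf (run w c M T) return_pmf"
      using assms by (intro bind_pmf_cong) (auto simp: steps_halted)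
    finally show ?thesis using s(2) by (simp add: bind_return_pmf')
  qed
  then show "M' \<in> A" using assms s by blast
qed

lemma run_sampling:
  assumes pre: "runs w c1 M t1 M1 []" and m: "M1 a = m" "m > 0"
    and post: "\<And>u. u < m \<Longrightarrow> \<exists>t\<le>t2. \<exists>M'. runs w c2 (M1(d := u)) t M' (f u) \<and> M' \<in> A"
    and T: "3 + t1 + t2 \<le> T"
  shows "map_pmf out (run w (Seq c1 (Seq (Rand d a) c2)) M T) = map_pmf f (pmf_of_set {..<m})"
    and "s \<in> set_pmf (run w (Seq c1 (Seq (Rand d a) c2)) M T) \<Longrightarrow> code s = [] \<and> mem s \<in> A"
proof -
  define T' where "T' = T - (3 + t1)"
  have T': "T = Suc (t1 + Suc (Suc T'))" "t2 \<le> T'" using T by (auto simp: T'_def)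
  obtain U1 where U1: "steps w (t1 + Suc (Suc T')) \<lparr>code = [c1, Seq (Rand d a) c2], mem = M, used = {}, out = []\<rparr> =
    steps w (Suc (Suc T')) \<lparr>code = [Seq (Rand d a) c2], mem = M1, used = U1, out = []\<rparr>"
    using pre unfolding runs_def by (metis append_Nil)
  have "\<exists>M' U'. steps w T' \<lparr>code = [c2], mem = M1(d := u), used = U1 \<union> {d, a}, out = []\<rparr> =
      return_pmf \<lparr>code = [], mem = M', used = U', out = f u\<rparr> \<and> M' \<in> A" if "u < m" for u
  proof -
    obtain t M' where t: "t \<le> t2" "runs w c2 (M1(d := u)) t M' (f u)" "M' \<in> A" using post[OF \<open>u < m\<close>] by blast
    show ?thesis using runs_halts[OF t(2) le_trans[OF t(1) T'(2)], of "U1 \<union> {d, a}" "[]"] t(3) by auto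
  qed
  then obtain M' U' where fin: "\<And>u. u < m \<Longrightarrow>
      steps w T' \<lparr>code = [c2], mem = M1(d := u), used = U1 \<union> {d, a}, out = []\<rparr> =
      return_pmf \<lparr>code = [], mem = M' u, used = U' u, out = f u\<rparr> \<and> M' u \<in> A" by metis
  let ?S = "pmf_of_set {..<m}"
  have S: "set_pmf ?S = {..<m}" using m by (intro set_pmf_of_set) auto
  have "run w (Seq c1 (Seq (Rand d a) c2)) M T =
    bind_pmf ?S (\<lambda>u. steps w T' \<lparr>code = [c2], mem = M1(d := u), used = U1 \<union> {d, a}, out = []\<rparr>)"
    using U1 m unfolding run_def T'(1) by (simp add: bind_return_pmf uniform_below_def bind_map_pmf)
  also have "\<dots> = bind_pmf ?S (\<lambda>u. return_pmf \<lparr>code = [], mem = M' u, used = U' u, out = f u\<rparr>)"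
    using fin S by (intro bind_pmf_cong) auto
  finally have run: "run w (Seq c1 (Seq (Rand d a) c2)) M T =
    map_pmf (\<lambda>u. \<lparr>code = [], mem = M' u, used = U' u, out = f u\<rparr>) ?S" by (simp add: map_pmf_def)
  then show "map_pmf out (run w (Seq c1 (Seq (Rand d a) c2)) M T) = map_pmf f ?S"
    by (simp add: map_pmf_comp)
  assume "s \<in> set_pmf (run w (Seq c1 (Seq (Rand d a) c2)) M T)"
  then obtain u where "u < m" "s = \<lparr>code = [], mem = M' u, used = U' u, out = f u\<rparr>"
    using S unfolding run by auto
  then show "code s = [] \<and> mem s \<in> A" using conjunct2[OF fin] by simp
qed

text \<open>
  Vertex \<open>i\<close> is bit \<open>n - i\<close>, because reverse bumping looks for the largest smaller entry and the
  machine can only isolate the lowest set bit, as \<open>h - (h AND (h - 1))\<close>.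
\<close>

definition bits :: "nat \<Rightarrow> nat set \<Rightarrow> nat" where
  "bits n R = (\<Sum>i\<in>R. 2 ^ (n - i))"

lemma bits_less:
  assumes "R \<subseteq> {x<..n}"
  shows "bits n R < 2 ^ (n - x)"
proof -
  have "inj_on (\<lambda>i. n - i) R" using assms by (intro inj_onI) (metis diff_diff_cancel greaterThanAtMost_iff subsetD)
  then have "bits n R = (\<Sum>j\<in>(\<lambda>i. n - i) ` R. 2 ^ j)" by (simp add: bits_def sum.reindex)
  moreover have "(\<lambda>i. n - i) ` R \<subseteq> {..<n - x}" using assms by (force intro: diff_less_mono2)
  then have "(\<Sum>j\<in>(\<lambda>i. n - i) ` R. 2 ^ j) \<le> (\<Sum>j<n - x. 2 ^ j :: nat)" by (intro sum_mono2) auto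
  moreover have "(\<Sum>j<m. 2 ^ j) < (2::nat) ^ m" for m by (induction m) auto
  ultimately show ?thesis by (metis le_less_trans)
qed

lemma bits_dvd:
  assumes "R \<subseteq> {..<x}" "x \<le> n"
  shows "2 ^ Suc (n - x) dvd bits n R"
  unfolding bits_def using assms by (intro dvd_sum le_imp_power_dvd) auto

lemma bits_insert: "finite R \<Longrightarrow> x \<notin> R \<Longrightarrow> bits n (insert x R) = 2 ^ (n - x) + bits n R"
  by (simp add: bits_def)

lemma bits_remove: "finite R \<Longrightarrow> x \<in> R \<Longrightarrow> bits n R = 2 ^ (n - x) + bits n (R - {x})"
  by (simp add: bits_def sum.remove)

lemma and_pred:
  "and (2 ^ p * (2 * q + 1)) (2 ^ p * (2 * q + 1) - 1) = 2 ^ p * (2 * q :: nat)"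
proof (induction p)
  case 0
  show ?case by (simp add: and_nat_rec[of "Suc (2 * q)" "2 * q"])
next
  case (Suc p)
  let ?A = "2 ^ p * (2 * q + 1)"
  have "?A > 0" by simp
  have "and (2 * a) (2 * a - 1) = 2 * and a (a - 1)" if "a > 0" for a :: nat
  proof -
    have "(2 * a - 1) div 2 = a - 1" using that by simp
    then show ?thesis using and_nat_rec[of "2 * a" "2 * a - 1"] by simp
  qed
  from this[OF \<open>?A > 0\<close>] have "and (2 * ?A) (2 * ?A - 1) = 2 * and ?A (?A - 1)" .
  then show ?case using Suc by simp
qed

lemma bits_lowest:
  assumes "finite R" "R \<subseteq> {..n}" "R \<noteq> {}"
  shows "and (bits n R) (bits n R - 1) = bits n (R - {Max R})"
proof -
  let ?x = "Max R"
  have "?x \<in> R" using assms by simp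
  then have "?x \<le> n" using assms(2) by auto
  have "R - {?x} \<subseteq> {..<?x}" using assms(1) by (auto intro: le_neq_implies_less)
  from bits_dvd[OF this \<open>?x \<le> n\<close>] obtain q where q: "bits n (R - {?x}) = 2 ^ Suc (n - ?x) * q" by (elim dvdE)
  have "bits n R = 2 ^ (n - ?x) * (2 * q + 1)"
    using bits_remove[OF assms(1) \<open>?x \<in> R\<close>, of n] q by simp
  then show ?thesis using and_pred[of "n - ?x" q] q by simp
qed

lemma bits_truncate:
  assumes "finite R" "R \<subseteq> {..n}" "x \<notin> R" "x \<le> n"
  shows "bits n R div 2 ^ (n - x) * 2 ^ (n - x) = bits n {z\<in>R. z < x}"
proof -
  have "R = {z\<in>R. z < x} \<union> {z\<in>R. x < z}" using assms(3) by (auto simp: not_less le_less)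
  moreover have "bits n ({z\<in>R. z < x} \<union> {z\<in>R. x < z}) = bits n {z\<in>R. z < x} + bits n {z\<in>R. x < z}"
    unfolding bits_def using assms by (intro sum.union_disjoint) auto
  ultimately have "bits n R = bits n {z\<in>R. z < x} + bits n {z\<in>R. x < z}" by simp
  moreover have "bits n {z\<in>R. x < z} < 2 ^ (n - x)" by (rule bits_less) (use assms in auto)
  moreover have "2 ^ Suc (n - x) dvd bits n {z\<in>R. z < x}" by (rule bits_dvd) (use assms in auto)
  then obtain q where "bits n {z\<in>R. z < x} = q * 2 ^ (n - x)" by (auto elim: dvdE)
  ultimately show ?thesis by simp
qed

section \<open>Tabulating the completions\<close>

text \<open>
  Registers: 0 \<open>n\<close>, 1 \<open>base\<close>, 2 \<open>base ^ K\<close>, 3 and 15 the constants 1 and 2, 4 the address of the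
  partner array, 5 \<open>2 ^ n\<close>, 6 the table address of the current state, 7 the remaining rank, 8 the bit
  of the current vertex 9, 10 a loop counter, 16 \<open>n + 2\<close>, 17 the table address of the initial state,
  23 the current table offset; 11--14, 18--20, 22 and 31 are scratch. Row \<open>r\<close> is in \<open>32 + r\<close>,
  \<open>stride r\<close> in \<open>32 + K + r\<close>, and the table starts at \<open>32 + 2 * K\<close>.
\<close>

definition seqs :: "com list \<Rightarrow> com" where
  "seqs cs = foldr Seq cs (Const 31 0)"

fun locate :: "nat \<Rightarrow> move \<Rightarrow> com" where
  "locate K (Open r) = Op Add 18 6 (32 + K + r)"
| "locate K (Close r) = Op Sub 18 6 (32 + K + r)"
| "locate K Skip = Const 18 0"

fun guard :: "nat \<Rightarrow> com \<Rightarrow> com" where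
  "guard 0 c = c"
| "guard (Suc r) c =
     Seq (Op Div 20 12 1) (Seq (Op Mul 13 20 1) (Seq (Op Sub 11 12 13) (Seq (Op Sub 19 16 11)
       (Seq (Op Div 12 12 1) (Cond 11 (Cond 19 (guard r c) (Const 31 0)) (Const 31 0))))))"

definition add_counts :: "nat \<Rightarrow> move list \<Rightarrow> com list" where
  "add_counts K ms = concat (map (\<lambda>mv. [locate K mv, Load 14 18, Op Add 22 22 14]) ms)"

definition update :: "nat \<Rightarrow> com" where
  "update K = seqs (Load 22 6 # add_counts K (walk_graph.moves K) @ [Op Add 18 6 2, Store 18 22])"

definition fill_step :: "nat \<Rightarrow> com" where
  "fill_step K = seqs [Op Mul 12 23 3, guard K (update K), Op Add 23 23 3, Op Add 6 6 3, Op Sub 10 10 3]"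

definition double :: com where
  "double = seqs [Op Add 5 5 5, Op Sub 10 10 3]"

definition stride_setup :: "nat \<Rightarrow> nat \<Rightarrow> com list" where
  "stride_setup K j = concat (map (\<lambda>r. [Op Add 17 17 2, Op Sub (32 + K + r) 2 12, Op Mul 12 2 3, Op Mul 2 2 1]) [0..<j])"

definition setup1 :: "nat \<Rightarrow> com" where
  "setup1 K = seqs ([Const 3 1, Const 15 2, Const 13 3, Op Add 1 0 13, Op Add 16 0 15, Const 2 1, Const 17 0,
     Const 12 0] @ stride_setup K K @ [Op Mul 10 0 3, Const 5 1])"

definition setup2 :: "nat \<Rightarrow> com" where
  "setup2 K = seqs [Const 6 (32 + 2 * K), Op Add 18 6 17, Store 18 3, Op Mul 10 0 2, Op Add 17 18 10,
     Op Add 4 6 10, Op Add 4 4 2, Op Mul 23 2 3]"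

definition preprocess :: "nat \<Rightarrow> com" where
  "preprocess K = Seq (setup1 K) (Seq (While 10 double) (Seq (setup2 K) (While 10 (fill_step K))))"

lemma stride_setup_Suc: "stride_setup K (Suc j) = stride_setup K j @
  [Op Add 17 17 2, Op Sub (32 + K + j) 2 12, Op Mul 12 2 3, Op Mul 2 2 1]"
  by (simp add: stride_setup_def)

lemma sem_seqs: "sem w (seqs cs) M = (fold (sem w) cs M)(31 := 0)"
  unfolding seqs_def by (induction cs arbitrary: M) auto

lemma plain_seqs: "plain (seqs cs) \<longleftrightarrow> (\<forall>c\<in>set cs. plain c)"
  unfolding seqs_def by (induction cs) auto

lemma plain_locate: "plain (locate K mv)"
  by (cases mv) auto

lemma plain_guard: "plain c \<Longrightarrow> plain (guard r c)"
  by (induction r) auto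

lemma plain_fill_step: "plain (fill_step K)"
  by (auto simp: fill_step_def plain_seqs update_def add_counts_def plain_locate intro!: plain_guard)

lemma plain_double: "plain double" by (simp add: double_def plain_seqs)

lemma plain_setup: "plain (setup1 K)" "plain (setup2 K)"
  by (auto simp: setup1_def setup2_def plain_seqs stride_setup_def)

locale machine = walk_graph +
  fixes w :: nat
  assumes bounds: "32 + 2 * K + (n + 2) * base ^ K + 2 ^ (n + 1) + (2 * K + 1) ^ (n + 1) < 2 ^ w"
begin

definition tab :: nat where "tab = 32 + 2 * K"
definition arr :: nat where "arr = tab + (n + 1) * base ^ K"

lemma pow_pos: "base ^ K > 0" using base_gt by simp

lemma pow_le: "r \<le> K \<Longrightarrow> base ^ r \<le> base ^ K"
  using base_gt by (intro power_increasing) auto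

lemma cell_less: "m \<le> n \<Longrightarrow> x < base ^ K \<Longrightarrow> m * base ^ K + x < (n + 1) * base ^ K"
proof -
  assume "m \<le> n" "x < base ^ K"
  then have "m * base ^ K + x < m * base ^ K + base ^ K" by simp
  also have "\<dots> = (m + 1) * base ^ K" by simp
  also have "\<dots> \<le> (n + 1) * base ^ K" using \<open>m \<le> n\<close> by (intro mult_le_mono1) simp
  finally show ?thesis .
qed

lemma arr_less: "arr + base ^ K + 2 ^ (n + 1) < 2 ^ w"
  using bounds by (simp add: arr_def tab_def algebra_simps)

lemma small:
  "n + 3 < 2 ^ w" "base ^ K < 2 ^ w" "n * base ^ K < 2 ^ w" "2 * 2 ^ n < (2::nat) ^ w" "32 + 2 * K < 2 ^ w"
  "(2 * K + 1) ^ (n + 1) < 2 ^ w"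
proof -
  have "(n + 2) * 1 \<le> (n + 2) * base ^ K" using pow_pos by (intro mult_le_mono) auto
  moreover have "32 + 2 * K + X + Y + Z < 2 ^ w \<Longrightarrow> n + 2 \<le> X \<Longrightarrow> n + 3 < 2 ^ w" for X Y Z by linarith
  ultimately show "n + 3 < 2 ^ w" using bounds by simp
  have "n * base ^ K \<le> (n + 2) * base ^ K" "1 * base ^ K \<le> (n + 2) * base ^ K" by (intro mult_le_mono1; simp)+
  then show "base ^ K < 2 ^ w" "n * base ^ K < 2 ^ w" using bounds by simp_all
  have "A + X + Y + Z < 2 ^ w \<Longrightarrow> A < 2 ^ w \<and> Z < 2 ^ w" for A X Y Z :: nat by linarith
  from this[OF bounds] show "32 + 2 * K < 2 ^ w" "(2 * K + 1) ^ (n + 1) < 2 ^ w" by auto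
  show "2 * 2 ^ n < (2::nat) ^ w" using bounds by simp
qed

lemma cell_small: "m \<le> n \<Longrightarrow> x < base ^ K \<Longrightarrow> tab + (m * base ^ K + x) < 2 ^ w"
  using cell_less[of m x] arr_less by (simp add: arr_def)

lemma origin_less: "origin < base ^ K"
  unfolding origin_def using base_gt by (intro key_less) auto

lemma count_small: "m \<le> n \<Longrightarrow> count (Suc m) x < 2 ^ w"
  using count_le[of "Suc m" x] power_increasing[of "Suc m" "n + 1" "2 * K + 1"] small(6) by simp

lemma locate_sem:
  assumes "mv \<in> set moves" "M 6 = tab + (m * base ^ K + x)" "inside K x" "x < base ^ K" "m \<le> n"
    "\<And>r. r < K \<Longrightarrow> M (32 + K + r) = stride r"
  shows "sem w (locate K mv) M = M(18 := tab + (m * base ^ K + target mv x))"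
proof -
  have "target mv x < base ^ K" using target_less[OF assms(3,4)] assms(1) by simp
  note sm = cell_small[OF assms(5) this]
  show ?thesis
  proof (cases mv)
    case (Open r)
    then have "r < K" using assms(1) by (auto simp: moves_def)
    then show ?thesis using Open sm assms(2) assms(6)[of r] by (simp add: add.assoc)
  next
    case (Close r)
    then have "r < K" using assms(1) by (auto simp: moves_def)
    then show ?thesis using Close sm assms(2) assms(6)[of r] target_bounds(1)[OF assms(3,4) \<open>r < K\<close>] by simp
  next
    case Skip
    then show ?thesis using assms(1) distinct_moves by simp
  qed
qed

lemma add_counts_sem:
  assumes "set ms \<subseteq> set moves" "M 6 = tab + (m * base ^ K + x)" "inside K x" "x < base ^ K" "m \<le> n"
    "\<And>r. r < K \<Longrightarrow> M (32 + K + r) = stride r"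
    "\<And>y. y < base ^ K \<Longrightarrow> M (tab + (m * base ^ K + y)) = count m y"
    "M 22 + (\<Sum>mv\<leftarrow>ms. count m (target mv x)) < 2 ^ w"
  shows "fold (sem w) (add_counts K ms) M 22 = M 22 + (\<Sum>mv\<leftarrow>ms. count m (target mv x)) \<and>
    (\<forall>z. z \<notin> {14, 18, 22} \<longrightarrow> fold (sem w) (add_counts K ms) M z = M z)"
  using assms(1,2,6-8)
proof (induction ms arbitrary: M)
  case Nil
  then show ?case by (simp add: add_counts_def)
next
  case (Cons mv ms)
  have mv: "mv \<in> set moves" using Cons.prems by simp
  let ?M = "(M(18 := tab + (m * base ^ K + target mv x)))(14 := count m (target mv x),
    22 := M 22 + count m (target mv x))"
  have ne: "tab + y \<noteq> z" if "z \<le> 31" for y z using that by (simp add: tab_def)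
  have "target mv x < base ^ K" using target_less[OF assms(3,4)] mv by simp
  then have "fold (sem w) (add_counts K (mv # ms)) M = fold (sem w) (add_counts K ms) ?M"
    using locate_sem[OF mv Cons.prems(2) assms(3-5) Cons.prems(3)] Cons.prems(4,5) ne[of 18] ne[of 14]
    by (simp add: add_counts_def)
  moreover have "fold (sem w) (add_counts K ms) ?M 22 = ?M 22 + (\<Sum>mv\<leftarrow>ms. count m (target mv x)) \<and>
    (\<forall>z. z \<notin> {14, 18, 22} \<longrightarrow> fold (sem w) (add_counts K ms) ?M z = ?M z)"
    by (rule Cons.IH) (use Cons.prems ne in auto)
  ultimately show ?case by simp
qed

lemma update_sem:
  assumes "M 6 = tab + (m * base ^ K + x)" "inside K x" "x < base ^ K" "m < n" "M 2 = base ^ K"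
    "\<And>r. r < K \<Longrightarrow> M (32 + K + r) = stride r"
    "\<And>y. y < base ^ K \<Longrightarrow> M (tab + (m * base ^ K + y)) = count m y"
  shows "z \<notin> {14, 18, 22, 31} \<Longrightarrow> sem w (update K) M z =
    (if z = tab + (Suc m * base ^ K + x) then count (Suc m) x else M z)"
proof -
  assume z: "z \<notin> {14, 18, 22, 31}"
  let ?M = "M(22 := count m x)"
  have sum: "count m x + (\<Sum>mv\<leftarrow>moves. count m (target mv x)) = count (Suc m) x" using assms(2) by simp
  have ne: "tab + y \<noteq> z" if "z \<le> 31" for y z using that by (simp add: tab_def)
  have *: "fold (sem w) (add_counts K moves) ?M 22 = ?M 22 + (\<Sum>mv\<leftarrow>moves. count m (target mv x)) \<and>
    (\<forall>z. z \<notin> {14, 18, 22} \<longrightarrow> fold (sem w) (add_counts K moves) ?M z = ?M z)"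
    by (rule add_counts_sem) (use assms ne sum count_small[of m x] in auto)
  have "tab + (m * base ^ K + x) + base ^ K = tab + (Suc m * base ^ K + x)" by simp
  moreover have "tab + (Suc m * base ^ K + x) < 2 ^ w" using assms(3,4) by (intro cell_small) auto
  ultimately show ?thesis
    using * z assms(1,3,5) assms(7)[OF assms(3)] sum ne
    by (auto simp: update_def sem_seqs)
qed

lemma guard_sem:
  assumes "M 1 = base" "M 16 = n + 2" "M 12 < 2 ^ w"
  shows "\<exists>M'. (\<forall>z. z \<notin> {11, 12, 13, 19, 20, 31} \<longrightarrow> M' z = M z) \<and>
    sem w (guard r c) M = (if inside r (M 12) then sem w c M' else M')"
  using assms
proof (induction r arbitrary: M)
  case 0
  then show ?case by auto
next
  case (Suc r)
  let ?q = "M 12 div base"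
  let ?M = "((((M(20 := ?q))(13 := ?q * base))(11 := M 12 mod base))(19 := n + 2 - M 12 mod base))(12 := ?q)"
  have q: "?q < 2 ^ w" "?q * base < 2 ^ w" "M 12 mod base < 2 ^ w" "n + 2 - M 12 mod base < 2 ^ w"
    using Suc.prems(3) small(1) le_less_trans[OF div_le_dividend] le_less_trans[OF div_times_less_eq_dividend]
      le_less_trans[OF mod_less_eq_dividend] by auto
  have m: "M 12 - ?q * base = M 12 mod base" by (simp add: minus_div_mult_eq_mod)
  have "sem w (guard (Suc r) c) M =
    (if M 12 mod base \<noteq> 0 \<and> M 12 mod base < n + 2 then sem w (guard r c) ?M else ?M(31 := 0))"
    using Suc.prems q m by auto
  moreover obtain M' where "\<forall>z. z \<notin> {11, 12, 13, 19, 20, 31} \<longrightarrow> M' z = ?M z"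
    "sem w (guard r c) ?M = (if inside r ?q then sem w c M' else M')"
  proof -
    have "?M 1 = base" "?M 16 = n + 2" "?M 12 < 2 ^ w" using Suc.prems q by simp_all
    from Suc.IH[OF this] show ?thesis using that by (metis fun_upd_same)
  qed
  ultimately show ?case
    by (intro exI[of _ "if M 12 mod base \<noteq> 0 \<and> M 12 mod base < n + 2 then M' else ?M(31 := 0)"]) auto
qed

lemma inside_mod: "inside j (x mod base ^ j) \<longleftrightarrow> inside j x"
proof (induction j arbitrary: x)
  case (Suc j)
  have "x mod base ^ Suc j mod base = x mod base" by (simp add: mod_mult2_eq)
  moreover have "x mod base ^ Suc j div base = x div base mod base ^ j"
    using base_gt by (simp add: mod_mult2_eq)
  ultimately show ?case using Suc by simp
qed simp

definition table_upto :: "nat \<Rightarrow> mem \<Rightarrow> bool" where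
  "table_upto a M \<longleftrightarrow> (\<forall>x. M (tab + x) = (if x < a then count (x div base ^ K) (x mod base ^ K) else 0))"

definition fill_inv :: "nat \<Rightarrow> mem \<Rightarrow> bool" where
  "fill_inv i M \<longleftrightarrow> i \<le> n * base ^ K \<and> M 10 = i \<and> M 23 = (n + 1) * base ^ K - i \<and>
     M 6 = tab + n * base ^ K - i \<and> table_upto ((n + 1) * base ^ K - i) M \<and>
     M 0 = n \<and> M 1 = base \<and> M 2 = base ^ K \<and> M 3 = 1 \<and> M 4 = arr \<and> M 5 = 2 ^ n \<and> M 15 = 2 \<and>
     M 16 = n + 2 \<and> M 17 = tab + (n * base ^ K + origin) \<and> (\<forall>r<K. M (32 + K + r) = stride r)"

lemma fill_step_inv:
  assumes "fill_inv (Suc i) M"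
  shows "M 10 \<noteq> 0 \<and> fill_inv i (sem w (fill_step K) M)"
proof -
  define a where "a = (n + 1) * base ^ K - Suc i"
  define m x where "m = a div base ^ K - 1" and "x = a mod base ^ K"
  have i: "Suc i \<le> n * base ^ K" using assms by (simp add: fill_inv_def)
  have a: "base ^ K \<le> a" "a < (n + 1) * base ^ K" using i by (auto simp: a_def)
  have "a div base ^ K \<ge> 1" using a(1) pow_pos by (simp add: div_greater_zero_iff Suc_leI)
  moreover have "a div base ^ K < n + 1" using a(2) pow_pos by (simp add: less_mult_imp_div_less)
  ultimately have m: "m < n" "a div base ^ K = Suc m" by (auto simp: m_def)
  have ax: "a = Suc m * base ^ K + x" using m(2) div_mult_mod_eq[of a "base ^ K"] by (simp add: x_def)
  have x: "x < base ^ K" unfolding x_def using pow_pos by simp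
  have M: "M 10 = Suc i" "M 23 = a" "M 6 = tab + (m * base ^ K + x)" "table_upto a M" "M 0 = n" "M 1 = base"
    "M 2 = base ^ K" "M 3 = 1" "M 4 = arr" "M 5 = 2 ^ n" "M 15 = 2" "M 16 = n + 2"
    "M 17 = tab + (n * base ^ K + origin)" "\<And>r. r < K \<Longrightarrow> M (32 + K + r) = stride r"
    using assms ax i unfolding fill_inv_def a_def[symmetric] by (auto simp: a_def)
  have asmall: "a < 2 ^ w" "Suc a < 2 ^ w" using a(2) arr_less pow_pos by (auto simp: arr_def)
  let ?M = "M(12 := a)"
  obtain M' where M': "\<And>z. z \<notin> {11, 12, 13, 19, 20, 31} \<Longrightarrow> M' z = M z"
    "sem w (guard K (update K)) ?M = (if inside K a then sem w (update K) M' else M')"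
    using guard_sem[of ?M K "update K"] M asmall by auto
  have ne: "tab + y \<noteq> z" if "z \<le> 31" for y z using that by (simp add: tab_def)
  have ne': "32 + K + r \<noteq> tab + y" if "r < K" for r y using that by (simp add: tab_def)
  define M2 where "M2 = sem w (guard K (update K)) ?M"
  have ins: "inside K a \<longleftrightarrow> inside K x" unfolding x_def by (rule inside_mod[symmetric])
  have upd: "sem w (update K) M' z = (if z = tab + a then count (Suc m) x else M' z)"
    if "z \<notin> {14, 18, 22, 31}" "inside K x" for z
    unfolding ax
  proof (rule update_sem[OF _ that(2) x m(1) _ _ _ that(1)])
    fix y assume "y < base ^ K"
    then have "m * base ^ K + y < Suc m * base ^ K" by simp
    also have "\<dots> \<le> a" using ax by simp
    finally have "m * base ^ K + y < a" .
    moreover have "(m * base ^ K + y) div base ^ K = m" "(m * base ^ K + y) mod base ^ K = y"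
      using \<open>y < base ^ K\<close> pow_pos by simp_all
    ultimately show "M' (tab + (m * base ^ K + y)) = count m y"
      using M(4) M'(1)[of "tab + (m * base ^ K + y)"] ne \<open>y < base ^ K\<close> by (simp add: table_upto_def)
  qed (use M M' in auto)
  have M2: "M2 z = (if z = tab + a then count (Suc m) x else M z)"
    if "z \<notin> {11, 12, 13, 14, 18, 19, 20, 22, 31}" for z
  proof (cases "inside K x")
    case True
    then show ?thesis unfolding M2_def M'(2) ins using upd[of z] M'(1)[of z] that by simp
  next
    case False
    then have "count (Suc m) x = 0" "M (tab + a) = 0" using M(4) by (auto simp: table_upto_def)
    then show ?thesis unfolding M2_def M'(2) ins using False M'(1)[of z] that by simp
  qed
  have r: "M2 10 = Suc i" "M2 23 = a" "M2 6 = tab + (m * base ^ K + x)" "M2 3 = 1"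
    using M2 M ne by auto
  have s6: "tab + (m * base ^ K + x) + 1 < 2 ^ w"
    using cell_less[OF less_imp_le[OF m(1)] x] arr_less pow_pos by (simp add: arr_def)
  have "Suc i < 2 ^ w" using i small(3) by linarith
  then have fs: "sem w (fill_step K) M = M2(23 := Suc a, 6 := tab + (m * base ^ K + x) + 1, 10 := i, 31 := 0)"
    using r asmall s6 M unfolding fill_step_def sem_seqs M2_def by simp
  have "table_upto (Suc a) (sem w (fill_step K) M)"
    unfolding table_upto_def
  proof
    fix y
    have "sem w (fill_step K) M (tab + y) = M2 (tab + y)" unfolding fs using ne by simp
    also have "\<dots> = (if y = a then count (Suc m) x else M (tab + y))" using M2[of "tab + y"] ne by simp
    also have "\<dots> = (if y < Suc a then count (y div base ^ K) (y mod base ^ K) else 0)"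
      using M(4) m(2) x_def by (auto simp: table_upto_def)
    finally show "sem w (fill_step K) M (tab + y) = (if y < Suc a then count (y div base ^ K) (y mod base ^ K) else 0)" .
  qed
  moreover have "(n + 1) * base ^ K - i = Suc a" "tab + n * base ^ K - i = tab + (m * base ^ K + x) + 1"
    using i ax by (auto simp: a_def)
  moreover have M2c: "M2 z = M z" if "z \<notin> {11, 12, 13, 14, 18, 19, 20, 22, 31}" "z < tab" for z
    using M2[OF that(1)] that(2) by simp
  have "31 < tab" "\<And>r. r < K \<Longrightarrow> 32 + K + r < tab" by (auto simp: tab_def)
  ultimately show ?thesis using M M2c i unfolding fill_inv_def by (simp add: fs)
qed

definition prepared :: "mem \<Rightarrow> bool" where
  "prepared M \<longleftrightarrow> M 0 = n \<and> M 2 = base ^ K \<and> M 3 = 1 \<and> M 4 = arr \<and> M 5 = 2 ^ n \<and> M 15 = 2 \<and>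
     M 17 = tab + (n * base ^ K + origin) \<and> (\<forall>r<K. M (32 + K + r) = stride r) \<and>
     (\<forall>m\<le>n. \<forall>x<base ^ K. M (tab + (m * base ^ K + x)) = count m x)"

lemma fill_inv_prepared:
  assumes "fill_inv 0 M"
  shows "prepared M"
proof -
  have "M (tab + (m * base ^ K + x)) = count m x" if "m \<le> n" "x < base ^ K" for m x
  proof -
    have "(m * base ^ K + x) div base ^ K = m" "(m * base ^ K + x) mod base ^ K = x"
      using that pow_pos by simp_all
    then show ?thesis using assms cell_less[OF that] by (simp add: fill_inv_def table_upto_def)
  qed
  then show ?thesis using assms by (simp add: fill_inv_def prepared_def)
qed

definition setup_inv :: "nat \<Rightarrow> mem \<Rightarrow> bool" where
  "setup_inv j M \<longleftrightarrow> M 0 = n \<and> M 1 = base \<and> M 2 = base ^ j \<and> M 3 = 1 \<and> M 15 = 2 \<and> M 16 = n + 2 \<and>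
     M 17 = (\<Sum>r<j. base ^ r) \<and> M 12 = (if j = 0 then 0 else base ^ (j - 1)) \<and>
     (\<forall>r<j. M (32 + K + r) = stride r) \<and> (\<forall>x. M (tab + x) = 0)"

lemma stride_setup_inv:
  assumes "setup_inv 0 M" "j \<le> K"
  shows "setup_inv j (fold (sem w) (stride_setup K j) M)"
  using assms(2)
proof (induction j)
  case 0
  then show ?case using assms by (simp add: stride_setup_def)
next
  case (Suc j)
  define M1 where "M1 = fold (sem w) (stride_setup K j) M"
  have inv: "setup_inv j M1" using Suc by (simp add: M1_def)
  have "(\<Sum>r<Suc j. 1 * base ^ r) < base ^ Suc j" using base_gt by (intro sum_less_power) auto
  moreover have "base ^ Suc j < 2 ^ w" using pow_le[OF Suc.prems] small(2) by linarith
  ultimately have s1: "(\<Sum>r<j. base ^ r) + base ^ j < 2 ^ w" "base ^ j * base < 2 ^ w"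
    by (simp_all add: mult.commute)
  have s2: "stride j < 2 ^ w" "base ^ j < 2 ^ w" using s1 stride_le[of j] by linarith+
  have "M1 2 - M1 12 = stride j" using inv by (simp add: setup_inv_def stride_def)
  then have "fold (sem w) (stride_setup K (Suc j)) M =
    M1(17 := (\<Sum>r<j. base ^ r) + base ^ j, 32 + K + j := stride j, 12 := base ^ j, 2 := base ^ j * base)"
    using inv s1 s2 unfolding stride_setup_Suc fold_append comp_def M1_def[symmetric]
    by (simp add: setup_inv_def)
  then show ?case using inv Suc.prems by (auto simp: setup_inv_def less_Suc_eq tab_def mult.commute)
qed

lemma setup1_sem:
  defines "M \<equiv> sem w (setup1 K) (input n)"
  shows "M 0 = n" "M 1 = base" "M 2 = base ^ K" "M 3 = 1" "M 15 = 2" "M 16 = n + 2" "M 17 = origin"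
    "M 10 = n" "M 5 = 1" "\<forall>r<K. M (32 + K + r) = stride r" "\<forall>x. M (tab + x) = 0"
proof -
  let ?l = "[Const 3 1, Const 15 2, Const 13 3, Op Add 1 0 13, Op Add 16 0 15, Const 2 1, Const 17 0, Const 12 0]"
  define M1 where "M1 = fold (sem w) ?l (input n)"
  define M2 where "M2 = fold (sem w) (stride_setup K K) M1"
  have sm: "Suc 0 < 2 ^ w" "2 < (2::nat) ^ w" "3 < (2::nat) ^ w" "n + 3 < 2 ^ w" "n + 2 < 2 ^ w" "n < 2 ^ w"
    using small(1) by linarith+
  have tab: "31 < tab" by (simp add: tab_def)
  have "w > 0" using small(1) by (cases w) auto
  then have "setup_inv 0 M1"
    unfolding M1_def setup_inv_def using sm tab by (simp add: input_def base_def)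
  then have inv: "setup_inv K M2" unfolding M2_def by (intro stride_setup_inv) auto
  have "sem w (setup1 K) (input n) = M2(10 := n, 5 := 1, 31 := 0)"
    using inv sm \<open>w > 0\<close> unfolding setup1_def sem_seqs fold_append comp_def M1_def[symmetric] M2_def[symmetric]
    by (simp add: setup_inv_def)
  then have M: "M = M2(10 := n, 5 := 1, 31 := 0)" by (simp add: M_def)
  show "M 0 = n" "M 1 = base" "M 2 = base ^ K" "M 3 = 1" "M 15 = 2" "M 16 = n + 2" "M 17 = origin"
    "M 10 = n" "M 5 = 1" "\<forall>r<K. M (32 + K + r) = stride r" "\<forall>x. M (tab + x) = 0"
    unfolding M using inv tab by (auto simp: setup_inv_def origin_def key_def)
qed

lemma setup2_sem:
  assumes "M 0 = n" "M 1 = base" "M 2 = base ^ K" "M 3 = 1" "M 15 = 2" "M 16 = n + 2" "M 17 = origin"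
    "M 5 = 2 ^ n" "\<forall>r<K. M (32 + K + r) = stride r" "\<forall>x. M (tab + x) = 0"
  shows "fill_inv (n * base ^ K) (sem w (setup2 K) M)"
proof -
  have sm: "tab < 2 ^ w" "n * base ^ K < 2 ^ w" "base ^ K < 2 ^ w" "tab + origin < 2 ^ w"
    "tab + origin + n * base ^ K < 2 ^ w" "tab + n * base ^ K < 2 ^ w" "tab + n * base ^ K + base ^ K < 2 ^ w"
    using small cell_small[of n origin] cell_small[of 0 origin] cell_small[of n 0] origin_less pow_pos arr_less
    by (auto simp: tab_def arr_def algebra_simps)
  have tab: "31 < tab" "\<And>r. r < K \<Longrightarrow> 32 + K + r < tab" by (auto simp: tab_def)
  have ne': "32 + K + r \<noteq> tab + y" if "r < K" for r y using that by (simp add: tab_def)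
  have eq: "sem w (setup2 K) M = M(6 := tab, 18 := tab + origin, tab + origin := 1, 10 := n * base ^ K,
    17 := tab + origin + n * base ^ K, 4 := tab + n * base ^ K + base ^ K, 23 := base ^ K, 31 := 0)"
    using assms sm tab unfolding setup2_def sem_seqs tab_def[symmetric]
    by (simp add: fun_upd_twist)
  have "table_upto (base ^ K) (sem w (setup2 K) M)"
    unfolding table_upto_def eq using assms(10) tab origin_less by (auto simp: tab_def)
  then show ?thesis
    unfolding fill_inv_def using assms(1-9) tab ne' unfolding eq by (simp add: arr_def)
qed

lemma preprocess_runs:
  "\<exists>t M. t \<le> 3 + cost (setup1 K) + cost (setup2 K) + (n * (cost double + 1) + 1) +
      (n * base ^ K * (cost (fill_step K) + 1) + 1) \<and>
    runs w (preprocess K) (input n) t M [] \<and> prepared M"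
proof -
  define M1 where "M1 = sem w (setup1 K) (input n)"
  note s1 = setup1_sem[folded M1_def]
  obtain t1 where t1: "t1 \<le> cost (setup1 K)" "runs w (setup1 K) (input n) t1 M1 []"
    unfolding M1_def using runs_sem[OF plain_setup(1)] by blast
  define I where "I = (\<lambda>i M. i \<le> n \<and> M 10 = i \<and> M 5 = 2 ^ (n - i) \<and> (\<forall>z. z \<notin> {5, 10, 31} \<longrightarrow> M z = M1 z))"
  have "\<exists>t M'. t \<le> n * (cost double + 1) + 1 \<and> runs w (While 10 double) M1 t M' [] \<and> I 0 M'"
  proof (rule runs_While_invariant[OF plain_double])
    fix i M assume I: "I (Suc i) M"
    have "(2::nat) * 2 ^ (n - Suc i) = 2 ^ (n - i)" using I
      by (metis I_def Suc_diff_Suc less_eq_Suc_le power_Suc)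
    moreover have "(2::nat) ^ (n - i) \<le> 2 ^ n" by (intro power_increasing) auto
    then have "(2::nat) ^ (n - i) < 2 ^ w" using small(4) by linarith
    moreover have "i < 2 ^ w" using I small(1) by (simp add: I_def)
    ultimately show "M 10 \<noteq> 0 \<and> I i (sem w double M)"
      using I s1 unfolding I_def double_def sem_seqs by (auto simp flip: mult_2)
  qed (use s1 in \<open>auto simp: I_def\<close>)
  then obtain t2 M2 where t2: "t2 \<le> n * (cost double + 1) + 1" "runs w (While 10 double) M1 t2 M2 []" "I 0 M2"
    by blast
  have tab: "31 < tab" by (simp add: tab_def)
  have inv: "fill_inv (n * base ^ K) (sem w (setup2 K) M2)"
    by (rule setup2_sem) (use s1 t2(3) tab in \<open>auto simp: I_def\<close>)
  obtain t3 where t3: "t3 \<le> cost (setup2 K)" "runs w (setup2 K) M2 t3 (sem w (setup2 K) M2) []"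
    using runs_sem[OF plain_setup(2)] by blast
  obtain t4 M4 where t4: "t4 \<le> n * base ^ K * (cost (fill_step K) + 1) + 1"
    "runs w (While 10 (fill_step K)) (sem w (setup2 K) M2) t4 M4 []" "fill_inv 0 M4"
    using runs_While_invariant[where I = fill_inv and a = 10, OF plain_fill_step fill_step_inv _ inv]
    by (auto simp: fill_inv_def)
  have "runs w (preprocess K) (input n) (1 + t1 + (1 + t2 + (1 + t3 + t4))) M4 ([] @ [] @ [] @ [])"
    unfolding preprocess_def
    by (rule runs_Seq[OF t1(2) runs_Seq[OF t2(2) runs_Seq[OF t3(2) t4(2)]]])
  then show ?thesis using t1 t2 t3 t4 fill_inv_prepared
    by (intro exI[of _ "1 + t1 + (1 + t2 + (1 + t3 + t4))"] exI[of _ M4]) auto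
qed

end

section \<open>Generating a matching\<close>

definition bump :: "nat \<Rightarrow> com list" where
  "bump r = [Op Div 19 (32 + r) 11, Op Mul 19 19 11, Op Sub 13 19 3, Op And 13 19 13, Op Sub 13 19 13,
     Op Sub (32 + r) (32 + r) 13, Op Add (32 + r) (32 + r) 11, Op Mul 11 13 3]"

definition pop_max :: "nat \<Rightarrow> com list" where
  "pop_max r = [Op Sub 13 (32 + r) 3, Op And 13 (32 + r) 13, Op Sub 11 (32 + r) 13, Op Mul (32 + r) 13 3]"

fun action :: "move \<Rightarrow> com" where
  "action Skip = seqs [Const 13 0, Op Add 12 4 8, Store 12 13]"
| "action (Open r) = seqs [Op Mul 6 18 3, Op Add (32 + r) (32 + r) 8, Op Add 12 4 8, Store 12 9]"
| "action (Close r) = seqs ([Op Mul 6 18 3] @ (pop_max r @ concat (map bump (rev [0..<r]))) @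
     [Op Add 12 4 11, Load 13 12, Store 12 9, Op Add 12 4 8, Store 12 13])"

fun select_move :: "nat \<Rightarrow> move list \<Rightarrow> com" where
  "select_move K [] = action Skip"
| "select_move K (mv # ms) = Seq (locate K mv) (Seq (Load 14 18) (Seq (Op Sub 12 14 7)
     (Cond 12 (action mv) (Seq (Op Sub 7 7 14) (select_move K ms)))))"

definition gen_step :: "nat \<Rightarrow> com" where
  "gen_step K = seqs [Op Sub 6 6 2, Op Div 8 8 15, Op Add 9 9 3, Op Sub 10 10 3, select_move K (walk_graph.moves K)]"

definition gen_init :: "nat \<Rightarrow> com" where
  "gen_init K = seqs ([Op Mul 10 0 3, Op Mul 6 17 3, Op Mul 8 5 3, Const 9 0] @ map (\<lambda>r. Const (32 + r) 0) [0..<K])"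

definition rewind :: com where
  "rewind = seqs [Op Mul 10 0 3, Op Mul 8 5 3]"

definition emit :: com where
  "emit = Seq (Op Div 8 8 15) (Seq (Op Add 12 4 8) (Seq (Load 13 12) (Seq (Write 13) (Op Sub 10 10 3))))"

definition generate :: "nat \<Rightarrow> com" where
  "generate K = Seq (Load 14 17) (Seq (Rand 7 14)
     (Seq (gen_init K) (Seq (While 10 (gen_step K)) (Seq rewind (While 10 emit)))))"

lemma plain_action: "plain (action mv)"
  by (cases mv) (auto simp: plain_seqs bump_def pop_max_def)

lemma plain_select_move: "plain (select_move K ms)"
  by (induction ms) (auto simp: plain_action plain_locate simp del: action.simps)

lemma plain_gen_step: "plain (gen_step K)"
  by (auto simp: gen_step_def plain_seqs plain_select_move)

lemma plain_gen_init: "plain (gen_init K)" "plain rewind"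
  by (auto simp: gen_init_def rewind_def plain_seqs)

lemma tableau_drop: "tableau T \<Longrightarrow> tableau (drop j T)"
  by (induction T arbitrary: j) (auto simp: drop_Cons split: nat.split)

lemma row_drop: "row (drop j T) i = row T (j + i)"
  by (auto simp: row_def add.commute)

context machine
begin

lemma bits_bound: "R \<subseteq> {1..n} \<Longrightarrow> bits n R < 2 ^ n"
  using bits_less[of R 0 n] by (auto simp: subset_iff Suc_le_eq)

lemma bits_small: "R \<subseteq> {1..n} \<Longrightarrow> bits n R < 2 ^ w"
  using bits_bound[of R] small(4) by linarith

lemma power_bit_small: "(2::nat) ^ (n - x) < 2 ^ w"
proof -
  have "(2::nat) ^ (n - x) \<le> 2 ^ n" by (intro power_increasing) auto
  then show ?thesis using small(4) by linarith
qed

lemma arr_bit_small: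
  assumes "j \<le> n"
  shows "arr + 2 ^ j < 2 ^ w"
proof -
  have "(2::nat) ^ j \<le> 2 ^ (n + 1)" using assms by (intro power_increasing) auto
  then show ?thesis using arr_less by linarith
qed

lemma pop_max_sem:
  assumes "M 3 = 1" "M (32 + r) = bits n R" "finite R" "R \<subseteq> {1..n}" "R \<noteq> {}"
  shows "fold (sem w) (pop_max r) M (32 + r) = bits n (R - {Max R})"
    "fold (sem w) (pop_max r) M 11 = 2 ^ (n - Max R)"
    "z \<notin> {11, 13, 32 + r} \<Longrightarrow> fold (sem w) (pop_max r) M z = M z"
proof -
  have low: "and (bits n R) (bits n R - 1) = bits n (R - {Max R})"
    using assms by (intro bits_lowest) auto
  have eq: "bits n R = 2 ^ (n - Max R) + bits n (R - {Max R})" using assms by (intro bits_remove) auto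
  have sm: "bits n R < 2 ^ w" "bits n R - 1 < 2 ^ w" "bits n (R - {Max R}) < 2 ^ w" "(2::nat) ^ (n - Max R) < 2 ^ w"
    using bits_small[of R] bits_small[of "R - {Max R}"] assms(4) power_bit_small by (auto simp: less_imp_diff_less)
  have "bits n R - bits n (R - {Max R}) = 2 ^ (n - Max R)" using eq by simp
  then have "fold (sem w) (pop_max r) M =
    M(13 := bits n (R - {Max R}), 11 := 2 ^ (n - Max R), 32 + r := bits n (R - {Max R}))"
    using assms(1,2) sm low by (simp add: pop_max_def)
  then show "fold (sem w) (pop_max r) M (32 + r) = bits n (R - {Max R})"
    "fold (sem w) (pop_max r) M 11 = 2 ^ (n - Max R)"
    "z \<notin> {11, 13, 32 + r} \<Longrightarrow> fold (sem w) (pop_max r) M z = M z" by auto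
qed

lemma bump_sem:
  assumes "M 3 = 1" "M (32 + r) = bits n R" "M 11 = 2 ^ (n - x)" "finite R" "R \<subseteq> {1..n}"
    "\<exists>z\<in>R. z < x" "x \<notin> R" "x \<in> {1..n}"
  defines "y \<equiv> Max {z\<in>R. z < x}"
  shows "fold (sem w) (bump r) M (32 + r) = bits n (insert x (R - {y}))"
    "fold (sem w) (bump r) M 11 = 2 ^ (n - y)"
    "z \<notin> {11, 13, 19, 32 + r} \<Longrightarrow> fold (sem w) (bump r) M z = M z"
proof -
  let ?Q = "{z\<in>R. z < x}"
  have Q: "finite ?Q" "?Q \<subseteq> {1..n}" "?Q \<noteq> {}" using assms by auto
  have y: "y \<in> ?Q" unfolding y_def using Q by (intro Max_in) auto
  have trunc: "bits n R div 2 ^ (n - x) * 2 ^ (n - x) = bits n ?Q"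
    using assms by (intro bits_truncate) auto
  have low: "and (bits n ?Q) (bits n ?Q - 1) = bits n (?Q - {y})"
    unfolding y_def using Q by (intro bits_lowest) auto
  have eqQ: "bits n ?Q = 2 ^ (n - y) + bits n (?Q - {y})" using Q y by (intro bits_remove) auto
  have eqR: "bits n R = 2 ^ (n - y) + bits n (R - {y})" using assms(4) y by (intro bits_remove) auto
  have eqI: "bits n (insert x (R - {y})) = 2 ^ (n - x) + bits n (R - {y})"
    using assms(4,7) by (intro bits_insert) auto
  have sm: "bits n R < 2 ^ w" "bits n R div 2 ^ (n - x) < 2 ^ w" "bits n ?Q < 2 ^ w" "bits n ?Q - 1 < 2 ^ w"
    "bits n (?Q - {y}) < 2 ^ w" "(2::nat) ^ (n - y) < 2 ^ w" "bits n (R - {y}) < 2 ^ w"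
    "bits n (insert x (R - {y})) < 2 ^ w"
    using bits_small[of R] bits_small[of ?Q] bits_small[of "?Q - {y}"] bits_small[of "R - {y}"]
      bits_small[of "insert x (R - {y})"] power_bit_small assms(5,8) Q(2)
      le_less_trans[OF div_le_dividend[of "bits n R" "2 ^ (n - x)"]]
    by (auto simp: less_imp_diff_less)
  have "bits n ?Q - bits n (?Q - {y}) = 2 ^ (n - y)" "bits n R - 2 ^ (n - y) = bits n (R - {y})"
    using eqQ eqR by simp_all
  then have "fold (sem w) (bump r) M = M(19 := bits n ?Q, 13 := 2 ^ (n - y),
      32 + r := bits n (insert x (R - {y})), 11 := 2 ^ (n - y))"
    using assms(1-3) sm low trunc eqI by (simp add: bump_def add.commute)
  then show "fold (sem w) (bump r) M (32 + r) = bits n (insert x (R - {y}))"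
    "fold (sem w) (bump r) M 11 = 2 ^ (n - y)"
    "z \<notin> {11, 13, 19, 32 + r} \<Longrightarrow> fold (sem w) (bump r) M z = M z" by auto
qed

lemma close_sem:
  assumes tab: "tableau T" "length T = K" "\<Union>(set T) \<subseteq> {1..n}" and r: "r < K"
    and rem: "card (row T (Suc r)) < card (row T r)" and ex: "row_extract r T = (x, T')"
    and M: "M 3 = 1" "\<And>i. i < K \<Longrightarrow> M (32 + i) = bits n (T ! i)"
  defines "M' \<equiv> fold (sem w) (pop_max r @ concat (map bump (rev [0..<r]))) M"
  shows "M' 11 = 2 ^ (n - x)" "\<And>i. i < K \<Longrightarrow> M' (32 + i) = bits n (T' ! i)"
    "\<And>z. z \<notin> {11, 13, 19} \<Longrightarrow> z \<notin> {32..<32 + K} \<Longrightarrow> M' z = M z"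
proof -
  have sub: "T ! i \<subseteq> {1..n}" "finite (T ! i)" if "i < K" for i
    using tab that nth_mem[of i T] tableau_finite[OF tab(1), of "T ! i"] by blast+
  define prog where "prog = (\<lambda>j. pop_max r @ concat (map bump (rev [j..<r])))"
  have "let S = fold (sem w) (prog j) M; (y, Rs) = row_extract (r - j) (drop j T) in
      S 11 = 2 ^ (n - y) \<and> (\<forall>i<K. S (32 + i) = bits n (if i < j then T ! i else Rs ! (i - j))) \<and>
      (\<forall>z. z \<notin> {11, 13, 19} \<longrightarrow> z \<notin> {32..<32 + K} \<longrightarrow> S z = M z)" if "j \<le> r" for j
    using that
  proof (induction rule: inc_induct)
    case base
    have ne: "T ! r \<noteq> {}" using rem r tab(2) by (auto simp: row_def)
    have d: "drop r T = T ! r # drop (Suc r) T" using r tab(2) by (simp add: Cons_nth_drop_Suc)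
    note p = pop_max_sem[OF M(1) M(2)[OF r] sub(2,1)[OF r] ne]
    have "fold (sem w) (pop_max r) M (32 + i) = bits n (if i < r then T ! i else ((T ! r - {Max (T ! r)}) # drop (Suc r) T) ! (i - r))"
      if "i < K" for i
    proof (cases "i = r")
      case False
      then have "fold (sem w) (pop_max r) M (32 + i) = bits n (T ! i)" using p(3)[of "32 + i"] M(2)[OF that] by simp
      then show ?thesis using False that tab(2) by (auto simp: nth_Cons' not_less)
    qed (use p in simp)
    then show ?case using p r by (auto simp: prog_def d)
  next
    case (step j)
    define S where "S = fold (sem w) (prog (Suc j)) M"
    obtain y Rs where e: "row_extract (r - Suc j) (drop (Suc j) T) = (y, Rs)" by fastforce
    have IH: "S 11 = 2 ^ (n - y)" "\<And>i. i < K \<Longrightarrow> S (32 + i) = bits n (if i < Suc j then T ! i else Rs ! (i - Suc j))"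
      "\<And>z. z \<notin> {11, 13, 19} \<Longrightarrow> z \<notin> {32..<32 + K} \<Longrightarrow> S z = M z"
      using step.IH unfolding S_def[symmetric] e by (auto simp: Let_def)
    have j: "j < K" "Suc j < K" using step r by auto
    have d: "drop j T = T ! j # drop (Suc j) T" using j tab(2) by (simp add: Cons_nth_drop_Suc)
    have "card (row (drop (Suc j) T) (Suc (r - Suc j))) < card (row (drop (Suc j) T) (r - Suc j))"
      using rem step by (simp add: row_drop)
    note p = row_extract_props[OF tableau_drop[OF tab(1)] this e]
    have y: "y \<in> T ! Suc j" using p j tab(2) by (metis Cons_nth_drop_Suc hd_row.simps(2))
    then have yn: "y \<notin> T ! j" "y \<in> {1..n}"
      using tableau_disjoint[OF tab(1), of j "Suc j"] j tab(2) sub[OF j(2)] by auto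
    have "tableau (T ! j # drop (Suc j) T)" using tableau_drop[OF tab(1), of j] d by simp
    then have ex: "\<exists>z\<in>T ! j. z < y" by (rule tableau_smaller_above) (use p in simp)
    define v where "v = Max {z \<in> T ! j. z < y}"
    have "prog j = prog (Suc j) @ bump j" using step by (simp add: prog_def upt_rec[of j r])
    then have S': "fold (sem w) (prog j) M = fold (sem w) (bump j) S" by (simp add: S_def)
    have "r - j = Suc (r - Suc j)" using step by simp
    then have e': "row_extract (r - j) (drop j T) = (v, insert y (T ! j - {v}) # Rs)"
      unfolding d by (simp add: e v_def Let_def)
    have S3: "S 3 = 1" using IH(3)[of 3] M(1) by simp
    have Sj: "S (32 + j) = bits n (T ! j)" using IH(2)[OF j(1)] by simp
    note b = bump_sem[OF S3 Sj IH(1) sub(2,1)[OF j(1)] ex yn, folded v_def]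
    have "fold (sem w) (bump j) S (32 + i) = bits n (if i < j then T ! i else (insert y (T ! j - {v}) # Rs) ! (i - j))"
      if "i < K" for i
    proof (cases "i = j")
      case False
      then have "fold (sem w) (bump j) S (32 + i) = S (32 + i)" using b(3)[of "32 + i"] by simp
      then show ?thesis using IH(2)[OF that] False by (auto simp: nth_Cons' not_less)
    qed (use b in simp)
    then show ?case unfolding S' e' using b IH(3) j by auto
  qed
  from this[of 0] show "M' 11 = 2 ^ (n - x)" "\<And>i. i < K \<Longrightarrow> M' (32 + i) = bits n (T' ! i)"
    "\<And>z. z \<notin> {11, 13, 19} \<Longrightarrow> z \<notin> {32..<32 + K} \<Longrightarrow> M' z = M z"
    using ex unfolding prog_def M'_def[symmetric] by (auto simp: Let_def)
qed

lemma select_move_sem: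
  assumes "set ms \<subseteq> set moves" "prepared M" "M 6 = tab + (m * base ^ K + x)" "inside K x" "x < base ^ K" "m < n"
    "M 7 = u" "u < 2 ^ w" "pick (\<lambda>mv. count m (target mv x)) ms u = (mv, u')"
  shows "\<exists>M1. sem w (select_move K ms) M = sem w (action mv) M1 \<and> M1 7 = u' \<and>
    (mv \<noteq> Skip \<longrightarrow> M1 18 = tab + (m * base ^ K + target mv x)) \<and> (\<forall>z. z \<notin> {7, 12, 14, 18} \<longrightarrow> M1 z = M z)"
  using assms(1-3,7-9)
proof (induction ms arbitrary: M u)
  case Nil
  then show ?case by auto
next
  case (Cons v ms)
  have v: "v \<in> set moves" using Cons.prems by simp
  let ?c = "count m (target v x)"
  have "target v x < base ^ K" using target_less[OF assms(4,5)] v by simp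
  then have load: "M (tab + (m * base ^ K + target v x)) = ?c" using Cons.prems(2) assms(6) by (simp add: prepared_def)
  have ne: "tab + y \<noteq> z" if "z \<le> 31" for y z using that by (simp add: tab_def)
  have csm: "?c < 2 ^ w"
    using le_less_trans[OF count_le[of m], of "2 ^ w"] power_increasing[of m "n + 1" "2 * K + 1"] small(6) assms(6)
    by simp
  define M0 where "M0 = M(18 := tab + (m * base ^ K + target v x), 14 := ?c, 12 := ?c - u)"
  have M0: "sem w (Op Sub 12 14 7) (sem w (Load 14 18) (sem w (locate K v) M)) = M0"
    using locate_sem[of v M m x, OF v Cons.prems(3) assms(4,5)] assms(6) Cons.prems load ne csm
    by (simp add: M0_def prepared_def less_imp_diff_less)
  have sel: "sem w (select_move K (v # ms)) M = (if M0 12 \<noteq> 0 then sem w (action v) M0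
      else sem w (select_move K ms) (sem w (Op Sub 7 7 14) M0))"
    unfolding select_move.simps sem.simps(5) M0 sem.simps(6) ..
  have M0': "M0 12 = ?c - u" "M0 7 = u" "M0 14 = ?c" "M0 18 = tab + (m * base ^ K + target v x)"
    "\<forall>z. z \<notin> {7, 12, 14, 18} \<longrightarrow> M0 z = M z"
    using Cons.prems(4) by (auto simp: M0_def)
  show ?case
  proof (cases "u < ?c")
    case True
    then have "mv = v" "u' = u" using Cons.prems by auto
    moreover have "sem w (select_move K (v # ms)) M = sem w (action v) M0"
      unfolding sel using M0'(1) True by simp
    ultimately show ?thesis using M0' by (intro exI[of _ M0]) simp
  next
    case False
    let ?M = "M0(7 := u - ?c)"
    have "sem w (Op Sub 7 7 14) M0 = ?M" using M0' Cons.prems(5) by (simp add: less_imp_diff_less)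
    then have "sem w (select_move K (v # ms)) M = sem w (select_move K ms) ?M"
      unfolding sel using M0'(1) False by simp
    moreover have p: "prepared ?M" using Cons.prems(2) ne unfolding prepared_def M0_def by simp
    have q: "set ms \<subseteq> set moves" "?M 6 = tab + (m * base ^ K + x)" "?M 7 = u - ?c" "u - ?c < 2 ^ w"
      "pick (\<lambda>mv. count m (target mv x)) ms (u - ?c) = (mv, u')"
      using Cons.prems M0'(5) False by (simp_all add: less_imp_diff_less)
    obtain M1 where "sem w (select_move K ms) ?M = sem w (action mv) M1" "M1 7 = u'"
      "mv \<noteq> Skip \<longrightarrow> M1 18 = tab + (m * base ^ K + target mv x)" "\<forall>z. z \<notin> {7, 12, 14, 18} \<longrightarrow> M1 z = ?M z"
      using Cons.IH[OF q(1) p q(2-5)] by blast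
    ultimately show ?thesis using M0'(5) by (intro exI[of _ M1]) simp
  qed
qed

lemma prepared_frame:
  assumes "prepared M" "\<And>z. z < arr \<Longrightarrow> z \<notin> {6..14} \<union> {18, 19, 31} \<Longrightarrow> z \<notin> {32..<32 + K} \<Longrightarrow> M' z = M z"
  shows "prepared M'"
proof -
  have "31 < arr" "\<And>r. r < K \<Longrightarrow> 32 + K + r < arr" by (auto simp: arr_def tab_def)
  then have "M' 0 = M 0" "M' 2 = M 2" "M' 3 = M 3" "M' 4 = M 4" "M' 5 = M 5" "M' 15 = M 15" "M' 17 = M 17"
    "\<And>r. r < K \<Longrightarrow> M' (32 + K + r) = M (32 + K + r)"
    by (auto intro!: assms(2))
  moreover have "M' (tab + (m * base ^ K + x)) = M (tab + (m * base ^ K + x))" if "m \<le> n" "x < base ^ K" for m x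
    using cell_less[OF that] by (intro assms(2)) (auto simp: arr_def tab_def)
  ultimately show ?thesis using assms(1) by (simp add: prepared_def)
qed

text \<open>
  While the arc opened at \<open>j\<close> has not been closed, the array entry of \<open>j\<close> is \<open>j\<close> itself; it is at
  address \<open>2 ^ (n - j)\<close>, so reading it converts a bit into a vertex.
\<close>

definition gen_inv :: "(nat \<times> nat) set \<Rightarrow> nat \<Rightarrow> mem \<Rightarrow> bool" where
  "gen_inv D i M \<longleftrightarrow> prepared M \<and> i \<le> n \<and> M 8 = 2 ^ i \<and> M 9 = n - i \<and> M 10 = i \<and>
     (\<exists>T \<mu>. state (n - i) T \<and> M 7 < count i (shape_key T) \<and> M 6 = tab + (i * base ^ K + shape_key T) \<and>
       (\<forall>r<K. M (32 + r) = bits n (T ! r)) \<and>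
       D = \<mu> \<union> decode (n - i) T (unrank i (shape_key T) (M 7)) \<and> \<mu> \<subseteq> {..n - i} \<times> {..n - i} \<and>
       (\<forall>j\<in>{1..n - i}. M (arr + 2 ^ (n - j)) = (if j \<in> \<Union>(set T) then j else partner D j)))"

lemma gen_step_inv:
  assumes D: "partial_matching n D" and inv: "gen_inv D (Suc m) M"
  shows "M 10 \<noteq> 0 \<and> gen_inv D m (sem w (gen_step K) M)"
proof -
  define t where "t = n - Suc m"
  have mn: "m < n" "n - m = Suc t" "n - Suc t = m" using inv by (auto simp: gen_inv_def t_def)
  then have tn: "t < n" "n - t = Suc m" by auto
  obtain T \<mu> where st: "state t T" and u: "M 7 < count (Suc m) (shape_key T)"
    and pos: "M 6 = tab + (Suc m * base ^ K + shape_key T)" and rows: "\<And>r. r < K \<Longrightarrow> M (32 + r) = bits n (T ! r)"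
    and dec: "D = \<mu> \<union> decode t T (unrank (Suc m) (shape_key T) (M 7))" and \<mu>: "\<mu> \<subseteq> {..t} \<times> {..t}"
    and part: "\<And>j. j \<in> {1..t} \<Longrightarrow> M (arr + 2 ^ (n - j)) = (if j \<in> \<Union>(set T) then j else partner D j)"
    using inv unfolding gen_inv_def t_def by blast
  have prep: "prepared M" and regs: "M 8 = 2 ^ Suc m" "M 9 = t" "M 10 = Suc m"
    using inv by (auto simp: gen_inv_def t_def)
  have c: "M 2 = base ^ K" "M 3 = 1" "M 4 = arr" "M 15 = 2" using prep by (auto simp: prepared_def)
  define x where "x = shape_key T"
  have x: "inside K x" "x < base ^ K"
    unfolding x_def using inside_shape_key[OF st] shape_key_less[OF st] tn by auto
  obtain mv u' where pk: "pick (\<lambda>mv. count m (target mv x)) moves (M 7) = (mv, u')" by fastforce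
  define ws where "ws = unrank m (target mv x) u'"
  have un: "unrank (Suc m) x (M 7) = mv # ws" by (simp add: pk ws_def)
  have "(mv, u') \<in> (SIGMA mv:insert Skip (set moves). {..<count m (target mv x)})"
    using bij_betw_apply[OF pick_bij[OF distinct_moves, of "\<lambda>mv. count m (target mv x)"], of "M 7"] u x pk
    by (simp add: x_def)
  then have mv: "mv \<in> insert Skip (set moves)" and u': "u' < count m (target mv x)" by auto
  have walk: "mv # ws \<in> walks (n - t) (shape_key T)"
    using bij_betw_apply[OF unrank_bij[of "Suc m" x], of "M 7"] u un tn by (simp add: x_def)
  define T' where "T' = act t mv T"
  note f = forward[OF st tn(1) walk, folded T'_def]
  have ins: "inside K (target mv x)" using walks_inside[OF f(3)] f(2) by (simp add: x_def)
  define M0 where "M0 = M(6 := tab + (m * base ^ K + x), 8 := 2 ^ m, 9 := Suc t, 10 := m)"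
  have sm: "tab + (m * base ^ K + x) < 2 ^ w" "(2::nat) ^ m < 2 ^ w" "Suc t < 2 ^ w" "m < 2 ^ w"
    using cell_small[of m x] mn x power_bit_small[of "Suc t"] small(1) by auto
  have asm: "arr + 2 ^ m < 2 ^ w" using mn by (intro arr_bit_small) simp
  have M0: "fold (sem w) [Op Sub 6 6 2, Op Div 8 8 15, Op Add 9 9 3, Op Sub 10 10 3] M = M0"
    using sm c regs pos by (simp add: M0_def x_def)
  have "prepared M0" using prep by (rule prepared_frame) (auto simp: M0_def)
  moreover have "M 7 < 2 ^ w" using u count_small[of m x] mn by (simp add: x_def)
  ultimately obtain M1 where M1: "sem w (select_move K moves) M0 = sem w (action mv) M1" "M1 7 = u'"
    "mv \<noteq> Skip \<longrightarrow> M1 18 = tab + (m * base ^ K + target mv x)" "\<And>z. z \<notin> {7, 12, 14, 18} \<Longrightarrow> M1 z = M0 z"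
    using select_move_sem[of moves M0 m x "M 7" mv u'] x mn pk by (auto simp: M0_def)
  define M2 where "M2 = sem w (gen_step K) M"
  have gs: "gen_step K = seqs ([Op Sub 6 6 2, Op Div 8 8 15, Op Add 9 9 3, Op Sub 10 10 3] @ [select_move K moves])"
    by (simp add: gen_step_def)
  have M2: "M2 = (sem w (action mv) M1)(31 := 0)"
    unfolding M2_def gs sem_seqs fold_append comp_def M0 by (simp add: M1(1))
  have tab31: "31 < tab" "\<And>r. r < K \<Longrightarrow> 32 + r < arr" "tab \<le> arr" by (auto simp: tab_def arr_def)
  have M1c: "M1 3 = 1" "M1 4 = arr" "M1 8 = 2 ^ m" "M1 9 = Suc t" "M1 10 = m" "M1 6 = tab + (m * base ^ K + x)"
    using M1(4) c by (auto simp: M0_def)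
  have M1M: "M1 z = M z" if "z \<ge> 32" for z using M1(4)[of z] that by (auto simp: M0_def)
  have M1M': "M1 z = M z" if "z \<notin> {6..14} \<union> {18, 19, 31}" for z using M1(4)[of z] that by (auto simp: M0_def)
  have rows1: "M1 (32 + r) = bits n (T ! r)" if "r < K" for r using M1M[of "32 + r"] rows[OF that] by simp
  have arr32: "arr + y \<ge> 32" for y by (simp add: arr_def tab_def)
  have sT: "\<Union>(set T) \<subseteq> {1..t}" "length T = K" "tableau T" using st by (auto simp: state_def)
  have rowT: "T ! r \<subseteq> {1..t}" "finite (T ! r)" if "r < K" for r
    using sT that nth_mem[of r T] tableau_finite[OF sT(3), of "T ! r"] by blast+
  have tgt: "target mv x < base ^ K" using target_less[OF x mv] .
  have possm: "tab + (m * base ^ K + target mv x) < 2 ^ w" using cell_small[OF _ tgt] mn by simp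
  have inj: "(2::nat) ^ (n - j) = 2 ^ m \<longleftrightarrow> j = Suc t" if "j \<in> {1..Suc t}" for j
    using that mn by auto
  have dec': "D = \<mu> \<union> arc t mv T \<union> decode (Suc t) T' ws"
    using dec un unfolding x_def by (simp add: T'_def Un_assoc)
  note arcs = decode_arcs(1)[OF f(1) _ f(3)]
  have step: "M2 6 = tab + (m * base ^ K + target mv x) \<and> M2 7 = u' \<and> M2 8 = 2 ^ m \<and> M2 9 = Suc t \<and> M2 10 = m \<and>
      (\<forall>r<K. M2 (32 + r) = bits n (T' ! r)) \<and>
      (\<forall>z. z < arr \<longrightarrow> z \<notin> {6..14} \<union> {18, 19, 31} \<longrightarrow> z \<notin> {32..<32 + K} \<longrightarrow> M2 z = M z) \<and>
      (\<forall>j\<in>{1..Suc t}. M2 (arr + 2 ^ (n - j)) = (if j \<in> \<Union>(set T') then j else partner D j)) \<and>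
      arc t mv T \<subseteq> {..Suc t} \<times> {..Suc t}"
  proof (cases mv)
    case Skip
    have M2e: "M2 = M1(13 := 0, 12 := arr + 2 ^ m, arr + 2 ^ m := 0, 31 := 0)"
      unfolding M2 Skip using M1c asm arr32 by (auto simp: sem_seqs)
    have "T' = T" using Skip by (simp add: T'_def)
    have iso: "(Suc t, j) \<notin> D" "(j, Suc t) \<notin> D" for j
      using \<mu> arcs sT(1) tn(1) Skip unfolding dec' \<open>T' = T\<close> by fastforce+
    then have p0: "partner D (Suc t) = 0" by (simp add: partner_def)
    have "M2 (arr + 2 ^ (n - j)) = (if j \<in> \<Union>(set T) then j else partner D j)" if j: "j \<in> {1..Suc t}" for j
    proof (cases "j = Suc t")
      case True
      then show ?thesis using M2e mn sT(1) p0 arr32[of "2 ^ m"] by auto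
    next
      case False
      then have "M2 (arr + 2 ^ (n - j)) = M (arr + 2 ^ (n - j))"
        using inj[OF j] arr32[of "2 ^ (n - j)"] M1M[OF arr32] by (simp add: M2e)
      then show ?thesis using part[of j] j False by simp
    qed
    moreover have "M2 (32 + r) = bits n (T ! r)" if "r < K" for r
      using tab31(2)[OF that] rows1[OF that] by (simp add: M2e)
    ultimately show ?thesis
      using Skip M1c M1(2) tab31 M1M' unfolding \<open>T' = T\<close> by (simp add: M2e)
  next
    case (Open r)
    have r: "r < K" using mv Open by (auto simp: moves_def)
    have U: "\<Union>(set T') = insert (Suc t) (\<Union>(set T))"
      unfolding T'_def Open using forward_open(3)[OF st tn(1) r] ins Open by (simp add: x_def)
    have nin: "Suc t \<notin> T ! r" using rowT[OF r] by auto
    have b: "bits n (T ! r) + 2 ^ m = bits n (insert (Suc t) (T ! r))"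
      using bits_insert[OF rowT(2)[OF r] nin, of n] mn by simp
    have bsm: "bits n (insert (Suc t) (T ! r)) < 2 ^ w"
      using rowT(1)[OF r] tn(1) by (intro bits_small) auto
    have M2e: "M2 = M1(6 := tab + (m * base ^ K + target mv x), 32 + r := bits n (insert (Suc t) (T ! r)),
        12 := arr + 2 ^ m, arr + 2 ^ m := Suc t, 31 := 0)"
      unfolding M2 using Open M1(3) M1c asm possm rows1[OF r] b bsm by (simp add: sem_seqs)
    have T': "T' = T[r := insert (Suc t) (T ! r)]" by (simp add: T'_def Open)
    have rows2: "M2 (32 + i) = bits n (T' ! i)" if "i < K" for i
      using tab31(2)[OF that] rows1[OF that] sT(2) that by (auto simp: M2e T')
    have "M2 (arr + 2 ^ (n - j)) = (if j \<in> \<Union>(set T') then j else partner D j)" if j: "j \<in> {1..Suc t}" for j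
    proof (cases "j = Suc t")
      case True
      then show ?thesis using M2e mn U arr32[of "2 ^ m"] by auto
    next
      case False
      have "M2 (arr + 2 ^ (n - j)) = M (arr + 2 ^ (n - j))"
        using inj[OF j] arr32[of "2 ^ (n - j)"] M1M[OF arr32] False tab31(2)[OF r] by (simp add: M2e)
      then show ?thesis using part[of j] j False U by simp
    qed
    then show ?thesis using rows2 Open M1c M1(2) tab31 M1M' r by (simp add: M2e)
  next
    case (Close r)
    have r: "r < K" using mv Close by (auto simp: moves_def)
    have "inside K (shape_key T - stride r)" using ins Close by (simp add: x_def)
    from forward_close[OF st tn(1) r this] obtain v where
      v: "row_extract r T = (v, T')" "\<Union>(set T') = \<Union>(set T) - {v}" "v \<in> \<Union>(set T)"
        "card (row T (Suc r)) < card (row T r)"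
      unfolding T'_def Close by metis
    have vt: "v \<in> {1..t}" using v(3) sT(1) by blast
    have arc: "arc t mv T = {(v, Suc t)}" using v(1) Close by simp
    then have "(v, Suc t) \<in> D" unfolding dec' by simp
    note pd = partner_arc[OF D this]
    define M3 where "M3 = M1(6 := tab + (m * base ^ K + target mv x))"
    define M4 where "M4 = fold (sem w) (pop_max r @ concat (map bump (rev [0..<r]))) M3"
    have M4: "M4 11 = 2 ^ (n - v)" "\<And>i. i < K \<Longrightarrow> M4 (32 + i) = bits n (T' ! i)"
      "\<And>z. z \<notin> {11, 13, 19} \<Longrightarrow> z \<notin> {32..<32 + K} \<Longrightarrow> M4 z = M3 z"
    proof -
      have "\<Union>(set T) \<subseteq> {1..n}" using sT(1) tn(1) by (auto simp: subset_iff)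
      moreover have "M3 3 = 1" "\<And>i. i < K \<Longrightarrow> M3 (32 + i) = bits n (T ! i)"
        using M1c rows1 by (simp_all add: M3_def)
      ultimately show "M4 11 = 2 ^ (n - v)" "\<And>i. i < K \<Longrightarrow> M4 (32 + i) = bits n (T' ! i)"
        "\<And>z. z \<notin> {11, 13, 19} \<Longrightarrow> z \<notin> {32..<32 + K} \<Longrightarrow> M4 z = M3 z"
        unfolding M4_def using close_sem[OF sT(3,2) _ r v(4,1), of M3] by blast+
    qed
    have arr4: "M4 (arr + y) = M (arr + y)" for y
      using M4(3)[of "arr + y"] M1M[OF arr32] arr32[of y] tab31 by (auto simp: M3_def arr_def tab_def)
    have c4: "M4 4 = arr" "M4 8 = 2 ^ m" "M4 9 = Suc t" using M4(3) M1c by (auto simp: M3_def)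
    have vsm: "arr + 2 ^ (n - v) < 2 ^ w" by (intro arr_bit_small) simp
    have lv: "M4 (arr + 2 ^ (n - v)) = v" using arr4 part[OF vt] v(3) by simp
    have m3: "sem w (Op Mul 6 18 3) M1 = M3"
      using M1(3) M1c possm Close by (simp add: M3_def)
    have "sem w (action mv) M1 = (fold (sem w) [Op Add 12 4 11, Load 13 12, Store 12 9, Op Add 12 4 8, Store 12 13] M4)(31 := 0)"
      by (simp only: Close action.simps sem_seqs fold_append comp_def fold.simps id_def m3 M4_def)
    moreover have ne12: "arr + y \<noteq> z" if "z \<le> 31" for y z using arr32[of y] that by auto
    ultimately have M2e: "M2 = M4(12 := arr + 2 ^ m, 13 := v, arr + 2 ^ (n - v) := Suc t, arr + 2 ^ m := v, 31 := 0)"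
      unfolding M2 using c4 M4(1) vsm asm lv by (simp add: fun_upd_twist)
    have rows2: "M2 (32 + i) = bits n (T' ! i)" if "i < K" for i
      using tab31(2)[OF that] M4(2)[OF that] by (simp add: M2e)
    have "M2 (arr + 2 ^ (n - j)) = (if j \<in> \<Union>(set T') then j else partner D j)" if j: "j \<in> {1..Suc t}" for j
    proof -
      have jv: "(2::nat) ^ (n - j) = 2 ^ (n - v) \<longleftrightarrow> j = v" using j vt tn(1) by auto
      consider "j = Suc t" | "j = v" "j \<noteq> Suc t" | "j \<noteq> v" "j \<noteq> Suc t" by blast
      then show ?thesis
      proof cases
        case 1
        then show ?thesis using M2e mn pd v(2) sT(1) ne12 by auto
      next
        case 2
        then show ?thesis using M2e inj[OF j] pd v(2) ne12 by auto
      next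
        case 3
        then have "M2 (arr + 2 ^ (n - j)) = M (arr + 2 ^ (n - j))"
          using inj[OF j] jv ne12 arr4 by (simp add: M2e)
        then show ?thesis using part[of j] j 3 v(2) by simp
      qed
    qed
    moreover have "M2 z = M z" if "z < arr" "z \<notin> {6..14} \<union> {18, 19, 31}" "z \<notin> {32..<32 + K}" for z
    proof -
      have "M2 z = M4 z" using that by (auto simp: M2e)
      also have "\<dots> = M3 z" using that by (intro M4(3)) auto
      also have "\<dots> = M z" using M1M'[OF that(2)] that by (auto simp: M3_def)
      finally show ?thesis .
    qed
    moreover have "M2 z = M3 z" if "z \<in> {6, 7, 8, 9, 10}" for z
      using M4(3)[of z] that ne12 by (auto simp: M2e)
    then have "M2 6 = tab + (m * base ^ K + target mv x)" "M2 7 = u'" "M2 8 = 2 ^ m" "M2 9 = Suc t" "M2 10 = m"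
      using M1c M1(2) by (auto simp: M3_def)
    ultimately show ?thesis using rows2 vt unfolding arc by auto
  qed
  have "prepared M2" using prep step by (intro prepared_frame[of M M2]) auto
  then have "gen_inv D m M2"
    unfolding gen_inv_def
  proof (intro conjI exI[of _ T'] exI[of _ "\<mu> \<union> arc t mv T"])
    show "\<mu> \<union> arc t mv T \<subseteq> {..n - m} \<times> {..n - m}"
      using \<mu> step unfolding mn(2) by (auto simp: subset_iff le_SucI)
    show "D = \<mu> \<union> arc t mv T \<union> decode (n - m) T' (unrank m (shape_key T') (M2 7))"
      using dec' step f(2) unfolding mn(2) ws_def x_def by simp
  qed (use step f u' mn in \<open>auto simp: x_def\<close>)
  then show ?thesis using regs by (simp add: M2_def)
qed

lemma emit_runs:
  assumes "M 10 = i" "M 8 = 2 ^ i" "i \<le> n" "prepared M" "\<And>j. j < n \<Longrightarrow> M (arr + 2 ^ j) = f j"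
  shows "\<exists>t M'. t \<le> 10 * i + 1 \<and> runs w (While 10 emit) M t M' (map f (rev [0..<i])) \<and> prepared M'"
  using assms
proof (induction i arbitrary: M)
  case 0
  then show ?case using runs_While_stop[of M 10 w emit] by (intro exI[of _ 1] exI[of _ M]) auto
next
  case (Suc i)
  define M1 where "M1 = M(8 := 2 ^ i, 12 := arr + 2 ^ i, 13 := f i)"
  define M2 where "M2 = M1(10 := i)"
  have c: "M 3 = 1" "M 4 = arr" "M 15 = 2" using Suc.prems(4) by (auto simp: prepared_def)
  have "arr + 2 ^ i < 2 ^ w" using Suc.prems(3) by (intro arr_bit_small) simp
  then have sm: "(2::nat) ^ i < 2 ^ w" "arr + 2 ^ i < 2 ^ w" "i < 2 ^ w"
    using small(1) Suc.prems(3) by linarith+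
  have ne: "arr + y \<noteq> z" if "z \<le> 31" for y z using that by (simp add: arr_def tab_def)
  have r1: "runs w (Op Div 8 8 15) M 1 (M(8 := 2 ^ i)) []"
    using Suc.prems(2) c sm by (intro runs_atom) simp
  have r2: "runs w (Op Add 12 4 8) (M(8 := 2 ^ i)) 1 (M(8 := 2 ^ i, 12 := arr + 2 ^ i)) []"
    using c sm by (intro runs_atom) simp
  have r3: "runs w (Load 13 12) (M(8 := 2 ^ i, 12 := arr + 2 ^ i)) 1 M1 []"
    using Suc.prems(3) Suc.prems(5)[of i] ne by (intro runs_atom) (simp add: M1_def)
  have r4: "runs w (Write 13) M1 1 M1 [f i]" by (intro runs_atom) (simp add: M1_def)
  have r5: "runs w (Op Sub 10 10 3) M1 1 M2 []"
    using c sm Suc.prems(1) by (intro runs_atom) (simp add: M1_def M2_def)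
  have r: "runs w emit M 9 M2 [f i]"
    using runs_Seq[OF r1 runs_Seq[OF r2 runs_Seq[OF r3 runs_Seq[OF r4 r5]]]] by (simp add: emit_def eval_nat_numeral)
  have p2: "prepared M2" using Suc.prems(4) by (rule prepared_frame) (auto simp: M2_def M1_def)
  have q2: "M2 10 = i" "M2 8 = 2 ^ i" by (simp_all add: M2_def M1_def)
  have "M2 (arr + 2 ^ j) = f j" if "j < n" for j
    using Suc.prems(5)[OF that] ne by (simp add: M2_def M1_def)
  from Suc.IH[OF q2 _ p2 this] obtain t M' where t: "t \<le> 10 * i + 1" "runs w (While 10 emit) M2 t M' (map f (rev [0..<i]))" "prepared M'"
    using Suc.prems(3) by auto
  have "runs w (While 10 emit) M (1 + 9 + t) M' ([f i] @ map f (rev [0..<i]))"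
    by (rule runs_While_go[OF _ r t(2)]) (use Suc.prems(1) in simp)
  then show ?case using t by (intro exI[of _ "1 + 9 + t"] exI[of _ M']) auto
qed

definition outcome :: "nat \<Rightarrow> (nat \<times> nat) set" where
  "outcome u = decode 0 (replicate K {}) (unrank n origin u)"

lemma generate_runs:
  assumes "prepared M" "M 7 = u" "u < count n origin"
  shows "\<exists>t\<le>cost (gen_init K) + (n * (cost (gen_step K) + 1) + 1) + cost rewind + (10 * n + 1) + 3.
    \<exists>M'. runs w (Seq (gen_init K) (Seq (While 10 (gen_step K)) (Seq rewind (While 10 emit)))) M t M'
      (encode n (outcome u)) \<and> prepared M'"
proof -
  define D where "D = outcome u"
  have "D \<in> nc_matchings (Suc K) n"
    unfolding D_def outcome_def using bij_betw_apply[OF unrank_matching_bij, of u] assms(3) by simp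
  then have D: "partial_matching n D" by (simp add: nc_matchings_def)
  have c: "M 0 = n" "M 3 = 1" "M 5 = 2 ^ n" "M 17 = tab + (n * base ^ K + origin)"
    using assms(1) by (auto simp: prepared_def)
  have sm: "n < 2 ^ w" "(2::nat) ^ n < 2 ^ w" "tab + (n * base ^ K + origin) < 2 ^ w"
    using small cell_small[of n origin] origin_less by linarith+
  define M1 where "M1 = sem w (gen_init K) M"
  let ?M = "M(10 := n, 6 := tab + (n * base ^ K + origin), 8 := 2 ^ n, 9 := 0)"
  have init: "fold (sem w) (map (\<lambda>r. Const (32 + r) 0) [0..<j]) N z =
      (if z \<in> {32..<32 + j} then 0 else N z)" for j N z
    by (induction j) auto
  have M1: "M1 z = (if z \<in> insert 31 {32..<32 + K} then 0 else ?M z)" for z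
    using c sm init[of K ?M z] unfolding M1_def gen_init_def sem_seqs by auto
  obtain t1 where t1: "t1 \<le> cost (gen_init K)" "runs w (gen_init K) M t1 M1 []"
    unfolding M1_def using runs_sem[OF plain_gen_init(1)] by blast
  have "gen_inv D n M1"
    unfolding gen_inv_def
  proof (intro conjI exI[of _ "replicate K {}"] exI[of _ "{}"])
    show "prepared M1" using assms(1) by (rule prepared_frame) (auto simp: M1)
    show "D = {} \<union> decode (n - n) (replicate K {}) (unrank n (shape_key (replicate K {})) (M1 7))"
      using assms(2) by (simp add: M1 D_def outcome_def shape_key_empty)
  qed (use assms(2,3) state_empty in \<open>auto simp: M1 shape_key_empty bits_def\<close>)
  then have "\<exists>t M'. t \<le> n * (cost (gen_step K) + 1) + 1 \<and> runs w (While 10 (gen_step K)) M1 t M' [] \<and> gen_inv D 0 M'"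
    by (intro runs_While_invariant[where I = "gen_inv D" and a = 10, OF plain_gen_step gen_step_inv[OF D]])
      (simp_all only: gen_inv_def)
  then obtain t2 M2 where t2: "t2 \<le> n * (cost (gen_step K) + 1) + 1" "runs w (While 10 (gen_step K)) M1 t2 M2 []"
    "gen_inv D 0 M2" by blast
  then obtain T where T: "state n T" "M2 7 < count 0 (shape_key T)"
    "\<And>j. j \<in> {1..n} \<Longrightarrow> M2 (arr + 2 ^ (n - j)) = (if j \<in> \<Union>(set T) then j else partner D j)"
    unfolding gen_inv_def by auto
  have "shape_key T = origin" using T(2) by (cases "shape_key T = origin") auto
  then have "\<Union>(set T) = {}" using T(1) by (intro shape_key_origin) (simp_all add: state_def)
  then have part: "M2 (arr + 2 ^ (n - j)) = partner D j" if "j \<in> {1..n}" for j using T(3)[OF that] by auto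
  have p2: "prepared M2" using t2(3) by (simp add: gen_inv_def)
  then have c2: "M2 0 = n" "M2 3 = 1" "M2 5 = 2 ^ n" by (auto simp: prepared_def)
  define M3 where "M3 = sem w rewind M2"
  have M3: "M3 = M2(10 := n, 8 := 2 ^ n, 31 := 0)"
    using c2 sm by (simp add: M3_def rewind_def sem_seqs)
  obtain t3 where t3: "t3 \<le> cost rewind" "runs w rewind M2 t3 M3 []"
    unfolding M3_def using runs_sem[OF plain_gen_init(2)] by blast
  have p3: "prepared M3" using p2 by (rule prepared_frame) (auto simp: M3)
  have arr3: "M3 (arr + 2 ^ j) = partner D (n - j)" if "j < n" for j
    using part[of "n - j"] that by (simp add: M3 arr_def tab_def)
  obtain t4 M4 where t4: "t4 \<le> 10 * n + 1"
    "runs w (While 10 emit) M3 t4 M4 (map (\<lambda>j. partner D (n - j)) (rev [0..<n]))" "prepared M4"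
    using emit_runs[of M3 n "\<lambda>j. partner D (n - j)"] p3 arr3 by (auto simp: M3)
  have "map (\<lambda>j. partner D (n - j)) (rev [0..<n]) = encode n D"
    unfolding encode_def by (intro nth_equalityI) (auto simp: rev_nth simp del: upt_Suc)
  then have "runs w (Seq (gen_init K) (Seq (While 10 (gen_step K)) (Seq rewind (While 10 emit)))) M
      (1 + t1 + (1 + t2 + (1 + t3 + t4))) M4 (encode n D)"
    using runs_Seq[OF t1(2) runs_Seq[OF t2(2) runs_Seq[OF t3(2) t4(2)]]] by simp
  then show ?thesis using t1(1) t2(1) t3(1) t4(1,3) unfolding D_def
    by (intro exI[of _ "1 + t1 + (1 + t2 + (1 + t3 + t4))"] conjI exI[of _ M4]) auto
qed

lemma generate_correct:
  assumes "prepared M"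
    and T: "cost (gen_init K) + (n * (cost (gen_step K) + 1) + 1) + cost rewind + (10 * n + 1) + 7 \<le> T"
  shows "s \<in> set_pmf (run w (generate K) M T) \<Longrightarrow> code s = [] \<and> prepared (mem s)"
    and "map_pmf out (run w (generate K) M T) = pmf_of_set (encode n ` nc_matchings (Suc K) n)"
proof -
  let ?N = "count n origin"
  have "M 17 = tab + (n * base ^ K + origin)" "M (tab + (n * base ^ K + origin)) = ?N"
    using assms(1) origin_less by (auto simp: prepared_def)
  then have pre: "runs w (Load 14 17) M 1 (M(14 := ?N)) []" by (intro runs_atom) simp
  have prep: "prepared (M(14 := ?N, 7 := u))" for u using assms(1) by (rule prepared_frame) auto
  have post: "\<exists>t\<le>cost (gen_init K) + (n * (cost (gen_step K) + 1) + 1) + cost rewind + (10 * n + 1) + 3.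
    \<exists>M'. runs w (Seq (gen_init K) (Seq (While 10 (gen_step K)) (Seq rewind (While 10 emit))))
      ((M(14 := ?N))(7 := u)) t M' (encode n (outcome u)) \<and> M' \<in> {M. prepared M}" if "u < ?N" for u
    using generate_runs[OF prep _ that] by simp
  have "(M(14 := ?N)) 14 = ?N" by simp
  note s = run_sampling[OF pre this count_pos post, folded generate_def, where T = T]
  show "s \<in> set_pmf (run w (generate K) M T) \<Longrightarrow> code s = [] \<and> prepared (mem s)"
    using s(2)[where s = s] T by simp
  have bij: "bij_betw outcome {..<?N} (nc_matchings (Suc K) n)"
    using unrank_matching_bij by (simp add: outcome_def[abs_def])
  have "inj_on (\<lambda>u. encode n (outcome u)) {..<?N}"
  proof (rule inj_onI)
    fix u v assume uv: "u \<in> {..<?N}" "v \<in> {..<?N}" "encode n (outcome u) = encode n (outcome v)"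
    then have "partial_matching n (outcome u)" "partial_matching n (outcome v)"
      using bij_betw_apply[OF bij] by (auto simp: nc_matchings_def)
    then have "outcome u = outcome v" using inj_onD[OF encode_inj uv(3)] by simp
    then show "u = v" using bij_betw_imp_inj_on[OF bij] uv by (auto dest: inj_onD)
  qed
  then have "map_pmf (\<lambda>u. encode n (outcome u)) (pmf_of_set {..<?N}) =
      pmf_of_set ((\<lambda>u. encode n (outcome u)) ` {..<?N})"
    using count_pos by (intro map_pmf_of_set_inj) auto
  also have "(\<lambda>u. encode n (outcome u)) ` {..<?N} = encode n ` nc_matchings (Suc K) n"
    using bij_betw_imp_surj_on[OF bij] by (simp add: image_image[symmetric])
  finally show "map_pmf out (run w (generate K) M T) = pmf_of_set (encode n ` nc_matchings (Suc K) n)"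
    using s(1) T by simp
qed

lemma encode_nc_matchings:
  "finite (encode n ` nc_matchings (Suc K) n)" "encode n ` nc_matchings (Suc K) n \<noteq> {}"
  "card (encode n ` nc_matchings (Suc K) n) = fstar (Suc K) n"
proof -
  have "inj_on (encode n) (nc_matchings (Suc K) n)"
    by (rule inj_on_subset[OF encode_inj]) (auto simp: nc_matchings_def)
  then show card: "card (encode n ` nc_matchings (Suc K) n) = fstar (Suc K) n"
    by (simp add: card_image fstar_def)
  then have "card (encode n ` nc_matchings (Suc K) n) > 0" using count_pos card_nc_matchings by simp
  then show "finite (encode n ` nc_matchings (Suc K) n)" "encode n ` nc_matchings (Suc K) n \<noteq> {}"
    by (auto simp: card_gt_0_iff)
qed

end

lemma word_length_suffices: "machine K n ((2 * K + 8) * (n + 1))"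
proof
  define X :: nat where "X = 2 ^ (n + 1)"
  have X: "X \<ge> 2" using power_increasing[of 1 "n + 1" "2::nat"] by (simp add: X_def)
  have small: "x + 1 \<le> 2 ^ x" for x :: nat by (induction x) auto
  have mono: "X ^ a \<le> X ^ b" if "a \<le> b" for a b using that X by (intro power_increasing) auto
  have n2: "n + 2 \<le> X" using small[of "n + 1"] by (simp add: X_def)
  have "n + 3 \<le> X * 2" using n2 by simp
  also have "\<dots> \<le> X * X" using X by (intro mult_le_mono) auto
  finally have "(n + 3) ^ K \<le> (X * X) ^ K" by (intro power_mono) auto
  then have "(n + 2) * (n + 3) ^ K \<le> X * (X * X) ^ K" using n2 by (intro mult_le_mono)
  also have "\<dots> = X ^ (2 * K + 1)" by (simp add: power_mult power2_eq_square)
  also have "\<dots> \<le> X ^ (2 * K + 5)" by (intro mono) simp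
  finally have 1: "(n + 2) * (n + 3) ^ K \<le> X ^ (2 * K + 5)" .
  have "32 + 2 * K \<le> 32 * 2 ^ K" using small[of K] by simp
  also have "\<dots> = 2 ^ (K + 5)" by (simp add: power_add)
  also have "\<dots> \<le> X ^ (K + 5)" using X by (intro power_mono) auto
  also have "\<dots> \<le> X ^ (2 * K + 5)" by (intro mono) simp
  finally have 2: "32 + 2 * K \<le> X ^ (2 * K + 5)" .
  have "(2 * K + 1) ^ (n + 1) \<le> (2 ^ (2 * K)) ^ (n + 1)" using small[of "2 * K"] by (intro power_mono) auto
  also have "\<dots> = X ^ (2 * K)" by (simp only: X_def power_mult[symmetric] mult.commute)
  also have "\<dots> \<le> X ^ (2 * K + 5)" by (intro mono) simp
  finally have 3: "(2 * K + 1) ^ (n + 1) \<le> X ^ (2 * K + 5)" .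
  have 4: "2 ^ (n + 1) \<le> X ^ (2 * K + 5)" using mono[of 1 "2 * K + 5"] by (simp add: X_def)
  have "8 * X ^ (2 * K + 5) \<le> X ^ 3 * X ^ (2 * K + 5)"
    using power_mono[of 2 X 3] X by (intro mult_le_mono1) simp
  also have "\<dots> = X ^ (2 * K + 8)" by (simp flip: power_add add: add.commute)
  also have "\<dots> = 2 ^ ((2 * K + 8) * (n + 1))" by (simp only: X_def power_mult[symmetric] mult.commute)
  finally have 5: "8 * X ^ (2 * K + 5) \<le> 2 ^ ((2 * K + 8) * (n + 1))" .
  have "0 < X ^ (2 * K + 5)" using X by simp
  with 1 2 3 4 5
  show "32 + 2 * K + (n + 2) * walk_graph.base n ^ K + 2 ^ (n + 1) + (2 * K + 1) ^ (n + 1)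
    < 2 ^ ((2 * K + 8) * (n + 1))"
    unfolding walk_graph.base_def by linarith
qed

lemma bigo_power_nat:
  assumes "\<And>n. n \<ge> 1 \<Longrightarrow> f n \<le> C * n ^ j"
  shows "(\<lambda>n. real (f n)) \<in> O(\<lambda>n. real n ^ j)"
proof (rule bigoI)
  show "\<forall>\<^sub>F n in sequentially. norm (real (f n)) \<le> real C * norm (real n ^ j)"
    using eventually_ge_at_top[of 1]
  proof eventually_elim
    case (elim n)
    then have "real (f n) \<le> real (C * n ^ j)" using assms of_nat_mono by blast
    then show ?case by simp
  qed
qed

theorem theorem2:
  fixes k :: nat
  assumes "k \<ge> 2"
  shows "\<exists>(P :: com) (G :: com) (c :: nat)
           (Tp :: nat \<Rightarrow> nat) (Sp :: nat \<Rightarrow> nat) (Tg :: nat \<Rightarrow> nat) (Sg :: nat \<Rightarrow> nat).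
     c > 0 \<and>
     (\<lambda>n. real (Tp n)) \<in> O(\<lambda>n. real n ^ (k + 1)) \<and>
     (\<lambda>n. real (Sp n)) \<in> O(\<lambda>n. real n ^ k) \<and>
     (\<lambda>n. real (Tg n)) \<in> O(\<lambda>n. real n) \<and>
     (\<lambda>n. real (Sg n)) \<in> O(\<lambda>n. real n) \<and>
     (\<forall>n. runs_within (c * (n + 1)) P (input n) (Tp n) (Sp n) \<and>
       (\<forall>M \<in> ready (c * (n + 1)) P G n.
          runs_within (c * (n + 1)) G M (Tg n) (Sg n) \<and>
          set_pmf (map_pmf out (run (c * (n + 1)) G M (Tg n))) \<subseteq> encode n ` nc_matchings k n \<and>
          (\<forall>\<mu> \<in> nc_matchings k n.
             pmf (map_pmf out (run (c * (n + 1)) G M (Tg n))) (encode n \<mu>) = 1 / real (fstar k n))))"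
proof -
  define K where "K = k - 1"
  have k: "k = Suc K" using assms by (simp add: K_def)
  define c where "c = 2 * K + 8"
  define Tp where "Tp = (\<lambda>n. 3 + cost (setup1 K) + cost (setup2 K) + (n * (cost double + 1) + 1) +
      (n * (n + 3) ^ K * (cost (fill_step K) + 1) + 1))"
  define Tg where "Tg = (\<lambda>n. cost (gen_init K) + (n * (cost (gen_step K) + 1) + 1) + cost rewind + (10 * n + 1) + 7)"
  define Cp where "Cp = 3 + cost (setup1 K) + cost (setup2 K) + (cost double + 2) + (4 ^ K * (cost (fill_step K) + 1) + 1)"
  define Cg where "Cg = cost (gen_init K) + cost (gen_step K) + cost rewind + 20"
  have Tp: "Tp n \<le> Cp * n ^ k" if "n \<ge> 1" for n
  proof -
    have p: "1 \<le> n ^ k" "n \<le> n ^ k" using that by (auto simp: k)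
    have "(n + 3) ^ K \<le> (4 * n) ^ K" using that by (intro power_mono) auto
    then have "n * (n + 3) ^ K * (cost (fill_step K) + 1) \<le> n * (4 * n) ^ K * (cost (fill_step K) + 1)"
      by (intro mult_le_mono) auto
    also have "\<dots> = 4 ^ K * (cost (fill_step K) + 1) * n ^ k" by (simp add: k power_mult_distrib algebra_simps)
    finally have f: "n * (n + 3) ^ K * (cost (fill_step K) + 1) \<le> 4 ^ K * (cost (fill_step K) + 1) * n ^ k" .
    have d: "n * (cost double + 1) \<le> (cost double + 1) * n ^ k" using mult_le_mono2[OF p(2), of "cost double + 1"] by (simp only: mult.commute)
    have s: "a \<le> a * n ^ k" for a using p by simp
    show ?thesis using f d s[of "3 + cost (setup1 K) + cost (setup2 K) + 2"]
      unfolding Tp_def Cp_def by (simp add: algebra_simps)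
  qed
  have Tg: "Tg n \<le> Cg * n ^ 1" if "n \<ge> 1" for n
  proof -
    have "a \<le> a * n" for a using that by simp
    from this[of "cost (gen_init K) + cost rewind + 9"] show ?thesis
      unfolding Tg_def Cg_def by (simp add: algebra_simps)
  qed
  have mach: "runs_within (c * (n + 1)) (preprocess K) (input n) (Tp n) (3 * Tp n) \<and>
      (\<forall>M \<in> ready (c * (n + 1)) (preprocess K) (generate K) n.
         runs_within (c * (n + 1)) (generate K) M (Tg n) (3 * Tg n) \<and>
         set_pmf (map_pmf out (run (c * (n + 1)) (generate K) M (Tg n))) \<subseteq> encode n ` nc_matchings k n \<and>
         (\<forall>\<mu> \<in> nc_matchings k n. pmf (map_pmf out (run (c * (n + 1)) (generate K) M (Tg n))) (encode n \<mu>) =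
            1 / real (fstar k n)))" for n
  proof -
    define w where "w = c * (n + 1)"
    interpret machine K n w unfolding w_def c_def by (rule word_length_suffices)
    obtain t M0 where t: "t \<le> Tp n" "runs w (preprocess K) (input n) t M0 []" "prepared M0"
      using preprocess_runs by (auto simp: Tp_def base_def)
    obtain U where P: "run w (preprocess K) (input n) (Tp n) = return_pmf \<lparr>code = [], mem = M0, used = U, out = []\<rparr>"
      unfolding run_def using runs_halts[OF t(2,1), of "{}" "[]"] by auto
    have gen: "\<And>s. s \<in> set_pmf (run w (generate K) M (Tg n)) \<Longrightarrow> code s = [] \<and> prepared (mem s)"
      "map_pmf out (run w (generate K) M (Tg n)) = pmf_of_set (encode n ` nc_matchings k n)"
      if "prepared M" for M
      using generate_correct[OF that, of "Tg n"] by (auto simp: Tg_def k)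
    have "prepared M" if "M \<in> ready w (preprocess K) (generate K) n" for M
      using that
    proof induction
      case (preprocessed M)
      then show ?case using final_mems_subset[of w "preprocess K" "input n" "Tp n" "{M. prepared M}"] t(3) P by auto
    next
      case (generated M M')
      then show ?case using final_mems_subset[of w "generate K" M "Tg n" "{M. prepared M}"] gen(1)[of M] by auto
    qed
    then have "runs_within w (generate K) M (Tg n) (3 * Tg n) \<and>
         set_pmf (map_pmf out (run w (generate K) M (Tg n))) \<subseteq> encode n ` nc_matchings k n \<and>
         (\<forall>\<mu> \<in> nc_matchings k n. pmf (map_pmf out (run w (generate K) M (Tg n))) (encode n \<mu>) =
            1 / real (fstar k n))" if "M \<in> ready w (preprocess K) (generate K) n" for M
      using gen[of M] that encode_nc_matchings runs_withinI[of w "generate K" M "Tg n"]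
      by (simp add: k)
    moreover have "runs_within w (preprocess K) (input n) (Tp n) (3 * Tp n)"
      by (rule runs_withinI) (simp add: P)
    ultimately show ?thesis unfolding w_def by blast
  qed
  show ?thesis
  proof (rule exI[of _ "preprocess K"], rule exI[of _ "generate K"], rule exI[of _ c], rule exI[of _ Tp],
      rule exI[of _ "\<lambda>n. 3 * Tp n"], rule exI[of _ Tg], rule exI[of _ "\<lambda>n. 3 * Tg n"], intro conjI allI)
    show "c > 0" by (simp add: c_def)
    have "Tp n \<le> Cp * n ^ (k + 1)" if "n \<ge> 1" for n
    proof -
      have "n ^ k \<le> n ^ (k + 1)" using that by (intro power_increasing) auto
      then have "Cp * n ^ k \<le> Cp * n ^ (k + 1)" by (rule mult_le_mono2)
      then show ?thesis using Tp[OF that] by linarith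
    qed
    then show "(\<lambda>n. real (Tp n)) \<in> O(\<lambda>n. real n ^ (k + 1))" by (rule bigo_power_nat)
    show "(\<lambda>n. real (3 * Tp n)) \<in> O(\<lambda>n. real n ^ k)"
      by (rule bigo_power_nat[where C = "3 * Cp"]) (use Tp in simp)
    show "(\<lambda>n. real (Tg n)) \<in> O(\<lambda>n. real n)"
      using bigo_power_nat[where j = 1 and f = Tg, OF Tg] by simp
    show "(\<lambda>n. real (3 * Tg n)) \<in> O(\<lambda>n. real n)"
      using bigo_power_nat[where j = 1 and f = "\<lambda>n. 3 * Tg n" and C = "3 * Cg"] Tg by simp
  qed (use mach in blast)+
qed

end
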